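(* Let $\mathfrak{C}$ be a non-empty set. Let $(\mathcal{E},\otimes,I)$ be a strongly cofibrantly generated symmetric monoidal model category with a zero object and with a symmetric monoidal fibrant replacement functor, and suppose that $\mathcal{E}$ has either a cofibrant unit $I$ and a cocommutative interval, or functorial path data. Let $\mathsf{P}$ be a cofibrant $\mathfrak{C}$-colored PROP in $\mathcal{E}$, and let $f=\{f_c\colon X_c\to Y_c\}_{c\in\mathfrak{C}}$ be a collection of maps in $\mathcal{E}$. For a $\mathfrak{C}$-profile $\underline{c}=(c_1,\ldots,c_n)$ write $X_{\underline{c}}=X_{c_1}\otimes\cdots\otimes X_{c_n}$, and similarly for $Y_{\underline{c}}$ and $f_{\underline{c}}$. Then: (1) Suppose that for all $\mathfrak{C}$-profiles $\underline{c}$ the object $Y_{\underline{c}}$ is fibrant and the map $f_{\underline{c}}\colon X_{\underline{c}}\to Y_{\underline{c}}$ is an acyclic cofibration. Then for any $\mathsf{P}$-algebra structure on $X=\{X_c\}$ there is a $\mathsf{P}$-algebra structure on $Y=\{Y_c\}$ such that $f$ is a morphism of $\mathsf{P}$-algebras. (2) Suppose that for all $\mathfrak{C}$-profiles $\underline{c}$ the object $X_{\underline{c}}$ is cofibrant and the map $f_{\underline{c}}\colon X_{\underline{c}}\to Y_{\underline{c}}$ is an acyclic fibration. Then for any $\mathsf{P}$-algebra structure on $Y=\{Y_c\}$ there is a $\mathsf{P}$-algebra structure on $X=\{X_c\}$ such that $f$ is a morphism of $\mathsf{P}$-algebras.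
   Context: **Model categories.** A symmetric monoidal model category is a closed symmetric monoidal category with a model structure satisfying the pushout-product axiom; it has all small limits and colimits. Internal homs are written $Y^X$. A model category is *strongly cofibrantly generated* if there are sets of maps $K_1$ and $K_2$ such that (i) a map is an acyclic fibration (resp. fibration) iff it has the right lifting property with respect to every map in $K_1$ (resp. $K_2$), and (ii) each source $A$ of a map in $K_1$ or $K_2$ is small: there is a cardinal $\kappa_A$ such that for every regular cardinal $\lambda\ge\kappa_A$ and every $\lambda$-sequence $X$, the map $\operatorname{colim}_{\beta<\lambda}\mathcal{E}(A,X_\beta)\to\mathcal{E}(A,\operatorname{colim}_{\beta<\lambda}X_\beta)$ is a bijection. **Hypotheses on $\mathcal{E}$.** A *symmetric monoidal fibrant replacement functor* is a (lax) symmetric monoidal endofunctor $Q$ of $\mathcal{E}$ with a monoidal natural transformation $\mathrm{Id}\to Q$ that is a natural weak equivalence with $QX$ fibrant for all $X$. A *cocommutative interval* is a factorization $I\sqcup I\xrightarrow{\alpha}J\xrightarrow{\beta}I$ of the fold map with $\alpha$ a cofibration, $\beta$ a weak equivalence, $J$ a coassociative cocommutative comonoid, and $\alpha,\beta$ maps of comonoids. *Functorial path data* consists of a (lax) symmetric monoidal functor $Path$ on $\mathcal{E}$ and monoidal natural transformations $s\colon \mathrm{Id}\to Path$, $d_0,d_1\colon Path\to\mathrm{Id}$ such that, whenever $X$ is fibrant, $X\xrightarrow{s}Path(X)\xrightarrow{(d_0,d_1)}X\times X$ is a factorization of the diagonal as a weak equivalence followed by a fibration. **Colored PROPs (without units).**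 A *$\mathfrak{C}$-profile* is a finite non-empty sequence $\underline{c}=(c_1,\ldots,c_n)$ of elements (colors) of $\mathfrak{C}$; $(\underline{c},\underline{d})$ denotes concatenation. $\mathcal{P}_l(\mathfrak{C})$ is the groupoid of profiles whose morphisms $\underline{c}\to\underline{d}$ are the permutations $\sigma$ with $\sigma\underline{c}=\underline{d}$ (left action by permuting entries), and $\mathcal{P}_r(\mathfrak{C})=\mathcal{P}_l(\mathfrak{C})^{op}$. A *$\mathfrak{C}$-colored $\Sigma$-bimodule* is a functor $\mathsf{P}\colon\mathcal{P}_l(\mathfrak{C})\times\mathcal{P}_r(\mathfrak{C})\to\mathcal{E}$; its entries are $\mathsf{P}\binom{\underline{d}}{\underline{c}}$, with structure maps $(\sigma;\tau)\colon\mathsf{P}\binom{\underline{d}}{\underline{c}}\to\mathsf{P}\binom{\sigma\underline{d}}{\underline{c}\tau}$. A *$\mathfrak{C}$-colored PROP* is a $\mathfrak{C}$-colored $\Sigma$-bimodule $\mathsf{P}$ with - associative vertical compositions $\circ\colon\mathsf{P}\binom{\underline{d}}{\underline{b}}\otimes\mathsf{P}\binom{\underline{b}}{\underline{c}}\to\mathsf{P}\binom{\underline{d}}{\underline{c}}$ that are equivariant: $\circ$ commutes with $(\sigma;1)\otimes(1;\mu)$ on the source and $(\sigma;\mu)$ on the target, and $\circ$ equals $(1;\tau^{-1})\otimes(\tau;1)$ (to $\mathsf{P}\binom{\underline{d}}{\underline{b}\tau^{-1}}\otimes\mathsf{P}\binom{\tau\underline{b}}{\underline{c}}$) followed by $\circ$;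 - associative horizontal compositions $\otimes\colon\mathsf{P}\binom{\underline{d}_1}{\underline{c}_1}\otimes\mathsf{P}\binom{\underline{d}_2}{\underline{c}_2}\to\mathsf{P}\binom{\underline{d}_1,\underline{d}_2}{\underline{c}_1,\underline{c}_2}$ that are equivariant for $(\sigma_1;\tau_1)\otimes(\sigma_2;\tau_2)$ and $(\sigma_1\times\sigma_2;\tau_1\times\tau_2)$; - satisfying the interchange rule $(x_1\otimes x_2)\circ(y_1\otimes y_2)=(x_1\circ y_1)\otimes(x_2\circ y_2)$, expressed as a commutative diagram in $\mathcal{E}$ using the symmetry of $\otimes$. Morphisms are maps of $\Sigma$-bimodules preserving both compositions; the category is $\mathbf{PROP}^{\mathfrak{C}}_{\mathcal{E}}$. "Cofibrant" refers to the model structure on $\mathbf{PROP}^{\mathfrak{C}}_{\mathcal{E}}$ (which exists under the stated hypotheses) with fibrations and weak equivalences defined entrywise in $\mathcal{E}$. **Algebras.** For $X=\{X_c\}_{c\in\mathfrak{C}}$, the endomorphism PROP $E_X$ has entries $E_X\binom{\underline{d}}{\underline{c}}=X_{\underline{d}}^{X_{\underline{c}}}$, with permutation of tensor factors as action, tensor product of maps as horizontal composition and composition of maps as vertical composition. A *$\mathsf{P}$-algebra* structure on $X$ is a morphism $\mathsf{P}\to E_X$ of $\mathfrak{C}$-colored PROPs; equivalently a suitable family of maps $\lambda_X\colon\mathsf{P}\binom{\underline{d}}{\underline{c}}\otimes X_{\underline{c}}\to X_{\underline{d}}$. A morphism of $\mathsf{P}$-algebras $X\to Y$ is a collection $f=\{f_c\colon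 X_c\to Y_c\}$ with $f_{\underline{d}}\lambda_X=\lambda_Y(\mathrm{Id}\otimes f_{\underline{c}})$ for all $\underline{d},\underline{c}$. *)

theory Defs
  imports "HOL-Combinatorics.Permutations"
begin

unbundle cardinal_syntax

section \<open>Size\<close>

text \<open>
  ``Small'' is relative to a Grothendieck universe, given by a strongly inaccessible cardinal
  \<open>U\<close>: a set is small if its cardinality is below \<open>U\<close>. Every small set is in
  bijection with a set of elements of the type underlying \<open>U\<close>, so quantification over small
  index categories and small cardinals may be restricted to that type.
\<close>

definition strongly_inaccessible :: "'u rel \<Rightarrow> bool" where
  "strongly_inaccessible U \<longleftrightarrow>
     Card_order U \<and> natLeq <o U \<and> regularCard U \<and>
     (\<forall>A :: 'u set. |A| <o U \<longrightarrow> |Pow A| <o U)"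


section \<open>Categories\<close>

record ('o, 'a) cat =
  Obj :: "'o set"
  Arr :: "'a set"
  Dom :: "'a \<Rightarrow> 'o"
  Cod :: "'a \<Rightarrow> 'o"
  ident :: "'o \<Rightarrow> 'a"
  comp :: "'a \<Rightarrow> 'a \<Rightarrow> 'a"  (infixr "\<cdot>\<index>" 75)

definition hom :: "('o, 'a, 'm) cat_scheme \<Rightarrow> 'o \<Rightarrow> 'o \<Rightarrow> 'a set" where
  "hom C x y = {f \<in> Arr C. Dom C f = x \<and> Cod C f = y}"

locale category =
  fixes C :: "('o, 'a, 'm) cat_scheme" (structure)
  assumes Dom_Obj: "f \<in> Arr C \<Longrightarrow> Dom C f \<in> Obj C"
    and Cod_Obj: "f \<in> Arr C \<Longrightarrow> Cod C f \<in> Obj C"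
    and ident_hom: "x \<in> Obj C \<Longrightarrow> ident C x \<in> hom C x x"
    and comp_hom: "f \<in> hom C x y \<Longrightarrow> g \<in> hom C y z \<Longrightarrow> g \<cdot> f \<in> hom C x z"
    and comp_ident_right: "f \<in> hom C x y \<Longrightarrow> f \<cdot> ident C x = f"
    and comp_ident_left: "f \<in> hom C x y \<Longrightarrow> ident C y \<cdot> f = f"
    and comp_assoc: "f \<in> hom C w x \<Longrightarrow> g \<in> hom C x y \<Longrightarrow> h \<in> hom C y z \<Longrightarrow>
      (h \<cdot> g) \<cdot> f = h \<cdot> (g \<cdot> f)"

record ('o, 'a, 'p, 'b) func =
  omap :: "'o \<Rightarrow> 'p"
  amap :: "'a \<Rightarrow> 'b"

context
  fixes C :: "('o, 'a, 'm) cat_scheme" (structure)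
begin

definition inverse_arrows :: "'a \<Rightarrow> 'a \<Rightarrow> bool" where
  "inverse_arrows f g \<longleftrightarrow> f \<in> Arr C \<and> g \<in> hom C (Cod C f) (Dom C f) \<and>
     g \<cdot> f = ident C (Dom C f) \<and> f \<cdot> g = ident C (Cod C f)"

definition iso :: "'a \<Rightarrow> bool" where
  "iso f \<longleftrightarrow> (\<exists>g. inverse_arrows f g)"

definition inv_arr :: "'a \<Rightarrow> 'a" where
  "inv_arr f = (THE g. inverse_arrows f g)"

definition initial :: "'o \<Rightarrow> bool" where
  "initial z \<longleftrightarrow> z \<in> Obj C \<and> (\<forall>x \<in> Obj C. \<exists>!f. f \<in> hom C z x)"

definition terminal :: "'o \<Rightarrow> bool" where
  "terminal z \<longleftrightarrow> z \<in> Obj C \<and> (\<forall>x \<in> Obj C. \<exists>!f. f \<in> hom C x z)"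

definition zero_object :: "'o \<Rightarrow> bool" where
  "zero_object z \<longleftrightarrow> initial z \<and> terminal z"

definition is_product :: "'o \<Rightarrow> 'o \<Rightarrow> 'o \<Rightarrow> 'a \<Rightarrow> 'a \<Rightarrow> bool" where
  "is_product x y p p0 p1 \<longleftrightarrow> p0 \<in> hom C p x \<and> p1 \<in> hom C p y \<and>
     (\<forall>z. \<forall>f \<in> hom C z x. \<forall>g \<in> hom C z y. \<exists>!h. h \<in> hom C z p \<and> p0 \<cdot> h = f \<and> p1 \<cdot> h = g)"

definition is_coproduct :: "'o \<Rightarrow> 'o \<Rightarrow> 'o \<Rightarrow> 'a \<Rightarrow> 'a \<Rightarrow> bool" where
  "is_coproduct x y s i0 i1 \<longleftrightarrow> i0 \<in> hom C x s \<and> i1 \<in> hom C y s \<and>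
     (\<forall>z. \<forall>f \<in> hom C x z. \<forall>g \<in> hom C y z. \<exists>!h. h \<in> hom C s z \<and> h \<cdot> i0 = f \<and> h \<cdot> i1 = g)"

definition is_pushout :: "'a \<Rightarrow> 'a \<Rightarrow> 'a \<Rightarrow> 'a \<Rightarrow> bool" where
  "is_pushout f g p q \<longleftrightarrow> f \<in> Arr C \<and> g \<in> Arr C \<and> p \<in> Arr C \<and> q \<in> Arr C \<and>
     Dom C f = Dom C g \<and> Dom C p = Cod C f \<and> Dom C q = Cod C g \<and> Cod C p = Cod C q \<and>
     p \<cdot> f = q \<cdot> g \<and>
     (\<forall>z. \<forall>u \<in> hom C (Cod C f) z. \<forall>v \<in> hom C (Cod C g) z. u \<cdot> f = v \<cdot> g \<longrightarrow>
        (\<exists>!h. h \<in> hom C (Cod C p) z \<and> h \<cdot> p = u \<and> h \<cdot> q = v))"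

definition lifts :: "'a \<Rightarrow> 'a \<Rightarrow> bool" where
  \<comment> \<open>\<open>i\<close> has the left lifting property with respect to \<open>p\<close>\<close>
  "lifts i p \<longleftrightarrow>
     (\<forall>u \<in> hom C (Dom C i) (Dom C p). \<forall>v \<in> hom C (Cod C i) (Cod C p). p \<cdot> u = v \<cdot> i \<longrightarrow>
        (\<exists>h \<in> hom C (Cod C i) (Dom C p). h \<cdot> i = u \<and> p \<cdot> h = v))"

definition retract_of :: "'a \<Rightarrow> 'a \<Rightarrow> bool" where
  "retract_of f g \<longleftrightarrow> f \<in> Arr C \<and> g \<in> Arr C \<and>
     (\<exists>i \<in> hom C (Dom C f) (Dom C g). \<exists>r \<in> hom C (Dom C g) (Dom C f).
      \<exists>j \<in> hom C (Cod C f) (Cod C g). \<exists>s \<in> hom C (Cod C g) (Cod C f).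
        r \<cdot> i = ident C (Dom C f) \<and> s \<cdot> j = ident C (Cod C f) \<and>
        g \<cdot> i = j \<cdot> f \<and> f \<cdot> r = s \<cdot> g)"

end

definition is_functor ::
  "('o, 'a, 'm) cat_scheme \<Rightarrow> ('p, 'b, 'n) cat_scheme \<Rightarrow> ('o, 'a, 'p, 'b, 'k) func_scheme \<Rightarrow> bool" where
  "is_functor C D F \<longleftrightarrow>
     (\<forall>x \<in> Obj C. omap F x \<in> Obj D) \<and>
     (\<forall>x y. \<forall>f \<in> hom C x y. amap F f \<in> hom D (omap F x) (omap F y)) \<and>
     (\<forall>x \<in> Obj C. amap F (ident C x) = ident D (omap F x)) \<and>
     (\<forall>x y z. \<forall>f \<in> hom C x y. \<forall>g \<in> hom C y z.
        amap F (comp C g f) = comp D (amap F g) (amap F f))"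

definition is_nat_trans ::
  "('o, 'a, 'm) cat_scheme \<Rightarrow> ('p, 'b, 'n) cat_scheme \<Rightarrow>
   ('o, 'a, 'p, 'b, 'k) func_scheme \<Rightarrow> ('o, 'a, 'p, 'b, 'l) func_scheme \<Rightarrow> ('o \<Rightarrow> 'b) \<Rightarrow> bool" where
  "is_nat_trans C D F G t \<longleftrightarrow>
     (\<forall>x \<in> Obj C. t x \<in> hom D (omap F x) (omap G x)) \<and>
     (\<forall>x y. \<forall>f \<in> hom C x y. comp D (t y) (amap F f) = comp D (amap G f) (t x))"

context
  fixes J :: "('i, 'j, 'n) cat_scheme" and C :: "('o, 'a, 'm) cat_scheme" (structure)
    and F :: "('i, 'j, 'o, 'a) func"
begin

definition is_cocone :: "'o \<Rightarrow> ('i \<Rightarrow> 'a) \<Rightarrow> bool" where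
  "is_cocone L k \<longleftrightarrow> L \<in> Obj C \<and> (\<forall>j \<in> Obj J. k j \<in> hom C (omap F j) L) \<and>
     (\<forall>u \<in> Arr J. k (Cod J u) \<cdot> amap F u = k (Dom J u))"

definition is_cone :: "'o \<Rightarrow> ('i \<Rightarrow> 'a) \<Rightarrow> bool" where
  "is_cone L k \<longleftrightarrow> L \<in> Obj C \<and> (\<forall>j \<in> Obj J. k j \<in> hom C L (omap F j)) \<and>
     (\<forall>u \<in> Arr J. amap F u \<cdot> k (Dom J u) = k (Cod J u))"

definition is_colimit :: "'o \<Rightarrow> ('i \<Rightarrow> 'a) \<Rightarrow> bool" where
  "is_colimit L k \<longleftrightarrow> is_cocone L k \<and>
     (\<forall>M m. is_cocone M m \<longrightarrow> (\<exists>!h. h \<in> hom C L M \<and> (\<forall>j \<in> Obj J. h \<cdot> k j = m j)))"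

definition is_limit :: "'o \<Rightarrow> ('i \<Rightarrow> 'a) \<Rightarrow> bool" where
  "is_limit L k \<longleftrightarrow> is_cone L k \<and>
     (\<forall>M m. is_cone M m \<longrightarrow> (\<exists>!h. h \<in> hom C M L \<and> (\<forall>j \<in> Obj J. k j \<cdot> h = m j)))"

end

definition small_category :: "'u rel \<Rightarrow> ('i, 'j) cat \<Rightarrow> bool" where
  "small_category U J \<longleftrightarrow> category J \<and> |Obj J| <o U \<and> |Arr J| <o U"

definition locally_small :: "'u rel \<Rightarrow> ('o, 'a, 'm) cat_scheme \<Rightarrow> bool" where
  "locally_small U C \<longleftrightarrow> (\<forall>x \<in> Obj C. \<forall>y \<in> Obj C. |hom C x y| <o U)"

definition complete :: "'u rel \<Rightarrow> ('o, 'a, 'm) cat_scheme \<Rightarrow> bool" where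
  "complete U C \<longleftrightarrow> (\<forall>(J :: ('u, 'u) cat) F. small_category U J \<and> is_functor J C F \<longrightarrow>
     (\<exists>L k. is_limit J C F L k))"

definition cocomplete :: "'u rel \<Rightarrow> ('o, 'a, 'm) cat_scheme \<Rightarrow> bool" where
  "cocomplete U C \<longleftrightarrow> (\<forall>(J :: ('u, 'u) cat) F. small_category U J \<and> is_functor J C F \<longrightarrow>
     (\<exists>L k. is_colimit J C F L k))"


section \<open>Transfinite sequences and small objects\<close>

definition order_cat :: "'i rel \<Rightarrow> ('i, 'i \<times> 'i) cat" where
  "order_cat r = \<lparr>Obj = Field r, Arr = r, Dom = fst, Cod = snd,
     ident = (\<lambda>x. (x, x)), comp = (\<lambda>v u. (fst u, snd v))\<rparr>"

definition limit_elem :: "'i rel \<Rightarrow> 'i \<Rightarrow> bool" where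
  "limit_elem r b \<longleftrightarrow> b \<in> Field r \<and> underS r b \<noteq> {} \<and>
     (\<forall>a \<in> underS r b. \<exists>a' \<in> underS r b. a \<noteq> a' \<and> (a, a') \<in> r)"

definition is_sequence ::
  "'i rel \<Rightarrow> ('o, 'a, 'm) cat_scheme \<Rightarrow> ('i, 'i \<times> 'i, 'o, 'a) func \<Rightarrow> bool" where
  "is_sequence r C X \<longleftrightarrow> is_functor (order_cat r) C X \<and>
     (\<forall>b. limit_elem r b \<longrightarrow>
        is_colimit (order_cat (Restr r (underS r b))) C X (omap X b) (\<lambda>a. amap X (a, b)))"

text \<open>
  The colimit in sets of \<open>\<beta> \<mapsto> hom C A (X \<beta>)\<close> is the quotient of the disjoint union by
  the equivalence relation generated by \<open>(\<beta>, f) \<sim> (\<gamma>, X(\<beta>\<le>\<gamma>) \<cdot> f)\<close>.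
\<close>

context
  fixes r :: "'i rel" and C :: "('o, 'a, 'm) cat_scheme" (structure)
    and X :: "('i, 'i \<times> 'i, 'o, 'a) func" and A :: 'o
begin

definition hom_sum :: "('i \<times> 'a) set" where
  "hom_sum = (SIGMA b : Field r. hom C A (omap X b))"

definition hom_step :: "('i \<times> 'a) rel" where
  "hom_step = {((b, f), (c, amap X (b, c) \<cdot> f)) | b c f. (b, c) \<in> r \<and> f \<in> hom C A (omap X b)}"

definition hom_colim :: "('i \<times> 'a) set set" where
  "hom_colim = hom_sum // ((hom_step \<union> hom_step\<inverse>)\<^sup>* \<inter> hom_sum \<times> hom_sum)"

definition hom_colim_map :: "('i \<Rightarrow> 'a) \<Rightarrow> ('i \<times> 'a) set \<Rightarrow> 'a" where
  "hom_colim_map k K = the_elem ((\<lambda>(b, f). k b \<cdot> f) ` K)"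

end

definition small_object :: "'u rel \<Rightarrow> ('o, 'a, 'm) cat_scheme \<Rightarrow> 'o \<Rightarrow> bool" where
  "small_object U C A \<longleftrightarrow> A \<in> Obj C \<and>
     (\<exists>\<kappa> :: 'u rel. Card_order \<kappa> \<and> \<kappa> <o U \<and>
        (\<forall>l :: 'u rel. Card_order l \<and> infinite (Field l) \<and> regularCard l \<and> \<kappa> \<le>o l \<and> l <o U \<longrightarrow>
           (\<forall>X L k. is_sequence l C X \<and> is_colimit (order_cat l) C X L k \<longrightarrow>
              bij_betw (hom_colim_map C k) (hom_colim l C X A) (hom C A L))))"


section \<open>Model categories\<close>

record 'a model_str =
  weq :: "'a set"
  cof :: "'a set"
  fib :: "'a set"

locale model_category = category C
  for U :: "'u rel" and C :: "('o, 'a, 'm) cat_scheme" (structure) and M :: "'a model_str" +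
  assumes locally_small: "locally_small U C"
    and complete: "complete U C"
    and cocomplete: "cocomplete U C"
    and weq_Arr: "weq M \<subseteq> Arr C"
    and cof_Arr: "cof M \<subseteq> Arr C"
    and fib_Arr: "fib M \<subseteq> Arr C"
    and weq_comp: "f \<in> hom C x y \<Longrightarrow> g \<in> hom C y z \<Longrightarrow>
      f \<in> weq M \<Longrightarrow> g \<in> weq M \<Longrightarrow> g \<cdot> f \<in> weq M"
    and weq_cancel_left: "f \<in> hom C x y \<Longrightarrow> g \<in> hom C y z \<Longrightarrow>
      g \<in> weq M \<Longrightarrow> g \<cdot> f \<in> weq M \<Longrightarrow> f \<in> weq M"
    and weq_cancel_right: "f \<in> hom C x y \<Longrightarrow> g \<in> hom C y z \<Longrightarrow>
      f \<in> weq M \<Longrightarrow> g \<cdot> f \<in> weq M \<Longrightarrow> g \<in> weq M"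
    and weq_retract: "retract_of C f g \<Longrightarrow> g \<in> weq M \<Longrightarrow> f \<in> weq M"
    and cof_retract: "retract_of C f g \<Longrightarrow> g \<in> cof M \<Longrightarrow> f \<in> cof M"
    and fib_retract: "retract_of C f g \<Longrightarrow> g \<in> fib M \<Longrightarrow> f \<in> fib M"
    and acyclic_cof_lifts: "i \<in> cof M \<inter> weq M \<Longrightarrow> p \<in> fib M \<Longrightarrow> lifts C i p"
    and cof_lifts: "i \<in> cof M \<Longrightarrow> p \<in> fib M \<inter> weq M \<Longrightarrow> lifts C i p"
    and factor_acyclic_cof: "f \<in> hom C x y \<Longrightarrow>
      \<exists>z. \<exists>i \<in> hom C x z. \<exists>p \<in> hom C z y. i \<in> cof M \<inter> weq M \<and> p \<in> fib M \<and> f = p \<cdot> i"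
    and factor_acyclic_fib: "f \<in> hom C x y \<Longrightarrow>
      \<exists>z. \<exists>i \<in> hom C x z. \<exists>p \<in> hom C z y. i \<in> cof M \<and> p \<in> fib M \<inter> weq M \<and> f = p \<cdot> i"

definition fibrant :: "('o, 'a, 'm) cat_scheme \<Rightarrow> 'a model_str \<Rightarrow> 'o \<Rightarrow> bool" where
  "fibrant C M x \<longleftrightarrow> x \<in> Obj C \<and> (\<exists>t. terminal C t \<and> (\<exists>f \<in> hom C x t. f \<in> fib M))"

definition cofibrant :: "('o, 'a, 'm) cat_scheme \<Rightarrow> 'a model_str \<Rightarrow> 'o \<Rightarrow> bool" where
  "cofibrant C M x \<longleftrightarrow> x \<in> Obj C \<and> (\<exists>z. initial C z \<and> (\<exists>f \<in> hom C z x. f \<in> cof M))"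

definition strongly_cofibrantly_generated ::
  "'u rel \<Rightarrow> ('o, 'a, 'm) cat_scheme \<Rightarrow> 'a model_str \<Rightarrow> bool" where
  "strongly_cofibrantly_generated U C M \<longleftrightarrow>
     (\<exists>K1 K2. K1 \<subseteq> Arr C \<and> K2 \<subseteq> Arr C \<and> |K1| <o U \<and> |K2| <o U \<and>
        (\<forall>p \<in> Arr C. p \<in> fib M \<inter> weq M \<longleftrightarrow> (\<forall>i \<in> K1. lifts C i p)) \<and>
        (\<forall>p \<in> Arr C. p \<in> fib M \<longleftrightarrow> (\<forall>i \<in> K2. lifts C i p)) \<and>
        (\<forall>i \<in> K1 \<union> K2. small_object U C (Dom C i)))"


section \<open>Closed symmetric monoidal categories\<close>

text \<open>\<open>ihom E X Y\<close> is the internal hom \<open>Y\<^sup>X\<close>, with evaluation \<open>ihom E X Y \<otimes> X \<rightarrow> Y\<close>;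
  \<open>\<odot>\<close> is the tensor product of arrows.\<close>

record ('o, 'a) smc = "('o, 'a) cat" +
  tensor_obj :: "'o \<Rightarrow> 'o \<Rightarrow> 'o"  (infix "\<otimes>\<index>" 80)
  tensor_arr :: "'a \<Rightarrow> 'a \<Rightarrow> 'a"  (infix "\<odot>\<index>" 80)
  tunit :: 'o
  assoc :: "'o \<Rightarrow> 'o \<Rightarrow> 'o \<Rightarrow> 'a"
  lunit :: "'o \<Rightarrow> 'a"
  runit :: "'o \<Rightarrow> 'a"
  symm :: "'o \<Rightarrow> 'o \<Rightarrow> 'a"
  ihom :: "'o \<Rightarrow> 'o \<Rightarrow> 'o"
  ev :: "'o \<Rightarrow> 'o \<Rightarrow> 'a"

locale closed_symmetric_monoidal_category = category E
  for E :: "('o, 'a) smc" (structure) +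
  assumes tensor_Obj: "x \<in> Obj E \<Longrightarrow> y \<in> Obj E \<Longrightarrow> x \<otimes> y \<in> Obj E"
    and tensor_hom: "f \<in> hom E x y \<Longrightarrow> g \<in> hom E x' y' \<Longrightarrow> f \<odot> g \<in> hom E (x \<otimes> x') (y \<otimes> y')"
    and tensor_ident: "x \<in> Obj E \<Longrightarrow> y \<in> Obj E \<Longrightarrow> ident E x \<odot> ident E y = ident E (x \<otimes> y)"
    and tensor_comp: "f \<in> hom E x y \<Longrightarrow> g \<in> hom E y z \<Longrightarrow> f' \<in> hom E x' y' \<Longrightarrow> g' \<in> hom E y' z' \<Longrightarrow>
      (g \<cdot> f) \<odot> (g' \<cdot> f') = (g \<odot> g') \<cdot> (f \<odot> f')"
    and tunit_Obj: "tunit E \<in> Obj E"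
    and assoc_hom: "x \<in> Obj E \<Longrightarrow> y \<in> Obj E \<Longrightarrow> z \<in> Obj E \<Longrightarrow>
      assoc E x y z \<in> hom E ((x \<otimes> y) \<otimes> z) (x \<otimes> (y \<otimes> z))"
    and assoc_iso: "x \<in> Obj E \<Longrightarrow> y \<in> Obj E \<Longrightarrow> z \<in> Obj E \<Longrightarrow> iso E (assoc E x y z)"
    and assoc_natural: "f \<in> hom E x x' \<Longrightarrow> g \<in> hom E y y' \<Longrightarrow> h \<in> hom E z z' \<Longrightarrow>
      assoc E x' y' z' \<cdot> ((f \<odot> g) \<odot> h) = (f \<odot> (g \<odot> h)) \<cdot> assoc E x y z"
    and lunit_hom: "x \<in> Obj E \<Longrightarrow> lunit E x \<in> hom E (tunit E \<otimes> x) x"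
    and lunit_iso: "x \<in> Obj E \<Longrightarrow> iso E (lunit E x)"
    and lunit_natural: "f \<in> hom E x y \<Longrightarrow> lunit E y \<cdot> (ident E (tunit E) \<odot> f) = f \<cdot> lunit E x"
    and runit_hom: "x \<in> Obj E \<Longrightarrow> runit E x \<in> hom E (x \<otimes> tunit E) x"
    and runit_iso: "x \<in> Obj E \<Longrightarrow> iso E (runit E x)"
    and runit_natural: "f \<in> hom E x y \<Longrightarrow> runit E y \<cdot> (f \<odot> ident E (tunit E)) = f \<cdot> runit E x"
    and symm_hom: "x \<in> Obj E \<Longrightarrow> y \<in> Obj E \<Longrightarrow> symm E x y \<in> hom E (x \<otimes> y) (y \<otimes> x)"
    and symm_natural: "f \<in> hom E x x' \<Longrightarrow> g \<in> hom E y y' \<Longrightarrow>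
      symm E x' y' \<cdot> (f \<odot> g) = (g \<odot> f) \<cdot> symm E x y"
    and symm_symm: "x \<in> Obj E \<Longrightarrow> y \<in> Obj E \<Longrightarrow> symm E y x \<cdot> symm E x y = ident E (x \<otimes> y)"
    and pentagon: "w \<in> Obj E \<Longrightarrow> x \<in> Obj E \<Longrightarrow> y \<in> Obj E \<Longrightarrow> z \<in> Obj E \<Longrightarrow>
      (ident E w \<odot> assoc E x y z) \<cdot> assoc E w (x \<otimes> y) z \<cdot> (assoc E w x y \<odot> ident E z) =
      assoc E w x (y \<otimes> z) \<cdot> assoc E (w \<otimes> x) y z"
    and triangle: "x \<in> Obj E \<Longrightarrow> y \<in> Obj E \<Longrightarrow>
      (ident E x \<odot> lunit E y) \<cdot> assoc E x (tunit E) y = runit E x \<odot> ident E y"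
    and hexagon: "x \<in> Obj E \<Longrightarrow> y \<in> Obj E \<Longrightarrow> z \<in> Obj E \<Longrightarrow>
      assoc E y z x \<cdot> symm E x (y \<otimes> z) \<cdot> assoc E x y z =
      (ident E y \<odot> symm E x z) \<cdot> assoc E y x z \<cdot> (symm E x y \<odot> ident E z)"
    and ihom_Obj: "x \<in> Obj E \<Longrightarrow> y \<in> Obj E \<Longrightarrow> ihom E x y \<in> Obj E"
    and ev_hom: "x \<in> Obj E \<Longrightarrow> y \<in> Obj E \<Longrightarrow> ev E x y \<in> hom E (ihom E x y \<otimes> x) y"
    and ev_universal: "w \<in> Obj E \<Longrightarrow> x \<in> Obj E \<Longrightarrow> y \<in> Obj E \<Longrightarrow> f \<in> hom E (w \<otimes> x) y \<Longrightarrow>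
      \<exists>!g. g \<in> hom E w (ihom E x y) \<and> ev E x y \<cdot> (g \<odot> ident E x) = f"

context
  fixes E :: "('o, 'a) smc" (structure)
begin

definition curry_arr :: "'o \<Rightarrow> 'o \<Rightarrow> 'o \<Rightarrow> 'a \<Rightarrow> 'a" where
  "curry_arr w x y f = (THE g. g \<in> hom E w (ihom E x y) \<and> ev E x y \<cdot> (g \<odot> ident E x) = f)"

definition middle_swap :: "'o \<Rightarrow> 'o \<Rightarrow> 'o \<Rightarrow> 'o \<Rightarrow> 'a" where
  \<comment> \<open>\<open>(w \<otimes> x) \<otimes> (y \<otimes> z) \<rightarrow> (w \<otimes> y) \<otimes> (x \<otimes> z)\<close>\<close>
  "middle_swap w x y z =
     inv_arr E (assoc E w y (x \<otimes> z)) \<cdot>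
     (ident E w \<odot> (assoc E y x z \<cdot> (symm E x y \<odot> ident E z) \<cdot> inv_arr E (assoc E x y z))) \<cdot>
     assoc E w x (y \<otimes> z)"

definition pushout_product_axiom :: "'a model_str \<Rightarrow> bool" where
  "pushout_product_axiom M \<longleftrightarrow>
     (\<forall>f \<in> cof M. \<forall>g \<in> cof M. \<forall>p q h.
        is_pushout E (f \<odot> ident E (Dom E g)) (ident E (Dom E f) \<odot> g) p q \<and>
        h \<in> hom E (Cod E p) (Cod E f \<otimes> Cod E g) \<and>
        h \<cdot> p = ident E (Cod E f) \<odot> g \<and> h \<cdot> q = f \<odot> ident E (Cod E g) \<longrightarrow>
        h \<in> cof M \<and> (f \<in> weq M \<or> g \<in> weq M \<longrightarrow> h \<in> weq M))"

definition is_comonoid :: "'o \<Rightarrow> 'a \<Rightarrow> 'a \<Rightarrow> bool" where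
  "is_comonoid x \<Delta> \<epsilon> \<longleftrightarrow> x \<in> Obj E \<and> \<Delta> \<in> hom E x (x \<otimes> x) \<and> \<epsilon> \<in> hom E x (tunit E) \<and>
     assoc E x x x \<cdot> (\<Delta> \<odot> ident E x) \<cdot> \<Delta> = (ident E x \<odot> \<Delta>) \<cdot> \<Delta> \<and>
     lunit E x \<cdot> (\<epsilon> \<odot> ident E x) \<cdot> \<Delta> = ident E x \<and>
     runit E x \<cdot> (ident E x \<odot> \<epsilon>) \<cdot> \<Delta> = ident E x"

definition is_cocommutative :: "'o \<Rightarrow> 'a \<Rightarrow> bool" where
  "is_cocommutative x \<Delta> \<longleftrightarrow> symm E x x \<cdot> \<Delta> = \<Delta>"

definition is_comonoid_map :: "'o \<Rightarrow> 'a \<Rightarrow> 'a \<Rightarrow> 'o \<Rightarrow> 'a \<Rightarrow> 'a \<Rightarrow> 'a \<Rightarrow> bool" where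
  "is_comonoid_map x \<Delta>x \<epsilon>x y \<Delta>y \<epsilon>y f \<longleftrightarrow>
     f \<in> hom E x y \<and> \<Delta>y \<cdot> f = (f \<odot> f) \<cdot> \<Delta>x \<and> \<epsilon>y \<cdot> f = \<epsilon>x"

text \<open>
  The unit carries its canonical comonoid structure, and \<open>s = I \<squnion> I\<close> the coproduct
  structure, i.e. the unique one making both inclusions comonoid maps.
\<close>

definition has_cocommutative_interval :: "'a model_str \<Rightarrow> bool" where
  "has_cocommutative_interval M \<longleftrightarrow>
     (\<exists>s i0 i1 \<Delta>s \<epsilon>s j \<Delta>j \<epsilon>j \<alpha> \<beta>.
        let I = tunit E; \<Delta>I = inv_arr E (lunit E I); \<epsilon>I = ident E I in
        is_coproduct E I I s i0 i1 \<and>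
        is_comonoid s \<Delta>s \<epsilon>s \<and>
        is_comonoid_map I \<Delta>I \<epsilon>I s \<Delta>s \<epsilon>s i0 \<and> is_comonoid_map I \<Delta>I \<epsilon>I s \<Delta>s \<epsilon>s i1 \<and>
        is_comonoid j \<Delta>j \<epsilon>j \<and> is_cocommutative j \<Delta>j \<and>
        is_comonoid_map s \<Delta>s \<epsilon>s j \<Delta>j \<epsilon>j \<alpha> \<and> is_comonoid_map j \<Delta>j \<epsilon>j I \<Delta>I \<epsilon>I \<beta> \<and>
        \<alpha> \<in> cof M \<and> \<beta> \<in> weq M \<and>
        (\<beta> \<cdot> \<alpha>) \<cdot> i0 = ident E I \<and> (\<beta> \<cdot> \<alpha>) \<cdot> i1 = ident E I)"

end

locale symmetric_monoidal_model_category =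
  closed_symmetric_monoidal_category E + model_category U E M
  for U :: "'u rel" and E :: "('o, 'a) smc" (structure) and M :: "'a model_str" +
  assumes pushout_product: "pushout_product_axiom E M"


section \<open>Lax symmetric monoidal functors\<close>

record ('o, 'a) lax_func = "('o, 'a, 'o, 'a) func" +
  lax_mult :: "'o \<Rightarrow> 'o \<Rightarrow> 'a"
  lax_unit :: 'a

context
  fixes E :: "('o, 'a) smc" (structure)
begin

definition lax_symmetric_monoidal :: "('o, 'a) lax_func \<Rightarrow> bool" where
  "lax_symmetric_monoidal F \<longleftrightarrow> is_functor E E F \<and>
     (\<forall>x \<in> Obj E. \<forall>y \<in> Obj E. lax_mult F x y \<in> hom E (omap F x \<otimes> omap F y) (omap F (x \<otimes> y))) \<and>
     lax_unit F \<in> hom E (tunit E) (omap F (tunit E)) \<and>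
     (\<forall>x x' y y'. \<forall>f \<in> hom E x x'. \<forall>g \<in> hom E y y'.
        lax_mult F x' y' \<cdot> (amap F f \<odot> amap F g) = amap F (f \<odot> g) \<cdot> lax_mult F x y) \<and>
     (\<forall>x \<in> Obj E. \<forall>y \<in> Obj E. \<forall>z \<in> Obj E.
        amap F (assoc E x y z) \<cdot> lax_mult F (x \<otimes> y) z \<cdot> (lax_mult F x y \<odot> ident E (omap F z)) =
        lax_mult F x (y \<otimes> z) \<cdot> (ident E (omap F x) \<odot> lax_mult F y z) \<cdot>
          assoc E (omap F x) (omap F y) (omap F z)) \<and>
     (\<forall>x \<in> Obj E.
        amap F (lunit E x) \<cdot> lax_mult F (tunit E) x \<cdot> (lax_unit F \<odot> ident E (omap F x)) =
        lunit E (omap F x)) \<and>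
     (\<forall>x \<in> Obj E.
        amap F (runit E x) \<cdot> lax_mult F x (tunit E) \<cdot> (ident E (omap F x) \<odot> lax_unit F) =
        runit E (omap F x)) \<and>
     (\<forall>x \<in> Obj E. \<forall>y \<in> Obj E.
        amap F (symm E x y) \<cdot> lax_mult F x y = lax_mult F y x \<cdot> symm E (omap F x) (omap F y))"

definition id_lax_func :: "('o, 'a) lax_func" where
  "id_lax_func = \<lparr>omap = (\<lambda>x. x), amap = (\<lambda>f. f),
     lax_mult = (\<lambda>x y. ident E (x \<otimes> y)), lax_unit = ident E (tunit E)\<rparr>"

definition is_monoidal_nat_trans ::
  "('o, 'a) lax_func \<Rightarrow> ('o, 'a) lax_func \<Rightarrow> ('o \<Rightarrow> 'a) \<Rightarrow> bool" where
  "is_monoidal_nat_trans F G t \<longleftrightarrow> is_nat_trans E E F G t \<and>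
     (\<forall>x \<in> Obj E. \<forall>y \<in> Obj E. t (x \<otimes> y) \<cdot> lax_mult F x y = lax_mult G x y \<cdot> (t x \<odot> t y)) \<and>
     t (tunit E) \<cdot> lax_unit F = lax_unit G"

definition has_symmetric_monoidal_fibrant_replacement :: "'a model_str \<Rightarrow> bool" where
  "has_symmetric_monoidal_fibrant_replacement M \<longleftrightarrow>
     (\<exists>Q t. lax_symmetric_monoidal Q \<and> is_monoidal_nat_trans id_lax_func Q t \<and>
        (\<forall>x \<in> Obj E. t x \<in> weq M \<and> fibrant E M (omap Q x)))"

definition has_functorial_path_data :: "'a model_str \<Rightarrow> bool" where
  "has_functorial_path_data M \<longleftrightarrow>
     (\<exists>Path s d0 d1. lax_symmetric_monoidal Path \<and>
        is_monoidal_nat_trans id_lax_func Path s \<and>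
        is_monoidal_nat_trans Path id_lax_func d0 \<and>
        is_monoidal_nat_trans Path id_lax_func d1 \<and>
        (\<forall>x. fibrant E M x \<longrightarrow>
           s x \<in> weq M \<and> d0 x \<cdot> s x = ident E x \<and> d1 x \<cdot> s x = ident E x \<and>
           (\<forall>p p0 p1 h. is_product E x x p p0 p1 \<and> h \<in> hom E (omap Path x) p \<and>
              p0 \<cdot> h = d0 x \<and> p1 \<cdot> h = d1 x \<longrightarrow> h \<in> fib M)))"

end


section \<open>Profiles and iterated tensor products\<close>

definition profiles :: "'c set \<Rightarrow> 'c list set" where
  "profiles CC = {c. c \<noteq> [] \<and> set c \<subseteq> CC}"

text \<open>
  The library's \<open>permute_list \<tau> c\<close> has \<open>i\<close>-th entry \<open>c ! \<tau> i\<close> and is a right action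
  \<open>c\<tau>\<close> of the symmetric group; the left action is \<open>\<sigma>c = c\<sigma>\<inverse>\<close>.
\<close>

definition lact :: "(nat \<Rightarrow> nat) \<Rightarrow> 'c list \<Rightarrow> 'c list" where
  "lact \<sigma> c = permute_list (inv \<sigma>) c"

definition ract :: "'c list \<Rightarrow> (nat \<Rightarrow> nat) \<Rightarrow> 'c list" where
  "ract c \<tau> = permute_list \<tau> c"

definition block_perm :: "nat \<Rightarrow> (nat \<Rightarrow> nat) \<Rightarrow> (nat \<Rightarrow> nat) \<Rightarrow> nat \<Rightarrow> nat" where
  \<comment> \<open>\<open>\<sigma> \<times> \<tau>\<close>, where \<open>\<sigma>\<close> acts on the first \<open>n\<close> positions\<close>
  "block_perm n \<sigma> \<tau> i = (if i < n then \<sigma> i else n + \<tau> (i - n))"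

context
  fixes E :: "('o, 'a) smc" (structure)
begin

text \<open>Iterated tensor products are bracketed to the right. Profiles being non-empty, the value at
  \<open>[]\<close> is irrelevant.\<close>

fun tens_obj :: "('c \<Rightarrow> 'o) \<Rightarrow> 'c list \<Rightarrow> 'o" where
  "tens_obj X [] = tunit E"
| "tens_obj X [c] = X c"
| "tens_obj X (c # b # bs) = X c \<otimes> tens_obj X (b # bs)"

fun tens_arr :: "('c \<Rightarrow> 'a) \<Rightarrow> 'c list \<Rightarrow> 'a" where
  "tens_arr f [] = ident E (tunit E)"
| "tens_arr f [c] = f c"
| "tens_arr f (c # b # bs) = f c \<odot> tens_arr f (b # bs)"

text \<open>The associativity isomorphism \<open>X\<^sub>c \<otimes> X\<^sub>d \<rightarrow> X\<^sub>c\<^sub>d\<close> for non-empty \<open>c\<close> and \<open>d\<close>.\<close>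

fun join :: "('c \<Rightarrow> 'o) \<Rightarrow> 'c list \<Rightarrow> 'c list \<Rightarrow> 'a" where
  "join X [] d = lunit E (tens_obj X d)"
| "join X [c] d = ident E (X c \<otimes> tens_obj X d)"
| "join X (c # b # bs) d =
     (ident E (X c) \<odot> join X (b # bs) d) \<cdot> assoc E (X c) (tens_obj X (b # bs)) (tens_obj X d)"

text \<open>
  \<open>insert_iso X c j e\<close> moves the first factor of \<open>X\<^sub>c \<otimes> X\<^sub>e\<close> to position \<open>j\<close>, for
  \<open>j \<le> length e\<close>. \<open>perm_iso X c \<sigma>\<close> is the symmetry isomorphism from
  \<open>tens_obj X c\<close> to \<open>tens_obj X (lact \<sigma> c)\<close> sending the \<open>i\<close>-th factor to position
  \<open>\<sigma> i\<close>: the tail is permuted by the permutation that \<open>\<sigma>\<close> induces on the remaining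
  positions, and then the first factor is moved to position \<open>\<sigma> 0\<close>.
\<close>

fun insert_iso :: "('c \<Rightarrow> 'o) \<Rightarrow> 'c \<Rightarrow> nat \<Rightarrow> 'c list \<Rightarrow> 'a" where
  "insert_iso X c 0 e = ident E (tens_obj X (c # e))"
| "insert_iso X c (Suc j) [] = ident E (X c)"
| "insert_iso X c (Suc j) [a] = symm E (X c) (X a)"
| "insert_iso X c (Suc j) (a # b # bs) =
     (ident E (X a) \<odot> insert_iso X c j (b # bs)) \<cdot>
     assoc E (X a) (X c) (tens_obj X (b # bs)) \<cdot>
     (symm E (X c) (X a) \<odot> ident E (tens_obj X (b # bs))) \<cdot>
     inv_arr E (assoc E (X c) (X a) (tens_obj X (b # bs)))"

definition tail_perm :: "(nat \<Rightarrow> nat) \<Rightarrow> nat \<Rightarrow> nat" where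
  "tail_perm \<sigma> i = (if \<sigma> 0 < \<sigma> (Suc i) then \<sigma> (Suc i) - 1 else \<sigma> (Suc i))"

fun perm_iso :: "('c \<Rightarrow> 'o) \<Rightarrow> 'c list \<Rightarrow> (nat \<Rightarrow> nat) \<Rightarrow> 'a" where
  "perm_iso X [] \<sigma> = ident E (tunit E)"
| "perm_iso X [c] \<sigma> = ident E (X c)"
| "perm_iso X (c # b # bs) \<sigma> =
     insert_iso X c (\<sigma> 0) (lact (tail_perm \<sigma>) (b # bs)) \<cdot>
     (ident E (X c) \<odot> perm_iso X (b # bs) (tail_perm \<sigma>))"

end


section \<open>Colored PROPs\<close>

text \<open>
  \<open>entry P d c\<close> has outputs \<open>d\<close> and inputs \<open>c\<close>; \<open>act P \<sigma> \<tau> d c\<close> is the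
  structure map \<open>(\<sigma>; \<tau>)\<close> out of \<open>entry P d c\<close>; \<open>vcomp P d b c\<close> composes
  \<open>entry P d b\<close> with \<open>entry P b c\<close>; \<open>hcomp P d1 c1 d2 c2\<close> has source
  \<open>entry P d1 c1 \<otimes> entry P d2 c2\<close>.
\<close>

record ('c, 'o, 'a) colored_prop =
  entry :: "'c list \<Rightarrow> 'c list \<Rightarrow> 'o"
  act :: "(nat \<Rightarrow> nat) \<Rightarrow> (nat \<Rightarrow> nat) \<Rightarrow> 'c list \<Rightarrow> 'c list \<Rightarrow> 'a"
  vcomp :: "'c list \<Rightarrow> 'c list \<Rightarrow> 'c list \<Rightarrow> 'a"
  hcomp :: "'c list \<Rightarrow> 'c list \<Rightarrow> 'c list \<Rightarrow> 'c list \<Rightarrow> 'a"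

locale sigma_bimodule =
  fixes E :: "('o, 'a) smc" (structure) and CC :: "'c set" and P :: "('c, 'o, 'a) colored_prop"
  assumes entry_Obj: "d \<in> profiles CC \<Longrightarrow> c \<in> profiles CC \<Longrightarrow> entry P d c \<in> Obj E"
    and act_hom: "d \<in> profiles CC \<Longrightarrow> c \<in> profiles CC \<Longrightarrow>
      \<sigma> permutes {..<length d} \<Longrightarrow> \<tau> permutes {..<length c} \<Longrightarrow>
      act P \<sigma> \<tau> d c \<in> hom E (entry P d c) (entry P (lact \<sigma> d) (ract c \<tau>))"
    and act_id: "d \<in> profiles CC \<Longrightarrow> c \<in> profiles CC \<Longrightarrow> act P id id d c = ident E (entry P d c)"
    and act_comp: "d \<in> profiles CC \<Longrightarrow> c \<in> profiles CC \<Longrightarrow>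
      \<sigma> permutes {..<length d} \<Longrightarrow> \<tau> permutes {..<length c} \<Longrightarrow>
      \<sigma>' permutes {..<length d} \<Longrightarrow> \<tau>' permutes {..<length c} \<Longrightarrow>
      act P \<sigma>' \<tau>' (lact \<sigma> d) (ract c \<tau>) \<cdot> act P \<sigma> \<tau> d c = act P (\<sigma>' \<circ> \<sigma>) (\<tau> \<circ> \<tau>') d c"

locale colored_PROP = sigma_bimodule E CC P
  for E :: "('o, 'a) smc" (structure) and CC :: "'c set" and P :: "('c, 'o, 'a) colored_prop" +
  assumes vcomp_hom: "d \<in> profiles CC \<Longrightarrow> b \<in> profiles CC \<Longrightarrow> c \<in> profiles CC \<Longrightarrow>
      vcomp P d b c \<in> hom E (entry P d b \<otimes> entry P b c) (entry P d c)"
    and vcomp_assoc: "d \<in> profiles CC \<Longrightarrow> a \<in> profiles CC \<Longrightarrow> b \<in> profiles CC \<Longrightarrow> c \<in> profiles CC \<Longrightarrow>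
      vcomp P d b c \<cdot> (vcomp P d a b \<odot> ident E (entry P b c)) =
      vcomp P d a c \<cdot> (ident E (entry P d a) \<odot> vcomp P a b c) \<cdot>
        assoc E (entry P d a) (entry P a b) (entry P b c)"
    and vcomp_equivariant_outer: "d \<in> profiles CC \<Longrightarrow> b \<in> profiles CC \<Longrightarrow> c \<in> profiles CC \<Longrightarrow>
      \<sigma> permutes {..<length d} \<Longrightarrow> \<mu> permutes {..<length c} \<Longrightarrow>
      vcomp P (lact \<sigma> d) b (ract c \<mu>) \<cdot> (act P \<sigma> id d b \<odot> act P id \<mu> b c) =
      act P \<sigma> \<mu> d c \<cdot> vcomp P d b c"
    and vcomp_equivariant_inner: "d \<in> profiles CC \<Longrightarrow> b \<in> profiles CC \<Longrightarrow> c \<in> profiles CC \<Longrightarrow>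
      \<tau> permutes {..<length b} \<Longrightarrow>
      vcomp P d (lact \<tau> b) c \<cdot> (act P id (inv \<tau>) d b \<odot> act P \<tau> id b c) = vcomp P d b c"
    and hcomp_hom: "d1 \<in> profiles CC \<Longrightarrow> c1 \<in> profiles CC \<Longrightarrow> d2 \<in> profiles CC \<Longrightarrow> c2 \<in> profiles CC \<Longrightarrow>
      hcomp P d1 c1 d2 c2 \<in> hom E (entry P d1 c1 \<otimes> entry P d2 c2) (entry P (d1 @ d2) (c1 @ c2))"
    and hcomp_assoc: "d1 \<in> profiles CC \<Longrightarrow> c1 \<in> profiles CC \<Longrightarrow> d2 \<in> profiles CC \<Longrightarrow> c2 \<in> profiles CC \<Longrightarrow>
      d3 \<in> profiles CC \<Longrightarrow> c3 \<in> profiles CC \<Longrightarrow>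
      hcomp P (d1 @ d2) (c1 @ c2) d3 c3 \<cdot> (hcomp P d1 c1 d2 c2 \<odot> ident E (entry P d3 c3)) =
      hcomp P d1 c1 (d2 @ d3) (c2 @ c3) \<cdot> (ident E (entry P d1 c1) \<odot> hcomp P d2 c2 d3 c3) \<cdot>
        assoc E (entry P d1 c1) (entry P d2 c2) (entry P d3 c3)"
    and hcomp_equivariant: "d1 \<in> profiles CC \<Longrightarrow> c1 \<in> profiles CC \<Longrightarrow>
      d2 \<in> profiles CC \<Longrightarrow> c2 \<in> profiles CC \<Longrightarrow>
      \<sigma>1 permutes {..<length d1} \<Longrightarrow> \<tau>1 permutes {..<length c1} \<Longrightarrow>
      \<sigma>2 permutes {..<length d2} \<Longrightarrow> \<tau>2 permutes {..<length c2} \<Longrightarrow>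
      hcomp P (lact \<sigma>1 d1) (ract c1 \<tau>1) (lact \<sigma>2 d2) (ract c2 \<tau>2) \<cdot>
        (act P \<sigma>1 \<tau>1 d1 c1 \<odot> act P \<sigma>2 \<tau>2 d2 c2) =
      act P (block_perm (length d1) \<sigma>1 \<sigma>2) (block_perm (length c1) \<tau>1 \<tau>2) (d1 @ d2) (c1 @ c2) \<cdot>
        hcomp P d1 c1 d2 c2"
    and interchange: "d1 \<in> profiles CC \<Longrightarrow> b1 \<in> profiles CC \<Longrightarrow> c1 \<in> profiles CC \<Longrightarrow>
      d2 \<in> profiles CC \<Longrightarrow> b2 \<in> profiles CC \<Longrightarrow> c2 \<in> profiles CC \<Longrightarrow>
      vcomp P (d1 @ d2) (b1 @ b2) (c1 @ c2) \<cdot> (hcomp P d1 b1 d2 b2 \<odot> hcomp P b1 c1 b2 c2) =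
      hcomp P d1 c1 d2 c2 \<cdot> (vcomp P d1 b1 c1 \<odot> vcomp P d2 b2 c2) \<cdot>
        middle_swap E (entry P d1 b1) (entry P d2 b2) (entry P b1 c1) (entry P b2 c2)"

context
  fixes E :: "('o, 'a) smc" (structure) and CC :: "'c set"
begin

definition is_prop_map ::
  "('c, 'o, 'a) colored_prop \<Rightarrow> ('c, 'o, 'a) colored_prop \<Rightarrow> ('c list \<Rightarrow> 'c list \<Rightarrow> 'a) \<Rightarrow> bool" where
  \<comment> \<open>components at non-profiles are fixed so that maps are determined by their components\<close>
  "is_prop_map P Q \<phi> \<longleftrightarrow>
     (\<forall>d c. d \<notin> profiles CC \<or> c \<notin> profiles CC \<longrightarrow> \<phi> d c = undefined) \<and>
     (\<forall>d \<in> profiles CC. \<forall>c \<in> profiles CC. \<phi> d c \<in> hom E (entry P d c) (entry Q d c)) \<and>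
     (\<forall>d \<in> profiles CC. \<forall>c \<in> profiles CC. \<forall>\<sigma> \<tau>.
        \<sigma> permutes {..<length d} \<and> \<tau> permutes {..<length c} \<longrightarrow>
        \<phi> (lact \<sigma> d) (ract c \<tau>) \<cdot> act P \<sigma> \<tau> d c = act Q \<sigma> \<tau> d c \<cdot> \<phi> d c) \<and>
     (\<forall>d \<in> profiles CC. \<forall>b \<in> profiles CC. \<forall>c \<in> profiles CC.
        \<phi> d c \<cdot> vcomp P d b c = vcomp Q d b c \<cdot> (\<phi> d b \<odot> \<phi> b c)) \<and>
     (\<forall>d1 \<in> profiles CC. \<forall>c1 \<in> profiles CC. \<forall>d2 \<in> profiles CC. \<forall>c2 \<in> profiles CC.
        \<phi> (d1 @ d2) (c1 @ c2) \<cdot> hcomp P d1 c1 d2 c2 = hcomp Q d1 c1 d2 c2 \<cdot> (\<phi> d1 c1 \<odot> \<phi> d2 c2))"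

definition PROP_cat ::
  "(('c, 'o, 'a) colored_prop,
    ('c, 'o, 'a) colored_prop \<times> ('c list \<Rightarrow> 'c list \<Rightarrow> 'a) \<times> ('c, 'o, 'a) colored_prop) cat" where
  "PROP_cat = \<lparr>
     Obj = {P. colored_PROP E CC P},
     Arr = {(P, \<phi>, Q). colored_PROP E CC P \<and> colored_PROP E CC Q \<and> is_prop_map P Q \<phi>},
     Dom = (\<lambda>(P, \<phi>, Q). P),
     Cod = (\<lambda>(P, \<phi>, Q). Q),
     ident = (\<lambda>P. (P, \<lambda>d c. if d \<in> profiles CC \<and> c \<in> profiles CC
                            then ident E (entry P d c) else undefined, P)),
     comp = (\<lambda>(Q', \<psi>, R) (P, \<phi>, Q). (P, \<lambda>d c. if d \<in> profiles CC \<and> c \<in> profiles CC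
                                      then \<psi> d c \<cdot> \<phi> d c else undefined, R))\<rparr>"

text \<open>
  In any model structure the cofibrations are the maps with the left lifting property with respect
  to the acyclic fibrations, so the model structure on PROPs is given by declaring its weak
  equivalences and fibrations, which are those of \<open>E\<close> entrywise.
\<close>

definition PROP_weq where
  "PROP_weq M = {(P, \<phi>, Q) \<in> Arr PROP_cat.
     \<forall>d \<in> profiles CC. \<forall>c \<in> profiles CC. \<phi> d c \<in> weq M}"

definition PROP_fib where
  "PROP_fib M = {(P, \<phi>, Q) \<in> Arr PROP_cat.
     \<forall>d \<in> profiles CC. \<forall>c \<in> profiles CC. \<phi> d c \<in> fib M}"

definition PROP_model where
  "PROP_model M = \<lparr>weq = PROP_weq M,
     cof = {i \<in> Arr PROP_cat. \<forall>p \<in> PROP_fib M \<inter> PROP_weq M. lifts PROP_cat i p},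
     fib = PROP_fib M\<rparr>"

end


section \<open>Endomorphism PROPs and algebras\<close>

context
  fixes E :: "('o, 'a) smc" (structure)
begin

definition endo_PROP :: "('c \<Rightarrow> 'o) \<Rightarrow> ('c, 'o, 'a) colored_prop" where
  "endo_PROP X =
     (let T = tens_obj E X; H = (\<lambda>d c. ihom E (T c) (T d)) in \<lparr>
        entry = H,
        act = (\<lambda>\<sigma> \<tau> d c. curry_arr E (H d c) (T (ract c \<tau>)) (T (lact \<sigma> d))
          (perm_iso E X d \<sigma> \<cdot> ev E (T c) (T d) \<cdot>
           (ident E (H d c) \<odot> perm_iso E X (ract c \<tau>) \<tau>))),
        vcomp = (\<lambda>d b c. curry_arr E (H d b \<otimes> H b c) (T c) (T d)
          (ev E (T b) (T d) \<cdot> (ident E (H d b) \<odot> ev E (T c) (T b)) \<cdot>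
           assoc E (H d b) (H b c) (T c))),
        hcomp = (\<lambda>d1 c1 d2 c2. curry_arr E (H d1 c1 \<otimes> H d2 c2) (T (c1 @ c2)) (T (d1 @ d2))
          (join E X d1 d2 \<cdot> (ev E (T c1) (T d1) \<odot> ev E (T c2) (T d2)) \<cdot>
           middle_swap E (H d1 c1) (H d2 c2) (T c1) (T c2) \<cdot>
           (ident E (H d1 c1 \<otimes> H d2 c2) \<odot> inv_arr E (join E X c1 c2))))\<rparr>)"

definition is_algebra ::
  "'c set \<Rightarrow> ('c, 'o, 'a) colored_prop \<Rightarrow> ('c \<Rightarrow> 'o) \<Rightarrow> ('c list \<Rightarrow> 'c list \<Rightarrow> 'a) \<Rightarrow> bool" where
  "is_algebra CC P X \<phi> \<longleftrightarrow> (\<forall>c \<in> CC. X c \<in> Obj E) \<and>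
     (P, \<phi>, endo_PROP X) \<in> hom (PROP_cat E CC) P (endo_PROP X)"

definition alg_map :: "('c \<Rightarrow> 'o) \<Rightarrow> ('c list \<Rightarrow> 'c list \<Rightarrow> 'a) \<Rightarrow> 'c list \<Rightarrow> 'c list \<Rightarrow> 'a" where
  \<comment> \<open>the adjoint structure map \<open>entry P d c \<otimes> X\<^sub>c \<rightarrow> X\<^sub>d\<close>\<close>
  "alg_map X \<phi> d c =
     ev E (tens_obj E X c) (tens_obj E X d) \<cdot> (\<phi> d c \<odot> ident E (tens_obj E X c))"

definition is_algebra_morphism ::
  "'c set \<Rightarrow> ('c, 'o, 'a) colored_prop \<Rightarrow> ('c \<Rightarrow> 'o) \<Rightarrow> ('c list \<Rightarrow> 'c list \<Rightarrow> 'a) \<Rightarrow>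
   ('c \<Rightarrow> 'o) \<Rightarrow> ('c list \<Rightarrow> 'c list \<Rightarrow> 'a) \<Rightarrow> ('c \<Rightarrow> 'a) \<Rightarrow> bool" where
  "is_algebra_morphism CC P X \<phi> Y \<psi> f \<longleftrightarrow> (\<forall>c \<in> CC. f c \<in> hom E (X c) (Y c)) \<and>
     (\<forall>d \<in> profiles CC. \<forall>c \<in> profiles CC.
        tens_arr E f d \<cdot> alg_map X \<phi> d c =
        alg_map Y \<psi> d c \<cdot> (ident E (entry P d c) \<odot> tens_arr E f c))"

end

end

theory Submission
  imports Defs
begin

text \<open>
  Let \<open>E\<^sub>f\<close> have as entries the pullbacks of \<open>ihom X\<^sub>c X\<^sub>d \<rightarrow> ihom X\<^sub>c Y\<^sub>d \<leftarrow> ihom Y\<^sub>c Y\<^sub>d\<close>. The operations of the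
  endomorphism PROPs \<open>E\<^sub>X\<close> and \<open>E\<^sub>Y\<close> are natural in \<open>f\<close> and so restrict to \<open>E\<^sub>f\<close>, and since the two
  projections are jointly monic, \<open>E\<^sub>f\<close> is again a PROP. A map \<open>P \<rightarrow> E\<^sub>f\<close> is the same as a pair of
  algebra structures on \<open>X\<close> and \<open>Y\<close> for which \<open>f\<close> is a morphism. By the pushout-product axiom the
  projection \<open>E\<^sub>f \<rightarrow> E\<^sub>X\<close> is entrywise an acyclic fibration in case (1), and \<open>E\<^sub>f \<rightarrow> E\<^sub>Y\<close> is one in
  case (2); as \<open>P\<close> is cofibrant, the given structure map lifts along it.
\<close>

text \<open>That the operations are natural hides most of the work. In \<open>endo_PROP\<close>
  iterated tensor products are bracketed to the right and all associators and symmetries are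
  explicit, so after uncurrying each law is a coherence statement about moving tensor factors. A
  calculus on words makes the associators disappear; what remains is that adjacent swaps are
  natural, involutive and satisfy the braid relation. Membership of a pair in the pullback is also
  tested after uncurrying, so that closure of \<open>E\<^sub>f\<close> under the operations becomes
  naturality of the structural isomorphisms in \<open>f\<close>. The two cases are not formal duals.
  By adjunction, lifting a cofibration \<open>i\<close> against the projection to
  \<open>E\<^sub>X\<close> means extending a map along the pushout-product of \<open>i\<close> and
  \<open>f_c\<close> into the fibrant object \<open>Y_d\<close>, and this pushout-product is acyclic
  because \<open>f_c\<close> is. Lifting \<open>i\<close> against the projection to
  \<open>E\<^sub>Y\<close> means lifting \<open>i\<close> tensored with \<open>X_c\<close> against
  \<open>f_d\<close>, and cofibrancy of \<open>X_c\<close> keeps the left-hand map a cofibration.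
  The entries range over all pairs of profiles, hence the hypotheses on tensor products over every
  profile.\<close>

context category
begin

section \<open>Composition, isomorphisms and cancellation in a category\<close>

lemma hom_iff: "f \<in> hom C x y \<longleftrightarrow> f \<in> Arr C \<and> Dom C f = x \<and> Cod C f = y"
  by (auto simp: hom_def)

lemma Arr_hom: "f \<in> Arr C \<Longrightarrow> f \<in> hom C (Dom C f) (Cod C f)"
  by (simp add: hom_def)

lemma comp_typed:
  assumes "f \<in> Arr C" "g \<in> Arr C" "Dom C g = Cod C f"
  shows comp_Arr [simp]: "g \<cdot> f \<in> Arr C" and Dom_comp [simp]: "Dom C (g \<cdot> f) = Dom C f"
    and Cod_comp [simp]: "Cod C (g \<cdot> f) = Cod C g"
  using comp_hom[OF Arr_hom[OF assms(1)], of g "Cod C g"] assms by (auto simp: hom_iff)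

declare Dom_Obj [simp] Cod_Obj [simp]

lemma ident_typed:
  assumes "x \<in> Obj C"
  shows ident_Arr [simp]: "ident C x \<in> Arr C" and Dom_ident [simp]: "Dom C (ident C x) = x"
    and Cod_ident [simp]: "Cod C (ident C x) = x"
  using ident_hom[OF assms] by (auto simp: hom_iff)

lemma comp_ident [simp]: "f \<in> Arr C \<Longrightarrow> Dom C f = x \<Longrightarrow> f \<cdot> ident C x = f"
  by (rule comp_ident_right) (auto simp: hom_iff)

lemma ident_comp [simp]: "f \<in> Arr C \<Longrightarrow> Cod C f = x \<Longrightarrow> ident C x \<cdot> f = f"
  by (rule comp_ident_left) (auto simp: hom_iff)

lemma assoc_comp:
  "f \<in> Arr C \<Longrightarrow> g \<in> Arr C \<Longrightarrow> h \<in> Arr C \<Longrightarrow> Dom C g = Cod C f \<Longrightarrow> Dom C h = Cod C g \<Longrightarrow>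
    (h \<cdot> g) \<cdot> f = h \<cdot> g \<cdot> f"
  by (rule comp_assoc) (auto simp: hom_iff)

lemma inverse_arrows_unique:
  assumes "inverse_arrows C f g" "inverse_arrows C f h"
  shows "g = h"
proof -
  have "g = (h \<cdot> f) \<cdot> g" using assms by (auto simp: inverse_arrows_def hom_iff)
  also have "\<dots> = h \<cdot> (f \<cdot> g)" using assms by (subst assoc_comp) (auto simp: inverse_arrows_def hom_iff)
  also have "\<dots> = h" using assms by (auto simp: inverse_arrows_def hom_iff)
  finally show ?thesis .
qed

lemma inverse_arrows_inv_arr: "iso C f \<Longrightarrow> inverse_arrows C f (inv_arr C f)"
  unfolding iso_def inv_arr_def by (rule theI') (blast intro: inverse_arrows_unique)

lemma inv_arr_eqI: "inverse_arrows C f g \<Longrightarrow> inv_arr C f = g"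
  unfolding inv_arr_def by (blast intro: inverse_arrows_unique)

lemma iso_Arr: "iso C f \<Longrightarrow> f \<in> Arr C"
  by (auto simp: iso_def inverse_arrows_def)

lemma inv_typed:
  assumes "iso C f"
  shows inv_Arr [simp]: "inv_arr C f \<in> Arr C"
    and Dom_inv [simp]: "Dom C (inv_arr C f) = Cod C f"
    and Cod_inv [simp]: "Cod C (inv_arr C f) = Dom C f"
    and inv_comp [simp]: "inv_arr C f \<cdot> f = ident C (Dom C f)"
    and comp_inv [simp]: "f \<cdot> inv_arr C f = ident C (Cod C f)"
  using inverse_arrows_inv_arr[OF assms] by (auto simp: inverse_arrows_def hom_iff)

lemma inv_comp_comp [simp]:
  "iso C f \<Longrightarrow> g \<in> Arr C \<Longrightarrow> Cod C g = Dom C f \<Longrightarrow> inv_arr C f \<cdot> f \<cdot> g = g"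
  using assoc_comp[of g f "inv_arr C f"] by (simp add: iso_Arr)

lemma comp_inv_comp [simp]:
  "iso C f \<Longrightarrow> g \<in> Arr C \<Longrightarrow> Cod C g = Cod C f \<Longrightarrow> f \<cdot> inv_arr C f \<cdot> g = g"
  using assoc_comp[of g "inv_arr C f" f] by (simp add: iso_Arr)

lemma iso_ident [simp]: "x \<in> Obj C \<Longrightarrow> iso C (ident C x)"
  unfolding iso_def inverse_arrows_def by (rule exI[of _ "ident C x"]) (auto simp: hom_iff)

lemma iso_comp [simp]:
  assumes "iso C f" "iso C g" "Dom C g = Cod C f"
  shows "iso C (g \<cdot> f)"
  unfolding iso_def inverse_arrows_def using assms
  by (intro exI[of _ "inv_arr C f \<cdot> inv_arr C g"])
    (auto simp: hom_iff iso_Arr assoc_comp)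

lemma iso_right_cancel:
  assumes "g \<cdot> f = h \<cdot> f" "iso C f" "g \<in> Arr C" "h \<in> Arr C" "Dom C g = Cod C f" "Dom C h = Cod C f"
  shows "g = h"
proof -
  have "(g \<cdot> f) \<cdot> inv_arr C f = (h \<cdot> f) \<cdot> inv_arr C f" using assms by simp
  then show ?thesis using assms(2-) by (simp add: assoc_comp iso_Arr)
qed

lemma iso_left_cancel:
  assumes "f \<cdot> g = f \<cdot> h" "iso C f" "g \<in> Arr C" "h \<in> Arr C" "Cod C g = Dom C f" "Cod C h = Dom C f"
  shows "g = h"
proof -
  have "inv_arr C f \<cdot> f \<cdot> g = inv_arr C f \<cdot> f \<cdot> h" using assms by simp
  then show ?thesis using assms(2-) by simp
qed

text \<open>Composites are kept nested to the right, where the left side of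
  \<open>g \<cdot> f = g' \<cdot> f'\<close> need not occur as a subterm. Precomposing both sides
  with a further arrow \<open>k\<close> gives the equation in a form that does.\<close>

lemma comp_eq_reassoc:
  "g \<cdot> f = g' \<cdot> f' \<Longrightarrow> f \<in> Arr C \<Longrightarrow> g \<in> Arr C \<Longrightarrow> f' \<in> Arr C \<Longrightarrow> g' \<in> Arr C \<Longrightarrow>
    Dom C g = Cod C f \<Longrightarrow> Dom C g' = Cod C f' \<Longrightarrow> k \<in> Arr C \<Longrightarrow> Cod C k = Dom C f \<Longrightarrow>
    g \<cdot> f \<cdot> k = g' \<cdot> f' \<cdot> k"
  by (metis assoc_comp Dom_comp)

end

section \<open>Interchange and naturality for tensor products\<close>

context closed_symmetric_monoidal_category
begin

declare tensor_Obj [simp] tunit_Obj [simp] ihom_Obj [simp] tensor_ident [simp]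

lemma tensor_typed:
  assumes "f \<in> Arr E" "g \<in> Arr E"
  shows tensor_Arr [simp]: "f \<odot> g \<in> Arr E"
    and Dom_tensor [simp]: "Dom E (f \<odot> g) = Dom E f \<otimes> Dom E g"
    and Cod_tensor [simp]: "Cod E (f \<odot> g) = Cod E f \<otimes> Cod E g"
  using tensor_hom[OF Arr_hom[OF assms(1)] Arr_hom[OF assms(2)]] by (auto simp: hom_iff)

lemma interchange_law:
  assumes "f \<in> Arr E" "g \<in> Arr E" "Dom E g = Cod E f" "f' \<in> Arr E" "g' \<in> Arr E" "Dom E g' = Cod E f'"
  shows "(g \<odot> g') \<cdot> (f \<odot> f') = (g \<cdot> f) \<odot> (g' \<cdot> f')"
  by (rule tensor_comp[symmetric]) (use assms in \<open>auto simp: hom_iff\<close>)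

lemma interchange_law2:
  assumes "f \<in> Arr E" "g \<in> Arr E" "Dom E g = Cod E f" "f' \<in> Arr E" "g' \<in> Arr E" "Dom E g' = Cod E f'"
    "k \<in> Arr E" "Cod E k = Dom E f \<otimes> Dom E f'"
  shows "(g \<odot> g') \<cdot> (f \<odot> f') \<cdot> k = ((g \<cdot> f) \<odot> (g' \<cdot> f')) \<cdot> k"
  using assms by (simp flip: interchange_law add: assoc_comp)

text \<open>The normal form used for composites throughout: nested to the right, with adjacent
  tensor products of arrows merged into one.\<close>

lemmas fuse = interchange_law interchange_law2 assoc_comp

lemma structure_typed:
  shows [simp]: "x \<in> Obj E \<Longrightarrow> y \<in> Obj E \<Longrightarrow> symm E x y \<in> Arr E"
    and [simp]: "x \<in> Obj E \<Longrightarrow> y \<in> Obj E \<Longrightarrow> Dom E (symm E x y) = x \<otimes> y"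
    and [simp]: "x \<in> Obj E \<Longrightarrow> y \<in> Obj E \<Longrightarrow> Cod E (symm E x y) = y \<otimes> x"
    and [simp]: "x \<in> Obj E \<Longrightarrow> y \<in> Obj E \<Longrightarrow> z \<in> Obj E \<Longrightarrow> assoc E x y z \<in> Arr E"
    and [simp]: "x \<in> Obj E \<Longrightarrow> y \<in> Obj E \<Longrightarrow> z \<in> Obj E \<Longrightarrow> Dom E (assoc E x y z) = (x \<otimes> y) \<otimes> z"
    and [simp]: "x \<in> Obj E \<Longrightarrow> y \<in> Obj E \<Longrightarrow> z \<in> Obj E \<Longrightarrow> Cod E (assoc E x y z) = x \<otimes> (y \<otimes> z)"
    and [simp]: "x \<in> Obj E \<Longrightarrow> y \<in> Obj E \<Longrightarrow> ev E x y \<in> Arr E"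
    and [simp]: "x \<in> Obj E \<Longrightarrow> y \<in> Obj E \<Longrightarrow> Dom E (ev E x y) = ihom E x y \<otimes> x"
    and [simp]: "x \<in> Obj E \<Longrightarrow> y \<in> Obj E \<Longrightarrow> Cod E (ev E x y) = y"
    and [simp]: "x \<in> Obj E \<Longrightarrow> runit E x \<in> Arr E"
    and [simp]: "x \<in> Obj E \<Longrightarrow> Dom E (runit E x) = x \<otimes> tunit E"
    and [simp]: "x \<in> Obj E \<Longrightarrow> Cod E (runit E x) = x"
  using symm_hom[of x y] assoc_hom[of x y z] ev_hom[of x y] runit_hom[of x] by (auto simp: hom_iff)

declare assoc_iso [simp] runit_iso [simp] symm_symm [simp]

lemma iso_symm [simp]: "x \<in> Obj E \<Longrightarrow> y \<in> Obj E \<Longrightarrow> iso E (symm E x y)"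
  unfolding iso_def inverse_arrows_def by (rule exI[of _ "symm E y x"]) (auto simp: hom_iff)

lemma iso_tensor [simp]:
  assumes "iso E f" "iso E g"
  shows "iso E (f \<odot> g)"
  unfolding iso_def inverse_arrows_def using assms
  by (intro exI[of _ "inv_arr E f \<odot> inv_arr E g"]) (auto simp: hom_iff iso_Arr interchange_law)

lemma assoc_nat:
  "f \<in> Arr E \<Longrightarrow> g \<in> Arr E \<Longrightarrow> h \<in> Arr E \<Longrightarrow> Cod E f = x \<Longrightarrow> Cod E g = y \<Longrightarrow> Cod E h = z \<Longrightarrow>
    assoc E x y z \<cdot> ((f \<odot> g) \<odot> h) = (f \<odot> (g \<odot> h)) \<cdot> assoc E (Dom E f) (Dom E g) (Dom E h)"
  by (rule assoc_natural) (auto simp: hom_iff)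

lemma assoc_nat2:
  "f \<in> Arr E \<Longrightarrow> g \<in> Arr E \<Longrightarrow> h \<in> Arr E \<Longrightarrow> Cod E f = x \<Longrightarrow> Cod E g = y \<Longrightarrow> Cod E h = z \<Longrightarrow>
   k \<in> Arr E \<Longrightarrow> Cod E k = (Dom E f \<otimes> Dom E g) \<otimes> Dom E h \<Longrightarrow>
    assoc E x y z \<cdot> ((f \<odot> g) \<odot> h) \<cdot> k = (f \<odot> (g \<odot> h)) \<cdot> assoc E (Dom E f) (Dom E g) (Dom E h) \<cdot> k"
  by (rule comp_eq_reassoc[OF assoc_nat]) auto

lemma symm_nat:
  "f \<in> Arr E \<Longrightarrow> g \<in> Arr E \<Longrightarrow> Cod E f = x \<Longrightarrow> Cod E g = y \<Longrightarrow>
    symm E x y \<cdot> (f \<odot> g) = (g \<odot> f) \<cdot> symm E (Dom E f) (Dom E g)"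
  by (rule symm_natural) (auto simp: hom_iff)

lemma inv_assoc_nat:
  assumes "f \<in> Arr E" "g \<in> Arr E" "h \<in> Arr E" "Cod E f = x" "Cod E g = y" "Cod E h = z"
  shows "inv_arr E (assoc E x y z) \<cdot> (f \<odot> (g \<odot> h)) =
    ((f \<odot> g) \<odot> h) \<cdot> inv_arr E (assoc E (Dom E f) (Dom E g) (Dom E h))"
proof (rule iso_left_cancel[where f = "assoc E x y z"])
  let ?A = "assoc E (Dom E f) (Dom E g) (Dom E h)"
  have "assoc E x y z \<cdot> ((f \<odot> g) \<odot> h) \<cdot> inv_arr E ?A = (f \<odot> (g \<odot> h)) \<cdot> ?A \<cdot> inv_arr E ?A"
    using assms by (intro assoc_nat2) auto
  then show "assoc E x y z \<cdot> inv_arr E (assoc E x y z) \<cdot> (f \<odot> (g \<odot> h)) =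
    assoc E x y z \<cdot> ((f \<odot> g) \<odot> h) \<cdot> inv_arr E ?A"
    using assms by auto
qed (use assms in auto)

text \<open>The right unitor is natural and invertible, so conjugating by it recovers a map from its
  tensor product with the unit.\<close>

lemma tunit_faithful:
  assumes "f \<in> Arr E" "g \<in> Arr E" "Dom E f = Dom E g" "Cod E f = Cod E g"
    and "f \<odot> ident E (tunit E) = g \<odot> ident E (tunit E)"
  shows "f = g"
proof (rule iso_right_cancel)
  have "f \<cdot> runit E (Dom E f) = runit E (Cod E f) \<cdot> (f \<odot> ident E (tunit E))"
    using assms by (intro runit_natural[symmetric]) (auto simp: hom_iff)
  also have "\<dots> = g \<cdot> runit E (Dom E f)"
    unfolding assms(5) using assms by (intro runit_natural) (auto simp: hom_iff)
  finally show "f \<cdot> runit E (Dom E f) = g \<cdot> runit E (Dom E f)" .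
qed (use assms in auto)

section \<open>Symmetric coherence\<close>

text \<open>The functor \<open>x \<mapsto> x \<otimes> -\<close> is faithful and turns the associator into an identity. Hence a
  structural isomorphism is determined by the map that it induces on iterated tensor products
  \<open>x\<^sub>1 \<otimes> (x\<^sub>2 \<otimes> \<dots> \<otimes> t)\<close>, natural in the tail \<open>t\<close>, and there only symmetries survive.\<close>

abbreviation wobj :: "'o list \<Rightarrow> 'o \<Rightarrow> 'o" where
  "wobj xs t \<equiv> foldr (tensor_obj E) xs t"

abbreviation warr :: "'o list \<Rightarrow> 'a \<Rightarrow> 'a" where
  "warr xs h \<equiv> foldr (\<lambda>x k. ident E x \<odot> k) xs h"

lemma wobj_Obj [simp]: "set xs \<subseteq> Obj E \<Longrightarrow> t \<in> Obj E \<Longrightarrow> wobj xs t \<in> Obj E"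
  by (induction xs) auto

lemma warr_typed:
  assumes "set xs \<subseteq> Obj E" "h \<in> Arr E"
  shows warr_Arr [simp]: "warr xs h \<in> Arr E" and Dom_warr [simp]: "Dom E (warr xs h) = wobj xs (Dom E h)"
    and Cod_warr [simp]: "Cod E (warr xs h) = wobj xs (Cod E h)"
  using assms(1) by (induction xs) (use assms(2) in auto)

lemma warr_ident [simp]: "set xs \<subseteq> Obj E \<Longrightarrow> t \<in> Obj E \<Longrightarrow> warr xs (ident E t) = ident E (wobj xs t)"
  by (induction xs) auto

end

text \<open>Bracketings of non-empty words of objects. With no constructor for an empty word,
  unitors never enter the comparison of two bracketings.\<close>

datatype 'o tree = Leaf 'o | Node "'o tree" "'o tree"

primrec leaves :: "'o tree \<Rightarrow> 'o list" where
  "leaves (Leaf x) = [x]"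
| "leaves (Node a b) = leaves a @ leaves b"

context closed_symmetric_monoidal_category
begin

primrec tobj :: "'o tree \<Rightarrow> 'o" where
  "tobj (Leaf x) = x"
| "tobj (Node a b) = tobj a \<otimes> tobj b"

text \<open>Moves all brackets to the right over a tail \<open>t\<close>, using associators only. At
  a node the second subtree is flattened first and then belongs to the tail of the first one, which
  is why the tail must be arbitrary.\<close>

primrec flatten :: "'o tree \<Rightarrow> 'o \<Rightarrow> 'a" where
  "flatten (Leaf x) t = ident E (x \<otimes> t)"
| "flatten (Node a b) t =
     flatten a (wobj (leaves b) t) \<cdot> (ident E (tobj a) \<odot> flatten b t) \<cdot> assoc E (tobj a) (tobj b) t"

abbreviation wf :: "'o tree \<Rightarrow> bool" where
  "wf a \<equiv> set (leaves a) \<subseteq> Obj E"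

lemma tobj_Obj [simp]: "wf a \<Longrightarrow> tobj a \<in> Obj E"
  by (induction a) auto

lemma flatten_typed:
  assumes "wf a" "t \<in> Obj E"
  shows flatten_iso [simp]: "iso E (flatten a t)"
    and flatten_Arr [simp]: "flatten a t \<in> Arr E"
    and Dom_flatten [simp]: "Dom E (flatten a t) = tobj a \<otimes> t"
    and Cod_flatten [simp]: "Cod E (flatten a t) = wobj (leaves a) t"
proof -
  have "iso E (flatten a t) \<and> flatten a t \<in> Arr E \<and> Dom E (flatten a t) = tobj a \<otimes> t \<and>
    Cod E (flatten a t) = wobj (leaves a) t"
    using assms by (induction a arbitrary: t) auto
  then show "iso E (flatten a t)" "flatten a t \<in> Arr E" "Dom E (flatten a t) = tobj a \<otimes> t"
    "Cod E (flatten a t) = wobj (leaves a) t" by auto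
qed

text \<open>Comes from naturality of the associator. The induction needs an arbitrary arrow on the
  tail: at a node, the hypothesis for \<open>a\<close> is applied to the arrow that \<open>h\<close>
  induces on the flattened \<open>b\<close>.\<close>

lemma flatten_natural:
  assumes "wf a" "h \<in> Arr E"
  shows "flatten a (Cod E h) \<cdot> (ident E (tobj a) \<odot> h) = warr (leaves a) h \<cdot> flatten a (Dom E h)"
  using assms
proof (induction a arbitrary: h)
  case (Leaf x)
  then show ?case by simp
next
  case (Node a b)
  let ?A = "assoc E (tobj a) (tobj b)"
  let ?s = "Dom E h" and ?t = "Cod E h"
  have w: "wf a" "wf b" "h \<in> Arr E" using Node by auto
  have "?A ?t \<cdot> (ident E (tobj a \<otimes> tobj b) \<odot> h) = (ident E (tobj a) \<odot> (ident E (tobj b) \<odot> h)) \<cdot> ?A ?s"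
    using w assoc_nat[of "ident E (tobj a)" "ident E (tobj b)" h, OF _ _ _ refl refl refl] by simp
  then have "flatten (Node a b) ?t \<cdot> (ident E (tobj (Node a b)) \<odot> h) =
    flatten a (wobj (leaves b) ?t) \<cdot>
      (ident E (tobj a) \<odot> (flatten b ?t \<cdot> (ident E (tobj b) \<odot> h))) \<cdot> ?A ?s"
    using w by (simp add: fuse)
  also have "\<dots> = (flatten a (Cod E (warr (leaves b) h)) \<cdot> (ident E (tobj a) \<odot> warr (leaves b) h)) \<cdot>
      (ident E (tobj a) \<odot> flatten b ?s) \<cdot> ?A ?s"
    using w by (simp add: Node.IH(2) fuse)
  also have "\<dots> = warr (leaves (Node a b)) h \<cdot> flatten (Node a b) ?s"
    using w by (subst Node.IH(1)) (auto simp: assoc_comp)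
  finally show ?case .
qed

text \<open>\<open>\<phi> t\<close> is the conjugate of \<open>f \<odot> ident E t\<close> by the
  flattenings, hence determined by \<open>f\<close>; it is carried along explicitly so that it can
  be kept in the form of a composite of symmetries. A whole family in \<open>t\<close> is required
  because tensoring places further factors behind.\<close>

definition rep :: "'o tree \<Rightarrow> 'o tree \<Rightarrow> 'a \<Rightarrow> ('o \<Rightarrow> 'a) \<Rightarrow> bool" where
  "rep a b f \<phi> \<longleftrightarrow> wf a \<and> wf b \<and> f \<in> hom E (tobj a) (tobj b) \<and>
     (\<forall>t \<in> Obj E. \<phi> t \<in> hom E (wobj (leaves a) t) (wobj (leaves b) t) \<and>
        flatten b t \<cdot> (f \<odot> ident E t) = \<phi> t \<cdot> flatten a t)"

lemma rep_typed:
  assumes "rep a b f \<phi>"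
  shows "wf a" "wf b" "f \<in> Arr E" "Dom E f = tobj a" "Cod E f = tobj b"
    and "t \<in> Obj E \<Longrightarrow> \<phi> t \<in> Arr E" "t \<in> Obj E \<Longrightarrow> Dom E (\<phi> t) = wobj (leaves a) t"
      "t \<in> Obj E \<Longrightarrow> Cod E (\<phi> t) = wobj (leaves b) t"
  using assms by (auto simp: rep_def hom_iff)

lemma rep_eq:
  "rep a b f \<phi> \<Longrightarrow> t \<in> Obj E \<Longrightarrow> flatten b t \<cdot> (f \<odot> ident E t) = \<phi> t \<cdot> flatten a t"
  by (simp add: rep_def)

text \<open>The tail \<open>tunit E\<close> suffices: flattenings are invertible and tensoring with
  the unit is faithful. Through this lemma an equation between structural maps is decided on
  words.\<close>

lemma rep_unique:
  assumes "rep a b f \<phi>" "rep a b g \<psi>" "\<phi> (tunit E) = \<psi> (tunit E)"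
  shows "f = g"
proof -
  have 1: "flatten b (tunit E) \<cdot> (f \<odot> ident E (tunit E)) = flatten b (tunit E) \<cdot> (g \<odot> ident E (tunit E))"
    using assms by (auto simp: rep_def)
  have "f \<odot> ident E (tunit E) = g \<odot> ident E (tunit E)"
    by (rule iso_left_cancel[OF 1]) (use assms(1,2) in \<open>auto simp: rep_def hom_iff\<close>)
  moreover have "f \<in> hom E (tobj a) (tobj b)" "g \<in> hom E (tobj a) (tobj b)"
    using assms by (auto simp: rep_def)
  ultimately show ?thesis by (elim tunit_faithful[rotated 4]) (auto simp: hom_iff)
qed

lemma rep_cong: "rep a b f \<phi> \<Longrightarrow> (\<And>t. t \<in> Obj E \<Longrightarrow> \<phi> t = \<psi> t) \<Longrightarrow> rep a b f \<psi>"
  by (auto simp: rep_def)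

lemma rep_ident: "wf a \<Longrightarrow> rep a a (ident E (tobj a)) (\<lambda>t. ident E (wobj (leaves a) t))"
  by (auto simp: rep_def hom_iff)

lemma rep_comp:
  assumes "rep a b f \<phi>" "rep b c g \<psi>"
  shows "rep a c (g \<cdot> f) (\<lambda>t. \<psi> t \<cdot> \<phi> t)"
  unfolding rep_def
proof (intro conjI ballI)
  fix t assume t: "t \<in> Obj E"
  note as = rep_typed[OF assms(1)] rep_typed[OF assms(2)]
  have "flatten c t \<cdot> ((g \<cdot> f) \<odot> ident E t) = (flatten c t \<cdot> (g \<odot> ident E t)) \<cdot> (f \<odot> ident E t)"
    using as t by (simp add: fuse)
  also have "flatten c t \<cdot> (g \<odot> ident E t) = \<psi> t \<cdot> flatten b t"
    using assms(2) t by (rule rep_eq)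
  also have "(\<psi> t \<cdot> flatten b t) \<cdot> (f \<odot> ident E t) = \<psi> t \<cdot> (flatten b t \<cdot> (f \<odot> ident E t))"
    using as t by (intro assoc_comp) auto
  also have "flatten b t \<cdot> (f \<odot> ident E t) = \<phi> t \<cdot> flatten a t"
    using assms(1) t by (rule rep_eq)
  also have "\<psi> t \<cdot> (\<phi> t \<cdot> flatten a t) = (\<psi> t \<cdot> \<phi> t) \<cdot> flatten a t"
    using as t by (intro assoc_comp[symmetric]) auto
  finally show "flatten c t \<cdot> ((g \<cdot> f) \<odot> ident E t) = (\<psi> t \<cdot> \<phi> t) \<cdot> flatten a t" .
qed (use assms in \<open>auto simp: rep_def hom_iff\<close>)

text \<open>\<open>g\<close> acts behind the leaves of \<open>a\<close>, which are mere spectators;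
  then \<open>f\<close> acts with the leaves of \<open>b'\<close> in its tail. It is here that
  \<open>\<phi>\<close> is needed at a tail other than \<open>t\<close>.\<close>

lemma rep_tensor:
  assumes "rep a b f \<phi>" "rep a' b' g \<psi>"
  shows "rep (Node a a') (Node b b') (f \<odot> g) (\<lambda>t. \<phi> (wobj (leaves b') t) \<cdot> warr (leaves a) (\<psi> t))"
  unfolding rep_def
proof (intro conjI ballI)
  fix t assume t: "t \<in> Obj E"
  note as = rep_typed[OF assms(1)] rep_typed[OF assms(2)]
  let ?w = "wobj (leaves b') t" and ?v = "wobj (leaves a') t"
  let ?A = "assoc E (tobj a) (tobj a') t"
  have w: "?w \<in> Obj E" using as t by auto
  have "flatten (Node b b') t \<cdot> ((f \<odot> g) \<odot> ident E t) =
     flatten b ?w \<cdot> (ident E (tobj b) \<odot> flatten b' t) \<cdot> (f \<odot> (g \<odot> ident E t)) \<cdot> ?A"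
    using as t w assoc_nat[of f g "ident E t", OF _ _ _ refl refl refl] by (simp add: assoc_comp)
  also have "\<dots> = flatten b ?w \<cdot> (f \<odot> (flatten b' t \<cdot> (g \<odot> ident E t))) \<cdot> ?A"
    using as t w by (simp add: fuse)
  also have "flatten b' t \<cdot> (g \<odot> ident E t) = \<psi> t \<cdot> flatten a' t"
    using assms(2) t by (rule rep_eq)
  also have "flatten b ?w \<cdot> (f \<odot> (\<psi> t \<cdot> flatten a' t)) \<cdot> ?A = (flatten b ?w \<cdot> (f \<odot> ident E ?w)) \<cdot> (ident E (tobj a) \<odot> (\<psi> t \<cdot> flatten a' t)) \<cdot> ?A"
    using as t w by (simp add: fuse)
  also have "flatten b ?w \<cdot> (f \<odot> ident E ?w) = \<phi> ?w \<cdot> flatten a ?w"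
    using assms(1) w by (rule rep_eq)
  also have "(\<phi> ?w \<cdot> flatten a ?w) \<cdot> (ident E (tobj a) \<odot> (\<psi> t \<cdot> flatten a' t)) \<cdot> ?A =
    \<phi> ?w \<cdot> (flatten a ?w \<cdot> (ident E (tobj a) \<odot> \<psi> t)) \<cdot> (ident E (tobj a) \<odot> flatten a' t) \<cdot> ?A"
    using as t w by (simp add: fuse)
  also have "flatten a ?w \<cdot> (ident E (tobj a) \<odot> \<psi> t) = warr (leaves a) (\<psi> t) \<cdot> flatten a ?v"
    using as t w flatten_natural[of a "\<psi> t"] by simp
  also have "\<phi> ?w \<cdot> (warr (leaves a) (\<psi> t) \<cdot> flatten a ?v) \<cdot> (ident E (tobj a) \<odot> flatten a' t) \<cdot> ?A =
     (\<phi> ?w \<cdot> warr (leaves a) (\<psi> t)) \<cdot> flatten (Node a a') t"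
    using as t w by (simp add: fuse)
  finally show "flatten (Node b b') t \<cdot> ((f \<odot> g) \<odot> ident E t) =
     (\<phi> ?w \<cdot> warr (leaves a) (\<psi> t)) \<cdot> flatten (Node a a') t" .
qed (use assms in \<open>auto simp: rep_def hom_iff\<close>)

text \<open>Conjugation by the flattenings respects inverses. The inverse on words is a parameter,
  so that it can be supplied in closed form.\<close>

lemma rep_inv:
  assumes "rep a b f \<phi>" "iso E f" "\<And>t. t \<in> Obj E \<Longrightarrow> inverse_arrows E (\<phi> t) (\<psi> t)"
  shows "rep b a (inv_arr E f) \<psi>"
  unfolding rep_def
proof (intro conjI ballI)
  note as = rep_typed[OF assms(1)] assms(2)
  fix t assume t: "t \<in> Obj E"
  note i = assms(3)[OF t, unfolded inverse_arrows_def hom_iff]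
  have ty: "\<psi> t \<in> Arr E" "Dom E (\<psi> t) = wobj (leaves b) t" "Cod E (\<psi> t) = wobj (leaves a) t"
    using i as t by auto
  show "\<psi> t \<in> hom E (wobj (leaves b) t) (wobj (leaves a) t)"
    using as t i by (auto simp: hom_iff)
  have "flatten a t \<cdot> (inv_arr E f \<odot> ident E t) = (\<psi> t \<cdot> \<phi> t) \<cdot> flatten a t \<cdot> (inv_arr E f \<odot> ident E t)"
    using as t i by simp
  also have "\<dots> = \<psi> t \<cdot> (\<phi> t \<cdot> flatten a t) \<cdot> (inv_arr E f \<odot> ident E t)"
    using as t ty by (simp add: assoc_comp)
  also have "\<phi> t \<cdot> flatten a t = flatten b t \<cdot> (f \<odot> ident E t)"
    using rep_eq[OF assms(1) t] by simp
  also have "\<psi> t \<cdot> (flatten b t \<cdot> (f \<odot> ident E t)) \<cdot> (inv_arr E f \<odot> ident E t) = \<psi> t \<cdot> flatten b t"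
    using as t i by (simp add: fuse)
  finally show "flatten a t \<cdot> (inv_arr E f \<odot> ident E t) = \<psi> t \<cdot> flatten b t" .
qed (use assms in \<open>auto simp: rep_def hom_iff\<close>)

text \<open>This is the pentagon for the three subtrees and the tail, together with naturality of
  the associator to carry the flattening of \<open>c\<close> across. Hence associators become
  identities on words.\<close>

lemma rep_assoc:
  assumes "wf a" "wf b" "wf c"
  shows "rep (Node (Node a b) c) (Node a (Node b c)) (assoc E (tobj a) (tobj b) (tobj c))
    (\<lambda>t. ident E (wobj (leaves a @ leaves b @ leaves c) t))"
  unfolding rep_def
proof (intro conjI ballI)
  fix t assume t: "t \<in> Obj E"
  let ?c = "wobj (leaves c) t" and ?A = "\<lambda>x y z. assoc E x y z"
  let ?b = "wobj (leaves b) ?c"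
  let ?x = "tobj a" and ?y = "tobj b" and ?z = "tobj c"
  have w: "?c \<in> Obj E" "?b \<in> Obj E" "?x \<in> Obj E" "?y \<in> Obj E" "?z \<in> Obj E" using assms t by auto
  have "flatten (Node a (Node b c)) t \<cdot> (?A ?x ?y ?z \<odot> ident E t) =
    flatten a ?b \<cdot> (ident E ?x \<odot> (flatten b ?c \<cdot> (ident E ?y \<odot> flatten c t))) \<cdot>
     ((ident E ?x \<odot> ?A ?y ?z t) \<cdot> ?A ?x (?y \<otimes> ?z) t \<cdot> (?A ?x ?y ?z \<odot> ident E t))"
    using assms t w by (simp add: fuse)
  also have "(ident E ?x \<odot> ?A ?y ?z t) \<cdot> ?A ?x (?y \<otimes> ?z) t \<cdot> (?A ?x ?y ?z \<odot> ident E t) =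
      ?A ?x ?y (?z \<otimes> t) \<cdot> ?A (?x \<otimes> ?y) ?z t"
    using assms t w by (intro pentagon) auto
  also have "flatten a ?b \<cdot> (ident E ?x \<odot> (flatten b ?c \<cdot> (ident E ?y \<odot> flatten c t))) \<cdot>
     (?A ?x ?y (?z \<otimes> t) \<cdot> ?A (?x \<otimes> ?y) ?z t) =
     flatten a ?b \<cdot> (ident E ?x \<odot> flatten b ?c) \<cdot> 
     ((ident E ?x \<odot> (ident E ?y \<odot> flatten c t)) \<cdot> ?A ?x ?y (?z \<otimes> t)) \<cdot> ?A (?x \<otimes> ?y) ?z t"
    using assms t w by (simp add: fuse)
  also have "(ident E ?x \<odot> (ident E ?y \<odot> flatten c t)) \<cdot> ?A ?x ?y (?z \<otimes> t) =
     ?A ?x ?y ?c \<cdot> (ident E (?x \<otimes> ?y) \<odot> flatten c t)"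
    using assms t w assoc_nat[of "ident E ?x" "ident E ?y" "flatten c t", OF _ _ _ refl refl refl] by simp
  also have "flatten a ?b \<cdot> (ident E ?x \<odot> flatten b ?c) \<cdot> 
     (?A ?x ?y ?c \<cdot> (ident E (?x \<otimes> ?y) \<odot> flatten c t)) \<cdot> ?A (?x \<otimes> ?y) ?z t =
     ident E (wobj (leaves a @ leaves b @ leaves c) t) \<cdot> flatten (Node (Node a b) c) t"
    using assms t w by (simp add: fuse)
  finally show "flatten (Node a (Node b c)) t \<cdot> (?A ?x ?y ?z \<odot> ident E t) =
     ident E (wobj (leaves a @ leaves b @ leaves c) t) \<cdot> flatten (Node (Node a b) c) t" .
qed (use assms in \<open>auto simp: hom_iff\<close>)

lemma rep_inv_assoc:
  assumes "wf a" "wf b" "wf c"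
  shows "rep (Node a (Node b c)) (Node (Node a b) c) (inv_arr E (assoc E (tobj a) (tobj b) (tobj c)))
    (\<lambda>t. ident E (wobj (leaves a @ leaves b @ leaves c) t))"
  by (rule rep_inv[OF rep_assoc]) (use assms in \<open>auto simp: inverse_arrows_def hom_iff\<close>)

text \<open>The symmetry of the two leading factors of a right-bracketed word. All word maps
  considered below are composites of such swaps behind spectators.\<close>

definition swap :: "'o \<Rightarrow> 'o \<Rightarrow> 'o \<Rightarrow> 'a" where
  "swap x y t = assoc E y x t \<cdot> (symm E x y \<odot> ident E t) \<cdot> inv_arr E (assoc E x y t)"

lemma swap_typed:
  assumes "x \<in> Obj E" "y \<in> Obj E" "t \<in> Obj E"
  shows swap_Arr [simp]: "swap x y t \<in> Arr E" and Dom_swap [simp]: "Dom E (swap x y t) = x \<otimes> (y \<otimes> t)"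
    and Cod_swap [simp]: "Cod E (swap x y t) = y \<otimes> (x \<otimes> t)"
  using assms by (auto simp: swap_def)

lemma rep_symm:
  "x \<in> Obj E \<Longrightarrow> y \<in> Obj E \<Longrightarrow> rep (Node (Leaf x) (Leaf y)) (Node (Leaf y) (Leaf x)) (symm E x y) (swap x y)"
  by (auto simp: rep_def hom_iff swap_def assoc_comp)

lemma swap_swap: 
  assumes "x \<in> Obj E" "y \<in> Obj E" "t \<in> Obj E"
  shows "swap y x t \<cdot> swap x y t = ident E (x \<otimes> (y \<otimes> t))"
  unfolding swap_def using assms by (simp add: assoc_comp) (simp add: fuse)

lemma swap_natural:
  assumes "f \<in> Arr E" "g \<in> Arr E" "h \<in> Arr E" "Cod E f = x" "Cod E g = y" "Cod E h = t"
  shows "swap x y t \<cdot> (f \<odot> (g \<odot> h)) = (g \<odot> (f \<odot> h)) \<cdot> swap (Dom E f) (Dom E g) (Dom E h)"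
proof -
  have "swap x y t \<cdot> (f \<odot> (g \<odot> h)) = assoc E y x t \<cdot> (symm E x y \<odot> ident E t) \<cdot>
      ((f \<odot> g) \<odot> h) \<cdot> inv_arr E (assoc E (Dom E f) (Dom E g) (Dom E h))"
    using assms inv_assoc_nat[OF assms] by (auto simp: swap_def assoc_comp)
  also have "\<dots> = assoc E y x t \<cdot> ((g \<odot> f) \<odot> h) \<cdot> (symm E (Dom E f) (Dom E g) \<odot> ident E (Dom E h)) \<cdot>
      inv_arr E (assoc E (Dom E f) (Dom E g) (Dom E h))"
    using assms by (auto simp: fuse symm_nat)
  also have "\<dots> = (g \<odot> (f \<odot> h)) \<cdot> swap (Dom E f) (Dom E g) (Dom E h)"
    using assms by (subst assoc_nat2) (auto simp: swap_def)
  finally show ?thesis .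
qed

text \<open>The hexagon, solved for the symmetry past a product: \<open>x\<close> passes
  \<open>y\<close> and then \<open>z\<close>, and the associators in between are invisible on
  words.\<close>

lemma rep_symm_right:
  assumes "x \<in> Obj E" "y \<in> Obj E" "z \<in> Obj E"
  shows "rep (Node (Leaf x) (Node (Leaf y) (Leaf z))) (Node (Node (Leaf y) (Leaf z)) (Leaf x))
    (symm E x (y \<otimes> z)) (\<lambda>t. (ident E y \<odot> swap x z t) \<cdot> swap x y (z \<otimes> t))"
proof -
  let ?A = "assoc E y z x" and ?B = "assoc E x y z"
  have "symm E x (y \<otimes> z) = inv_arr E ?A \<cdot> (?A \<cdot> symm E x (y \<otimes> z) \<cdot> ?B) \<cdot> inv_arr E ?B"
    using assms by (simp add: assoc_comp)
  also have "?A \<cdot> symm E x (y \<otimes> z) \<cdot> ?B = (ident E y \<odot> symm E x z) \<cdot> assoc E y x z \<cdot> (symm E x y \<odot> ident E z)"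
    using assms by (rule hexagon)
  finally have eq: "symm E x (y \<otimes> z) = inv_arr E ?A \<cdot>
    ((ident E y \<odot> symm E x z) \<cdot> assoc E y x z \<cdot> (symm E x y \<odot> ident E z)) \<cdot> inv_arr E ?B" .
  have s: "rep (Node (Leaf y) (Node (Leaf x) (Leaf z))) (Node (Leaf y) (Node (Leaf z) (Leaf x)))
      (ident E y \<odot> symm E x z) (\<lambda>t. ident E y \<odot> swap x z t)"
    by (rule rep_cong, rule rep_tensor[OF rep_ident[of "Leaf y", simplified] rep_symm])
      (use assms in auto)
  have s': "rep (Node (Node (Leaf x) (Leaf y)) (Leaf z)) (Node (Node (Leaf y) (Leaf x)) (Leaf z))
      (symm E x y \<odot> ident E z) (\<lambda>t. swap x y (z \<otimes> t))"
    by (rule rep_cong, rule rep_tensor[OF rep_symm rep_ident[of "Leaf z", simplified]])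
      (use assms in auto)
  show ?thesis unfolding eq
    using rep_comp[OF rep_inv_assoc[of "Leaf x" "Leaf y" "Leaf z", simplified]
      rep_comp[OF rep_comp[OF rep_comp[OF s' rep_assoc[of "Leaf y" "Leaf x" "Leaf z", simplified]]
        s, simplified] rep_inv_assoc[of "Leaf y" "Leaf z" "Leaf x", simplified], simplified], simplified] assms
    by (simp add: assoc_comp) (erule rep_cong, simp add: assoc_comp)
qed

text \<open>The hexagon with the product on the left is not among the axioms. Since
  \<open>symm E x y\<close> and \<open>symm E y x\<close> are mutually inverse, it follows by
  inverting the preceding case.\<close>

lemma rep_symm_left:
  assumes "x \<in> Obj E" "y \<in> Obj E" "z \<in> Obj E"
  shows "rep (Node (Node (Leaf y) (Leaf z)) (Leaf x)) (Node (Leaf x) (Node (Leaf y) (Leaf z)))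
    (symm E (y \<otimes> z) x) (\<lambda>t. swap y x (z \<otimes> t) \<cdot> (ident E y \<odot> swap z x t))"
proof -
  have "inv_arr E (symm E x (y \<otimes> z)) = symm E (y \<otimes> z) x"
    using assms by (intro inv_arr_eqI) (auto simp: inverse_arrows_def hom_iff)
  moreover have "inverse_arrows E ((ident E y \<odot> swap x z t) \<cdot> swap x y (z \<otimes> t))
     (swap y x (z \<otimes> t) \<cdot> (ident E y \<odot> swap z x t))" if t: "t \<in> Obj E" for t
  proof -
    let ?p = "swap x y (z \<otimes> t)" and ?p' = "swap y x (z \<otimes> t)"
    let ?q = "ident E y \<odot> swap x z t" and ?q' = "ident E y \<odot> swap z x t"
    have 1: "?p' \<cdot> ?p = ident E (x \<otimes> (y \<otimes> (z \<otimes> t)))" "?p \<cdot> ?p' = ident E (y \<otimes> (x \<otimes> (z \<otimes> t)))" 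
      using assms t by (simp_all add: swap_swap)
    have 2: "?q' \<cdot> ?q = ident E (y \<otimes> (x \<otimes> (z \<otimes> t)))" "?q \<cdot> ?q' = ident E (y \<otimes> (z \<otimes> (x \<otimes> t)))" 
      using assms t by (simp_all add: swap_swap interchange_law)
    have "(?p' \<cdot> ?q') \<cdot> (?q \<cdot> ?p) = ?p' \<cdot> ((?q' \<cdot> ?q) \<cdot> ?p)" using assms t by (simp add: assoc_comp)
    moreover have "(?q \<cdot> ?p) \<cdot> (?p' \<cdot> ?q') = ?q \<cdot> ((?p \<cdot> ?p') \<cdot> ?q')" using assms t by (simp add: assoc_comp)
    ultimately show ?thesis
      unfolding inverse_arrows_def 1 2 using assms t by (simp add: hom_iff 1 2)
  qed
  ultimately show ?thesis
    using rep_inv[OF rep_symm_right[OF assms]] assms by simp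
qed

end

section \<open>Permuting the factors of a tensor product\<close>

text \<open>The effect of \<open>insert_iso\<close> on the list of factors. A position beyond the
  end means the end, in agreement with the clauses of \<open>insert_iso\<close> for short
  lists.\<close>

definition insert_at :: "nat \<Rightarrow> 'x \<Rightarrow> 'x list \<Rightarrow> 'x list" where
  "insert_at j x e = take j e @ x # drop j e"

lemma insert_at_simps [simp]:
  "insert_at 0 x e = x # e" "insert_at j x [] = [x]" "insert_at (Suc j) x (a # e) = a # insert_at j x e"
  by (auto simp: insert_at_def)

lemma set_insert_at [simp]: "set (insert_at j x e) = insert x (set e)"
  by (induction e arbitrary: j) (case_tac [2] j, auto)

lemma length_insert_at [simp]: "length (insert_at j x e) = Suc (length e)"
  by (simp add: insert_at_def)

lemma map_insert_at: "map X (insert_at j x e) = insert_at j (X x) (map X e)"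
  by (simp add: insert_at_def take_map drop_map)

lemma nth_insert_at:
  "j \<le> length e \<Longrightarrow> i \<le> length e \<Longrightarrow>
    insert_at j x e ! i = (if i < j then e ! i else if i = j then x else e ! (i - 1))"
  by (auto simp: insert_at_def nth_append nth_Cons')

definition drop_perm :: "nat \<Rightarrow> (nat \<Rightarrow> nat) \<Rightarrow> nat \<Rightarrow> nat" where
  \<comment> \<open>the permutation induced by \<open>\<sigma>\<close> on the positions other than \<open>j\<close>\<close>
  "drop_perm j \<sigma> i =
     (let i' = (if i < j then i else Suc i) in if \<sigma> j < \<sigma> i' then \<sigma> i' - 1 else \<sigma> i')"

lemma tail_perm_eq: "tail_perm \<sigma> = drop_perm 0 \<sigma>"
  by (rule ext) (simp add: tail_perm_def drop_perm_def)

lemma length_lact [simp]: "length (lact \<sigma> c) = length c"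
  by (simp add: lact_def)

lemma lact_nth:
  assumes "\<sigma> permutes {..<length c}" "i < length c"
  shows "lact \<sigma> c ! \<sigma> i = c ! i"
proof -
  have "\<sigma> i < length c" using assms permutes_in_image[OF assms(1)] by auto
  then show ?thesis
    using assms permutes_inv[OF assms(1)] unfolding lact_def
    by (subst permute_list_nth) (auto simp: permutes_inverses)
qed

lemma lact_eqI:
  assumes "\<sigma> permutes {..<length c}" "length d = length c" "\<And>i. i < length c \<Longrightarrow> d ! \<sigma> i = c ! i"
  shows "lact \<sigma> c = d"
proof (rule nth_equalityI)
  fix k assume "k < length (lact \<sigma> c)"
  then have k: "k < length c" by simp
  define i where "i = inv \<sigma> k"
  have "i < length c" "\<sigma> i = k"
    using k permutes_in_image[OF permutes_inv[OF assms(1)]] assms(1) by (auto simp: i_def permutes_inverses)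
  then show "lact \<sigma> c ! k = d ! k" using lact_nth[OF assms(1)] assms(3) by metis
qed (use assms in simp)

lemma set_lact [simp]: "\<sigma> permutes {..<length c} \<Longrightarrow> set (lact \<sigma> c) = set c"
  unfolding lact_def by (rule set_permute_list) (rule permutes_inv)

lemma map_lact: "\<sigma> permutes {..<length c} \<Longrightarrow> map X (lact \<sigma> c) = lact \<sigma> (map X c)"
  unfolding lact_def by (rule permute_list_map[symmetric]) (rule permutes_inv)

lemma lact_id [simp]: "lact id c = c"
  by (simp add: lact_def)

lemma lact_lact:
  assumes "\<sigma> permutes {..<length c}" "\<sigma>' permutes {..<length c}"
  shows "lact \<sigma>' (lact \<sigma> c) = lact (\<sigma>' \<circ> \<sigma>) c"
proof -
  have "\<sigma> i < length c" if "i < length c" for i using that permutes_in_image[OF assms(1)] by auto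
  then show ?thesis
    using assms by (intro sym[OF lact_eqI] permutes_compose) (auto simp: lact_nth)
qed

lemma permutes_injD: "\<sigma> permutes S \<Longrightarrow> \<sigma> x = \<sigma> y \<Longrightarrow> x = y"
  by (auto dest: permutes_inj injD)

lemma permutes_lessThan:
  fixes n :: nat
  assumes "\<sigma> permutes {..<n}"
  shows "i < n \<Longrightarrow> \<sigma> i < n" and "n \<le> i \<Longrightarrow> \<sigma> i = i"
  using permutes_in_image[OF assms, of i] assms by (auto simp: permutes_def)

lemma permutes_lessThanI:
  fixes n :: nat
  assumes "\<And>i. i < n \<Longrightarrow> \<sigma> i < n" "\<And>i. n \<le> i \<Longrightarrow> \<sigma> i = i"
    and "\<And>i k. i < n \<Longrightarrow> k < n \<Longrightarrow> \<sigma> i = \<sigma> k \<Longrightarrow> i = k"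
  shows "\<sigma> permutes {..<n}"
proof (rule bij_imp_permutes)
  have "inj_on \<sigma> {..<n}" by (rule inj_onI) (use assms(3) in auto)
  moreover have "\<sigma> ` {..<n} = {..<n}"
    by (rule card_subset_eq) (use assms(1) calculation in \<open>auto simp: card_image\<close>)
  ultimately show "bij_betw \<sigma> {..<n} {..<n}" by (simp add: bij_betw_def)
qed (use assms(2) in auto)

lemma drop_perm_permutes:
  assumes "\<sigma> permutes {..<Suc n}" "j \<le> n"
  shows "drop_perm j \<sigma> permutes {..<n}"
proof (rule permutes_lessThanI)
  note l = permutes_lessThan[OF assms(1)]
  have ne: "\<sigma> j \<noteq> \<sigma> (if i < j then i else Suc i)" for i
    using permutes_injD[OF assms(1), of j "if i < j then i else Suc i"] by (auto split: if_splits)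
  show "drop_perm j \<sigma> i < n" if "i < n" for i
    using ne[of i] l(1)[of j] l(1)[of i] l(1)[of "Suc i"] that assms(2)
    by (auto simp: drop_perm_def split: if_splits)
  show "drop_perm j \<sigma> i = i" if "n \<le> i" for i
    using l(2)[of "Suc i"] l(1)[of j] that assms(2) by (auto simp: drop_perm_def)
  fix i k assume ik: "i < n" "k < n" "drop_perm j \<sigma> i = drop_perm j \<sigma> k"
  let ?s = "\<lambda>i. if i < j then i else Suc i"
  have "\<sigma> (?s i) = \<sigma> (?s k)"
    using ik(3) ne[of i] ne[of k] unfolding drop_perm_def Let_def by (simp split: if_splits; linarith)
  then have "?s i = ?s k" by (rule permutes_injD[OF assms(1)])
  then show "i = k" by (auto split: if_splits)
qed

text \<open>The entry at position \<open>j\<close> is followed separately; the others are renumbered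
  by removing \<open>j\<close> before the permutation and \<open>\<sigma> j\<close> after it. For
  \<open>j = 0\<close> this is the recursion on which \<open>perm_iso\<close> is built.\<close>

lemma lact_insert_at:
  assumes "\<sigma> permutes {..<Suc (length e)}" "j \<le> length e"
  shows "lact \<sigma> (insert_at j x e) = insert_at (\<sigma> j) x (lact (drop_perm j \<sigma>) e)"
proof (rule lact_eqI)
  note p = drop_perm_permutes[OF assms]
  note l = permutes_lessThan[OF assms(1)]
  fix i assume "i < length (insert_at j x e)"
  then have i: "i \<le> length e" by simp
  define k where "k = (if i < j then i else i - 1)"
  have L: "lact (drop_perm j \<sigma>) e ! drop_perm j \<sigma> k = e ! k" if "i \<noteq> j"
    by (rule lact_nth[OF p]) (use i that assms(2) in \<open>auto simp: k_def\<close>)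
  have ne: "\<sigma> i \<noteq> \<sigma> j" if "i \<noteq> j" using permutes_injD[OF assms(1)] that by blast
  have D: "drop_perm j \<sigma> k = (if \<sigma> j < \<sigma> i then \<sigma> i - 1 else \<sigma> i)" if "i \<noteq> j"
    using that by (auto simp: drop_perm_def k_def Let_def)
  show "insert_at (\<sigma> j) x (lact (drop_perm j \<sigma>) e) ! \<sigma> i = insert_at j x e ! i"
    using i assms(2) L D ne l(1)[of i] l(1)[of j]
    by (cases "i = j") (auto simp: nth_insert_at k_def split: if_splits)
qed (use assms in auto)

lemmas lact_Cons = lact_insert_at[where j = 0, simplified, folded tail_perm_eq]
lemmas tail_perm_permutes = drop_perm_permutes[where j = 0, simplified, folded tail_perm_eq]

text \<open>Removing two positions in either order induces the same permutation on the rest;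
  \<open>Suc k\<close> is called \<open>k\<close> once position 0 is gone.\<close>

lemma tail_drop_perm:
  assumes "\<sigma> permutes {..<Suc (Suc n)}" "k \<le> n"
  shows "tail_perm (drop_perm (Suc k) \<sigma>) = drop_perm k (tail_perm \<sigma>)"
proof
  fix i
  define i' where "i' = (if i < k then Suc i else Suc (Suc i))"
  have "\<sigma> 0 \<noteq> \<sigma> (Suc k)" "\<sigma> 0 \<noteq> \<sigma> i'" "\<sigma> (Suc k) \<noteq> \<sigma> i'"
    using permutes_injD[OF assms(1)] by (auto simp: i'_def dest!: permutes_injD[OF assms(1)] split: if_splits)
  then show "tail_perm (drop_perm (Suc k) \<sigma>) i = drop_perm k (tail_perm \<sigma>) i"
    by (auto simp: tail_perm_def drop_perm_def Let_def i'_def split: if_splits)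
qed

text \<open>The factor at position 0 sits at \<open>\<sigma> 0\<close> after the first permutation,
  so that is the position to remove from the second.\<close>

lemma tail_perm_comp:
  assumes "\<sigma> permutes {..<Suc n}" "\<sigma>' permutes {..<Suc n}"
  shows "tail_perm (\<sigma>' \<circ> \<sigma>) = drop_perm (\<sigma> 0) \<sigma>' \<circ> tail_perm \<sigma>"
proof
  fix i
  have "\<sigma> 0 \<noteq> \<sigma> (Suc i)" using permutes_injD[OF assms(1)] by blast
  \<comment> \<open>Closing the gap at \<open>\<sigma> 0\<close> and opening it again recovers the
    value of \<open>\<sigma>\<close>; the opening is what \<open>drop_perm (\<sigma> 0)\<close> does
    to its argument.\<close>
  then have "(if tail_perm \<sigma> i < \<sigma> 0 then tail_perm \<sigma> i else Suc (tail_perm \<sigma> i)) = \<sigma> (Suc i)"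
    by (auto simp: tail_perm_def)
  then show "tail_perm (\<sigma>' \<circ> \<sigma>) i = (drop_perm (\<sigma> 0) \<sigma>' \<circ> tail_perm \<sigma>) i"
    unfolding drop_perm_def o_def Let_def by (simp add: tail_perm_def[of "\<lambda>x. \<sigma>' (\<sigma> x)"])
qed

lemma tail_perm_id [simp]: "tail_perm id = id"
  by (rule ext) (simp add: tail_perm_def)

lemma tail_block_perm:
  assumes "\<sigma> permutes {..<Suc n}"
  shows "tail_perm (block_perm (Suc n) \<sigma> \<tau>) = block_perm n (tail_perm \<sigma>) \<tau>"
  using permutes_lessThan(1)[OF assms, of 0] by (intro ext) (auto simp: tail_perm_def block_perm_def)

lemma block_perm_permutes:
  assumes "\<sigma> permutes {..<n}" "\<tau> permutes {..<m}"
  shows "block_perm n \<sigma> \<tau> permutes {..<n + m}"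
proof (rule permutes_lessThanI)
  note l = permutes_lessThan[OF assms(1)] and l' = permutes_lessThan[OF assms(2)]
  show "block_perm n \<sigma> \<tau> i < n + m" if "i < n + m" for i
    using that l(1)[of i] l'(1)[of "i - n"] by (auto simp: block_perm_def)
  show "block_perm n \<sigma> \<tau> i = i" if "n + m \<le> i" for i
    using that l'(2)[of "i - n"] by (auto simp: block_perm_def)
  fix i k assume ik: "block_perm n \<sigma> \<tau> i = block_perm n \<sigma> \<tau> k"
  show "i = k"
  proof (cases "i < n"; cases "k < n")
    assume "i < n" "k < n"
    then show ?thesis using ik permutes_injD[OF assms(1)] by (auto simp: block_perm_def)
  next
    assume a: "\<not> i < n" "\<not> k < n"
    then have "i - n = k - n" using ik permutes_injD[OF assms(2)] by (auto simp: block_perm_def)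
    then show ?thesis using a by linarith
  qed (use ik l(1)[of i] l(1)[of k] in \<open>auto simp: block_perm_def\<close>)
qed

lemma lact_append:
  assumes "\<sigma> permutes {..<length c}" "\<tau> permutes {..<length d}"
  shows "lact (block_perm (length c) \<sigma> \<tau>) (c @ d) = lact \<sigma> c @ lact \<tau> d"
proof (rule lact_eqI)
  note l = permutes_lessThan[OF assms(1)]
  show "(lact \<sigma> c @ lact \<tau> d) ! block_perm (length c) \<sigma> \<tau> i = (c @ d) ! i" if "i < length (c @ d)" for i
    using that l(1)[of i] lact_nth[OF assms(1), of i] lact_nth[OF assms(2), of "i - length c"]
    by (auto simp: block_perm_def nth_append)
qed (use assms block_perm_permutes in auto)

section \<open>The braid relation and permutations of words\<close>

context closed_symmetric_monoidal_category
begin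

text \<open>The direction opposite to \<open>rep_unique\<close>: an equation known for arrows is
  read off on words, at any tail, because flattenings can be cancelled.\<close>

lemma rep_unique_word:
  assumes "rep a b f \<phi>" "rep a b f \<psi>" "t \<in> Obj E"
  shows "\<phi> t = \<psi> t"
proof (rule iso_right_cancel)
  show "\<phi> t \<cdot> flatten a t = \<psi> t \<cdot> flatten a t"
    using rep_eq[OF assms(1,3)] rep_eq[OF assms(2,3)] by simp
qed (use assms rep_typed[OF assms(1)] rep_typed[OF assms(2)] in auto)

text \<open>Naturality of the symmetry between \<open>x\<close> and a product, applied to the
  exchange of \<open>a\<close> and \<open>b\<close>: \<open>x\<close> may pass the pair before or
  after this exchange. Expanding the symmetry past a product by the hexagon and reading both sides
  on words gives the three swaps on each side.\<close>

lemma yang_baxter: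
  assumes "a \<in> Obj E" "b \<in> Obj E" "x \<in> Obj E" "t \<in> Obj E"
  shows "swap a b (x \<otimes> t) \<cdot> (ident E a \<odot> swap x b t) \<cdot> swap x a (b \<otimes> t) =
    (ident E b \<odot> swap x a t) \<cdot> swap x b (a \<otimes> t) \<cdot> (ident E x \<odot> swap a b t)"
proof -
  let ?l = "Node (Leaf x) (Node (Leaf a) (Leaf b))" and ?r = "Node (Node (Leaf b) (Leaf a)) (Leaf x)"
  have s: "rep (Node (Node (Leaf a) (Leaf b)) (Leaf x)) ?r (symm E a b \<odot> ident E x)
      (\<lambda>t. swap a b (x \<otimes> t))"
    by (rule rep_cong, rule rep_tensor[OF rep_symm rep_ident[of "Leaf x", simplified]])
      (use assms in auto)
  have s': "rep ?l (Node (Leaf x) (Node (Leaf b) (Leaf a))) (ident E x \<odot> symm E a b)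
      (\<lambda>t. ident E x \<odot> swap a b t)"
    by (rule rep_cong, rule rep_tensor[OF rep_ident[of "Leaf x", simplified] rep_symm])
      (use assms in auto)
  have eq: "(symm E a b \<odot> ident E x) \<cdot> symm E x (a \<otimes> b) = symm E x (b \<otimes> a) \<cdot> (ident E x \<odot> symm E a b)"
    using assms symm_nat[of "ident E x" "symm E a b", OF _ _ refl refl] by simp
  have "rep ?l ?r ((symm E a b \<odot> ident E x) \<cdot> symm E x (a \<otimes> b))
      (\<lambda>t. swap a b (x \<otimes> t) \<cdot> (ident E a \<odot> swap x b t) \<cdot> swap x a (b \<otimes> t))"
    using assms by (intro rep_comp[OF rep_symm_right s])
  moreover have "rep ?l ?r (symm E x (b \<otimes> a) \<cdot> (ident E x \<odot> symm E a b))
      (\<lambda>t. ((ident E b \<odot> swap x a t) \<cdot> swap x b (a \<otimes> t)) \<cdot> (ident E x \<odot> swap a b t))"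
    using assms by (intro rep_comp[OF s' rep_symm_right])
  ultimately have "swap a b (x \<otimes> t) \<cdot> (ident E a \<odot> swap x b t) \<cdot> swap x a (b \<otimes> t) =
      ((ident E b \<odot> swap x a t) \<cdot> swap x b (a \<otimes> t)) \<cdot> (ident E x \<odot> swap a b t)"
    unfolding eq by (rule rep_unique_word) (rule assms(4))
  then show ?thesis using assms by (simp add: assoc_comp)
qed

text \<open>The form of \<open>insert_iso\<close> on words: one adjacent swap for each letter of
  \<open>e\<close> that \<open>x\<close> passes.\<close>

fun word_insert :: "'o \<Rightarrow> nat \<Rightarrow> 'o list \<Rightarrow> 'o \<Rightarrow> 'a" where
  "word_insert x 0 e t = ident E (wobj (x # e) t)"
| "word_insert x (Suc j) [] t = ident E (x \<otimes> t)"
| "word_insert x (Suc j) (a # e) t = (ident E a \<odot> word_insert x j e t) \<cdot> swap x a (wobj e t)"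

lemma word_insert_typed:
  assumes "x \<in> Obj E" "set e \<subseteq> Obj E" "t \<in> Obj E"
  shows word_insert_Arr [simp]: "word_insert x j e t \<in> Arr E"
    and Dom_word_insert [simp]: "Dom E (word_insert x j e t) = wobj (x # e) t"
    and Cod_word_insert [simp]: "Cod E (word_insert x j e t) = wobj (insert_at j x e) t"
proof -
  have "word_insert x j e t \<in> Arr E \<and> Dom E (word_insert x j e t) = wobj (x # e) t \<and>
      Cod E (word_insert x j e t) = wobj (insert_at j x e) t"
    using assms by (induction x j e t rule: word_insert.induct) auto
  then show "word_insert x j e t \<in> Arr E" "Dom E (word_insert x j e t) = wobj (x # e) t"
    "Cod E (word_insert x j e t) = wobj (insert_at j x e) t" by auto
qed

text \<open>Starting from \<open>x\<close>, \<open>a\<close> and the word \<open>e\<close>, the two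
  letters are inserted in either order; placing \<open>a\<close> at \<open>p \<le> k\<close> shifts
  the target of \<open>x\<close> to \<open>Suc k\<close>. The induction removes a head letter
  \<open>b\<close> that both pass, and the three swaps among \<open>a\<close>, \<open>x\<close> and
  \<open>b\<close> are reordered by \<open>yang_baxter\<close>.\<close>

lemma word_insert_commute_le:
  assumes "p \<le> k" "k \<le> length e" "a \<in> Obj E" "x \<in> Obj E" "set e \<subseteq> Obj E" "t \<in> Obj E"
  shows "word_insert a p (insert_at k x e) t \<cdot> (ident E a \<odot> word_insert x k e t) \<cdot> swap x a (wobj e t) =
    word_insert x (Suc k) (insert_at p a e) t \<cdot> (ident E x \<odot> word_insert a p e t)"
  using assms
proof (induction p arbitrary: k e)
  case 0
  then show ?case by simp
next
  case (Suc p)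
  then obtain b e' k' where e: "e = b # e'" "k = Suc k'" by (cases e; cases k) auto
  let ?W = "wobj e' t"
  let ?I = "word_insert a p (insert_at k' x e') t" and ?J = "word_insert x k' e' t"
  let ?K = "word_insert x (Suc k') (insert_at p a e') t" and ?L = "word_insert a p e' t"
  have b: "b \<in> Obj E" and e': "set e' \<subseteq> Obj E" and W: "?W \<in> Obj E" using Suc e by auto
  note o = b e' W \<open>a \<in> Obj E\<close> \<open>x \<in> Obj E\<close> \<open>t \<in> Obj E\<close>
  have IH: "?I \<cdot> (ident E a \<odot> ?J) \<cdot> swap x a ?W = ?K \<cdot> (ident E x \<odot> ?L)"
    using Suc e by (intro Suc.IH) auto
  have "word_insert a (Suc p) (insert_at k x e) t \<cdot> (ident E a \<odot> word_insert x k e t) \<cdot> swap x a (wobj e t)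
     = (ident E b \<odot> ?I) \<cdot> (swap a b (wobj (insert_at k' x e') t) \<cdot> (ident E a \<odot> (ident E b \<odot> ?J))) \<cdot>
       (ident E a \<odot> swap x b ?W) \<cdot> swap x a (b \<otimes> ?W)"
    using o e by (simp add: fuse)
  also have "swap a b (wobj (insert_at k' x e') t) \<cdot> (ident E a \<odot> (ident E b \<odot> ?J)) =
      (ident E b \<odot> (ident E a \<odot> ?J)) \<cdot> swap a b (x \<otimes> ?W)"
    using o by (subst swap_natural) auto
  also have "(ident E b \<odot> ?I) \<cdot> ((ident E b \<odot> (ident E a \<odot> ?J)) \<cdot> swap a b (x \<otimes> ?W)) \<cdot>
       (ident E a \<odot> swap x b ?W) \<cdot> swap x a (b \<otimes> ?W) =
     (ident E b \<odot> (?I \<cdot> (ident E a \<odot> ?J))) \<cdot>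
       (swap a b (x \<otimes> ?W) \<cdot> (ident E a \<odot> swap x b ?W) \<cdot> swap x a (b \<otimes> ?W))"
    using o by (simp add: fuse)
  also have "swap a b (x \<otimes> ?W) \<cdot> (ident E a \<odot> swap x b ?W) \<cdot> swap x a (b \<otimes> ?W) =
      (ident E b \<odot> swap x a ?W) \<cdot> swap x b (a \<otimes> ?W) \<cdot> (ident E x \<odot> swap a b ?W)"
    using o by (intro yang_baxter) auto
  also have "(ident E b \<odot> (?I \<cdot> (ident E a \<odot> ?J))) \<cdot>
      ((ident E b \<odot> swap x a ?W) \<cdot> swap x b (a \<otimes> ?W) \<cdot> (ident E x \<odot> swap a b ?W)) =
     (ident E b \<odot> (?I \<cdot> (ident E a \<odot> ?J) \<cdot> swap x a ?W)) \<cdot>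
      swap x b (a \<otimes> ?W) \<cdot> (ident E x \<odot> swap a b ?W)"
    using o by (simp add: fuse)
  also have "\<dots> = (ident E b \<odot> ?K) \<cdot> ((ident E b \<odot> (ident E x \<odot> ?L)) \<cdot> swap x b (a \<otimes> ?W)) \<cdot>
      (ident E x \<odot> swap a b ?W)"
    unfolding IH using o by (simp add: fuse)
  also have "(ident E b \<odot> (ident E x \<odot> ?L)) \<cdot> swap x b (a \<otimes> ?W) =
      swap x b (wobj (insert_at p a e') t) \<cdot> (ident E x \<odot> (ident E b \<odot> ?L))"
    using o by (subst swap_natural) auto
  also have "(ident E b \<odot> ?K) \<cdot> (swap x b (wobj (insert_at p a e') t) \<cdot> (ident E x \<odot> (ident E b \<odot> ?L))) \<cdot>
      (ident E x \<odot> swap a b ?W) = word_insert x (Suc k) (insert_at (Suc p) a e) t \<cdot>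
      (ident E x \<odot> word_insert a (Suc p) e t)"
    using o e by (simp add: fuse)
  finally show ?case .
qed

text \<open>The preceding lemma with the two letters in exchanged roles; the additional swap cancels
  against its inverse.\<close>

lemma word_insert_commute_gt:
  assumes "k \<le> n" "n \<le> length e" "a \<in> Obj E" "x \<in> Obj E" "set e \<subseteq> Obj E" "t \<in> Obj E"
  shows "word_insert a (Suc n) (insert_at k x e) t \<cdot> (ident E a \<odot> word_insert x k e t) \<cdot> swap x a (wobj e t) =
    word_insert x k (insert_at n a e) t \<cdot> (ident E x \<odot> word_insert a n e t)"
proof -
  have W: "wobj e t \<in> Obj E" using assms by simp
  have c: "insert_at (Suc n) a (insert_at k x e) = insert_at k x (insert_at n a e)"
    using assms(1,2)
  proof (induction k arbitrary: n e)
    case (Suc k)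
    then show ?case by (cases e; cases n) auto
  qed simp
  have "word_insert a (Suc n) (insert_at k x e) t \<cdot> (ident E a \<odot> word_insert x k e t) \<cdot> swap x a (wobj e t) =
     (word_insert x k (insert_at n a e) t \<cdot> (ident E x \<odot> word_insert a n e t) \<cdot> swap a x (wobj e t)) \<cdot>
       swap x a (wobj e t)"
    using assms W by (subst word_insert_commute_le) (auto simp: assoc_comp)
  also have "\<dots> = word_insert x k (insert_at n a e) t \<cdot> (ident E x \<odot> word_insert a n e t)"
    using assms W by (simp add: assoc_comp swap_swap)
  finally show ?thesis .
qed

primrec word_perm :: "'o list \<Rightarrow> (nat \<Rightarrow> nat) \<Rightarrow> 'o \<Rightarrow> 'a" where
  "word_perm [] \<sigma> t = ident E t"
| "word_perm (x # xs) \<sigma> t =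
     word_insert x (\<sigma> 0) (lact (tail_perm \<sigma>) xs) t \<cdot> (ident E x \<odot> word_perm xs (tail_perm \<sigma>) t)"

lemma word_perm_typed:
  assumes "\<sigma> permutes {..<length xs}" "set xs \<subseteq> Obj E" "t \<in> Obj E"
  shows word_perm_Arr: "word_perm xs \<sigma> t \<in> Arr E"
    and Dom_word_perm: "Dom E (word_perm xs \<sigma> t) = wobj xs t"
    and Cod_word_perm: "Cod E (word_perm xs \<sigma> t) = wobj (lact \<sigma> xs) t"
proof -
  have "word_perm xs \<sigma> t \<in> Arr E \<and> Dom E (word_perm xs \<sigma> t) = wobj xs t \<and>
      Cod E (word_perm xs \<sigma> t) = wobj (lact \<sigma> xs) t"
    using assms
  proof (induction xs arbitrary: \<sigma>)
    case (Cons x xs)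
    then have "tail_perm \<sigma> permutes {..<length xs}" by (intro tail_perm_permutes) auto
    with Cons show ?case by (simp add: lact_Cons)
  qed (simp add: lact_def)
  then show "word_perm xs \<sigma> t \<in> Arr E" "Dom E (word_perm xs \<sigma> t) = wobj xs t"
    "Cod E (word_perm xs \<sigma> t) = wobj (lact \<sigma> xs) t" by auto
qed

text \<open>Induction on \<open>j\<close> lets \<open>x\<close> pass the head letter
  \<open>a\<close> of the word. Whether \<open>a\<close> finally stands before or after
  \<open>x\<close> decides which of the two commutation lemmas applies.\<close>

lemma word_perm_insert:
  assumes "\<sigma> permutes {..<Suc (length e)}" "j \<le> length e" "x \<in> Obj E" "set e \<subseteq> Obj E" "t \<in> Obj E"
  shows "word_perm (insert_at j x e) \<sigma> t \<cdot> word_insert x j e t =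
    word_insert x (\<sigma> j) (lact (drop_perm j \<sigma>) e) t \<cdot> (ident E x \<odot> word_perm e (drop_perm j \<sigma>) t)"
  using assms
proof (induction j arbitrary: \<sigma> e)
  case 0
  then have "tail_perm \<sigma> permutes {..<length e}" by (intro tail_perm_permutes) auto
  with 0 show ?case by (simp add: word_perm_typed flip: tail_perm_eq)
next
  case (Suc k)
  then obtain a e' where e: "e = a # e'" by (cases e) auto
  define \<tau> where "\<tau> = tail_perm \<sigma>"
  define \<rho> where "\<rho> = drop_perm (Suc k) \<sigma>"
  define L where "L = lact (drop_perm k \<tau>) e'"
  have \<sigma>: "\<sigma> permutes {..<Suc (Suc (length e'))}" using Suc.prems(1) e by simp
  have k: "k \<le> length e'" using Suc.prems(2) e by simp
  have \<tau>: "\<tau> permutes {..<Suc (length e')}" unfolding \<tau>_def using \<sigma> by (rule tail_perm_permutes)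
  have \<rho>: "\<rho> permutes {..<Suc (length e')}"
    unfolding \<rho>_def using \<sigma> k by (intro drop_perm_permutes) auto
  have d: "drop_perm k \<tau> permutes {..<length e'}" using \<tau> k by (rule drop_perm_permutes)
  have tr: "tail_perm \<rho> = drop_perm k \<tau>" unfolding \<rho>_def \<tau>_def using \<sigma> k by (rule tail_drop_perm)
  have o: "a \<in> Obj E" "x \<in> Obj E" "set e' \<subseteq> Obj E" "t \<in> Obj E" using Suc.prems e by auto
  have L: "set L \<subseteq> Obj E" "length L = length e'" using o d by (auto simp: L_def)
  have oW: "wobj L t \<in> Obj E" "wobj e' t \<in> Obj E" using o L by auto
  let ?P = "word_perm e' (drop_perm k \<tau>) t"
  have P: "?P \<in> Arr E" "Dom E ?P = wobj e' t" "Cod E ?P = wobj L t"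
    using word_perm_typed[OF d o(3,4)] by (auto simp: L_def)
  have IH: "word_perm (insert_at k x e') \<tau> t \<cdot> word_insert x k e' t =
      word_insert x (\<tau> k) L t \<cdot> (ident E x \<odot> ?P)"
    unfolding L_def using \<tau> k o by (intro Suc.IH)
  have Lk: "lact \<tau> (insert_at k x e') = insert_at (\<tau> k) x L"
    unfolding L_def using \<tau> k by (rule lact_insert_at)
  have Lr: "lact \<rho> (a # e') = insert_at (\<rho> 0) a L"
    unfolding L_def tr[symmetric] using \<rho> by (rule lact_Cons)
  have Q: "word_perm (insert_at k x e') \<tau> t \<in> Arr E"
    "Dom E (word_perm (insert_at k x e') \<tau> t) = wobj (insert_at k x e') t"
    "Cod E (word_perm (insert_at k x e') \<tau> t) = wobj (insert_at (\<tau> k) x L) t"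
    using word_perm_typed[of \<tau> "insert_at k x e'" t] \<tau> o Lk by auto
  \<comment> \<open>The final positions of \<open>a\<close> and \<open>x\<close> are
    \<open>\<sigma> 0\<close> and \<open>\<sigma> (Suc k)\<close>. The values
    \<open>\<rho> 0\<close> and \<open>\<tau> k\<close> are the same positions counted with the
    other of the two letters left out.\<close>
  have com: "word_insert a (\<sigma> 0) (insert_at (\<tau> k) x L) t \<cdot> (ident E a \<odot> word_insert x (\<tau> k) L t) \<cdot>
      swap x a (wobj L t) =
    word_insert x (\<sigma> (Suc k)) (insert_at (\<rho> 0) a L) t \<cdot> (ident E x \<odot> word_insert a (\<rho> 0) L t)"
  proof (cases "\<sigma> 0 < \<sigma> (Suc k)")
    case True
    then have "\<rho> 0 = \<sigma> 0" "\<sigma> (Suc k) = Suc (\<tau> k)" "\<sigma> 0 \<le> \<tau> k"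
      by (auto simp: \<rho>_def \<tau>_def drop_perm_def tail_perm_def)
    moreover have "\<tau> k \<le> length L" using permutes_lessThan(1)[OF \<tau>, of k] k L by simp
    ultimately show ?thesis using o L by (simp add: word_insert_commute_le)
  next
    case False
    moreover have "\<sigma> 0 \<noteq> \<sigma> (Suc k)" using permutes_injD[OF \<sigma>] by blast
    ultimately have "\<sigma> 0 = Suc (\<rho> 0)" "\<sigma> (Suc k) = \<tau> k" "\<tau> k \<le> \<rho> 0"
      by (auto simp: \<rho>_def \<tau>_def drop_perm_def tail_perm_def)
    moreover have "\<rho> 0 \<le> length L" using permutes_lessThan(1)[OF \<rho>, of 0] L by simp
    ultimately show ?thesis using o L by (simp add: word_insert_commute_gt)
  qed
  have "word_perm (insert_at (Suc k) x e) \<sigma> t \<cdot> word_insert x (Suc k) e t =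
     word_insert a (\<sigma> 0) (insert_at (\<tau> k) x L) t \<cdot>
     (ident E a \<odot> (word_perm (insert_at k x e') \<tau> t \<cdot> word_insert x k e' t)) \<cdot> swap x a (wobj e' t)"
    using o Q L k oW Lk by (simp add: e \<tau>_def[symmetric] fuse)
  also have "\<dots> = word_insert a (\<sigma> 0) (insert_at (\<tau> k) x L) t \<cdot>
     (ident E a \<odot> word_insert x (\<tau> k) L t) \<cdot> ((ident E a \<odot> (ident E x \<odot> ?P)) \<cdot> swap x a (wobj e' t))"
    unfolding IH using o Q P L k oW by (simp add: fuse)
  also have "(ident E a \<odot> (ident E x \<odot> ?P)) \<cdot> swap x a (wobj e' t) =
     swap x a (wobj L t) \<cdot> (ident E x \<odot> (ident E a \<odot> ?P))"
    using o P oW by (subst swap_natural) auto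
  also have "word_insert a (\<sigma> 0) (insert_at (\<tau> k) x L) t \<cdot> (ident E a \<odot> word_insert x (\<tau> k) L t) \<cdot>
       swap x a (wobj L t) \<cdot> (ident E x \<odot> (ident E a \<odot> ?P)) =
    (word_insert a (\<sigma> 0) (insert_at (\<tau> k) x L) t \<cdot> (ident E a \<odot> word_insert x (\<tau> k) L t) \<cdot>
       swap x a (wobj L t)) \<cdot> (ident E x \<odot> (ident E a \<odot> ?P))"
    using o P L oW by (simp add: assoc_comp)
  also have "\<dots> = word_insert x (\<sigma> (Suc k)) (insert_at (\<rho> 0) a L) t \<cdot>
     (ident E x \<odot> (word_insert a (\<rho> 0) L t \<cdot> (ident E a \<odot> ?P)))"
    unfolding com using o P L oW by (simp add: fuse)
  also have "\<dots> = word_insert x (\<sigma> (Suc k)) (lact \<rho> e) t \<cdot> (ident E x \<odot> word_perm e \<rho> t)"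
    by (simp add: e Lr tr L_def)
  finally show ?case unfolding \<rho>_def .
qed

text \<open>\<open>word_perm_insert\<close> carries the insertion of the head across the second
  permutation. What remains is the statement for the remaining letters, whose induced permutations
  compose by \<open>tail_perm_comp\<close>.\<close>

lemma word_perm_comp:
  assumes "\<sigma> permutes {..<length xs}" "\<sigma>' permutes {..<length xs}" "set xs \<subseteq> Obj E" "t \<in> Obj E"
  shows "word_perm (lact \<sigma> xs) \<sigma>' t \<cdot> word_perm xs \<sigma> t = word_perm xs (\<sigma>' \<circ> \<sigma>) t"
  using assms
proof (induction xs arbitrary: \<sigma> \<sigma>')
  case Nil
  then show ?case by (simp add: lact_def)
next
  case (Cons x xs)
  define \<tau> where "\<tau> = tail_perm \<sigma>"
  define \<rho> where "\<rho> = drop_perm (\<sigma> 0) \<sigma>'"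
  have \<sigma>: "\<sigma> permutes {..<Suc (length xs)}" "\<sigma>' permutes {..<Suc (length xs)}" using Cons.prems by auto
  have o: "x \<in> Obj E" "set xs \<subseteq> Obj E" "t \<in> Obj E" using Cons.prems by auto
  have s0: "\<sigma> 0 \<le> length xs" using permutes_lessThan(1)[OF \<sigma>(1), of 0] by simp
  have \<tau>: "\<tau> permutes {..<length xs}" unfolding \<tau>_def using \<sigma>(1) by (rule tail_perm_permutes)
  have \<rho>: "\<rho> permutes {..<length xs}" unfolding \<rho>_def using \<sigma>(2) s0 by (rule drop_perm_permutes)
  have t: "tail_perm (\<lambda>i. \<sigma>' (\<sigma> i)) = \<rho> \<circ> \<tau>"
    using tail_perm_comp[OF \<sigma>] by (simp add: \<rho>_def \<tau>_def o_def)
  note [simp] = word_perm_typed[OF \<tau> o(2,3)]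
  have [simp]: "word_perm (lact \<tau> xs) \<rho> t \<in> Arr E" "Dom E (word_perm (lact \<tau> xs) \<rho> t) = wobj (lact \<tau> xs) t"
    "Cod E (word_perm (lact \<tau> xs) \<rho> t) = wobj (lact \<rho> (lact \<tau> xs)) t"
    using word_perm_typed[of \<rho> "lact \<tau> xs" t] \<rho> \<tau> o by auto
  have l: "set (lact \<tau> xs) \<subseteq> Obj E" "set (lact \<rho> (lact \<tau> xs)) \<subseteq> Obj E" using \<tau> \<rho> o by auto
  have [simp]: "word_perm (insert_at (\<sigma> 0) x (lact \<tau> xs)) \<sigma>' t \<in> Arr E"
    "Dom E (word_perm (insert_at (\<sigma> 0) x (lact \<tau> xs)) \<sigma>' t) = wobj (insert_at (\<sigma> 0) x (lact \<tau> xs)) t"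
    using word_perm_typed[of \<sigma>' "insert_at (\<sigma> 0) x (lact \<tau> xs)" t] \<sigma> o l by auto
  have "word_perm (lact \<sigma> (x # xs)) \<sigma>' t \<cdot> word_perm (x # xs) \<sigma> t =
     (word_perm (insert_at (\<sigma> 0) x (lact \<tau> xs)) \<sigma>' t \<cdot> word_insert x (\<sigma> 0) (lact \<tau> xs) t) \<cdot>
       (ident E x \<odot> word_perm xs \<tau> t)"
    using o l lact_Cons[OF \<sigma>(1), of x, folded \<tau>_def] by (simp add: \<tau>_def[symmetric] assoc_comp)
  also have "word_perm (insert_at (\<sigma> 0) x (lact \<tau> xs)) \<sigma>' t \<cdot> word_insert x (\<sigma> 0) (lact \<tau> xs) t =
     word_insert x (\<sigma>' (\<sigma> 0)) (lact \<rho> (lact \<tau> xs)) t \<cdot> (ident E x \<odot> word_perm (lact \<tau> xs) \<rho> t)"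
    unfolding \<rho>_def using \<sigma> s0 o l by (intro word_perm_insert) auto
  also have "(word_insert x (\<sigma>' (\<sigma> 0)) (lact \<rho> (lact \<tau> xs)) t \<cdot> (ident E x \<odot> word_perm (lact \<tau> xs) \<rho> t)) \<cdot>
       (ident E x \<odot> word_perm xs \<tau> t) =
     word_insert x (\<sigma>' (\<sigma> 0)) (lact \<rho> (lact \<tau> xs)) t \<cdot>
       (ident E x \<odot> (word_perm (lact \<tau> xs) \<rho> t \<cdot> word_perm xs \<tau> t))"
    using o l by (simp add: fuse)
  also have "word_perm (lact \<tau> xs) \<rho> t \<cdot> word_perm xs \<tau> t = word_perm xs (\<rho> \<circ> \<tau>) t"
    using \<tau> \<rho> o(2,3) by (rule Cons.IH)
  finally show ?case using \<tau> \<rho> by (simp add: t lact_lact)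
qed

lemma word_perm_id [simp]: "set xs \<subseteq> Obj E \<Longrightarrow> t \<in> Obj E \<Longrightarrow> word_perm xs id t = ident E (wobj xs t)"
  by (induction xs) auto

lemma word_insert_append:
  "j \<le> length e \<Longrightarrow> word_insert x j (e @ e') t = word_insert x j e (wobj e' t)"
  by (induction x j e t rule: word_insert.induct) auto

text \<open>Every letter of \<open>xs\<close> is inserted at a position within \<open>xs\<close>, so
  the permuted \<open>ys\<close> is just a part of the tail during these insertions.\<close>

lemma word_perm_append:
  assumes "\<sigma> permutes {..<length xs}" "\<tau> permutes {..<length ys}" "set xs \<subseteq> Obj E" "set ys \<subseteq> Obj E" "t \<in> Obj E"
  shows "word_perm (xs @ ys) (block_perm (length xs) \<sigma> \<tau>) t =
    word_perm xs \<sigma> (wobj (lact \<tau> ys) t) \<cdot> warr xs (word_perm ys \<tau> t)"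
  using assms
proof (induction xs arbitrary: \<sigma>)
  case Nil
  have "block_perm 0 s \<tau> = \<tau>" for s by (rule ext) (simp add: block_perm_def)
  with Nil show ?case by (simp add: word_perm_typed)
next
  case (Cons x xs)
  have \<sigma>: "\<sigma> permutes {..<Suc (length xs)}" using Cons.prems by auto
  note tp = tail_perm_permutes[OF \<sigma>]
  have s0: "\<sigma> 0 \<le> length xs" using permutes_lessThan(1)[OF \<sigma>, of 0] by simp
  have "set (lact (tail_perm \<sigma>) xs) \<subseteq> Obj E" "set (lact \<tau> ys) \<subseteq> Obj E" using Cons.prems tp by auto
  moreover have "block_perm (Suc (length xs)) \<sigma> \<tau> 0 = \<sigma> 0" by (simp add: block_perm_def)
  ultimately show ?case using Cons \<sigma> tp s0
    by (simp add: tail_block_perm lact_append word_insert_append word_perm_typed fuse)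
qed

end

lemma lact_Nil_iff [simp]: "lact \<sigma> c = [] \<longleftrightarrow> c = []"
  using length_lact[of \<sigma> c] by (metis length_0_conv)

section \<open>Coherence of middle interchange, joins and permutation isomorphisms\<close>

context closed_symmetric_monoidal_category
begin

lemma middle_swap_typed:
  assumes "w \<in> Obj E" "x \<in> Obj E" "y \<in> Obj E" "z \<in> Obj E"
  shows middle_swap_Arr [simp]: "middle_swap E w x y z \<in> Arr E"
    and Dom_middle_swap [simp]: "Dom E (middle_swap E w x y z) = (w \<otimes> x) \<otimes> (y \<otimes> z)"
    and Cod_middle_swap [simp]: "Cod E (middle_swap E w x y z) = (w \<otimes> y) \<otimes> (x \<otimes> z)"
  using assms by (auto simp: middle_swap_def)

lemma middle_swap_natural:
  assumes "f \<in> Arr E" "g \<in> Arr E" "h \<in> Arr E" "k \<in> Arr E"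
  shows "middle_swap E (Cod E f) (Cod E g) (Cod E h) (Cod E k) \<cdot> ((f \<odot> g) \<odot> (h \<odot> k)) =
    ((f \<odot> h) \<odot> (g \<odot> k)) \<cdot> middle_swap E (Dom E f) (Dom E g) (Dom E h) (Dom E k)"
proof -
  have ms: "middle_swap E w x y z =
    inv_arr E (assoc E w y (x \<otimes> z)) \<cdot> (ident E w \<odot> swap x y z) \<cdot> assoc E w x (y \<otimes> z)" for w x y z
    by (simp add: middle_swap_def swap_def)
  let ?A = "assoc E (Dom E f) (Dom E g) (Dom E h \<otimes> Dom E k)"
  have "middle_swap E (Cod E f) (Cod E g) (Cod E h) (Cod E k) \<cdot> ((f \<odot> g) \<odot> (h \<odot> k)) =
     inv_arr E (assoc E (Cod E f) (Cod E h) (Cod E g \<otimes> Cod E k)) \<cdot>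
     (f \<odot> (swap (Cod E g) (Cod E h) (Cod E k) \<cdot> (g \<odot> (h \<odot> k)))) \<cdot> ?A"
    using assms assoc_nat[of f g "h \<odot> k", OF _ _ _ refl refl refl] by (simp add: ms fuse)
  also have "swap (Cod E g) (Cod E h) (Cod E k) \<cdot> (g \<odot> (h \<odot> k)) =
     (h \<odot> (g \<odot> k)) \<cdot> swap (Dom E g) (Dom E h) (Dom E k)"
    using assms by (intro swap_natural) auto
  also have "inv_arr E (assoc E (Cod E f) (Cod E h) (Cod E g \<otimes> Cod E k)) \<cdot>
     (f \<odot> ((h \<odot> (g \<odot> k)) \<cdot> swap (Dom E g) (Dom E h) (Dom E k))) \<cdot> ?A =
     (inv_arr E (assoc E (Cod E f) (Cod E h) (Cod E g \<otimes> Cod E k)) \<cdot> (f \<odot> (h \<odot> (g \<odot> k)))) \<cdot>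
     (ident E (Dom E f) \<odot> swap (Dom E g) (Dom E h) (Dom E k)) \<cdot> ?A"
    using assms by (simp add: fuse)
  also have "inv_arr E (assoc E (Cod E f) (Cod E h) (Cod E g \<otimes> Cod E k)) \<cdot> (f \<odot> (h \<odot> (g \<odot> k))) =
     ((f \<odot> h) \<odot> (g \<odot> k)) \<cdot> inv_arr E (assoc E (Dom E f) (Dom E h) (Dom E g \<otimes> Dom E k))"
    using assms by (subst inv_assoc_nat) auto
  finally show ?thesis using assms by (simp add: ms assoc_comp)
qed

text \<open>On words only the symmetry of the two middle factors survives, behind \<open>w\<close>
  and in front of \<open>z\<close>. Its representation is a hypothesis so that a middle factor may
  itself be a product, in which case the hexagon provides it.\<close>

lemma rep_middle_swap:
  assumes "rep (Node a b) (Node b a) (symm E (tobj a) (tobj b)) \<phi>" "wf w" "wf z"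
  shows "rep (Node (Node w a) (Node b z)) (Node (Node w b) (Node a z))
    (middle_swap E (tobj w) (tobj a) (tobj b) (tobj z)) (\<lambda>t. warr (leaves w) (\<phi> (wobj (leaves z) t)))"
proof -
  note ty = rep_typed[OF assms(1)]
  have ab: "wf a" "wf b" using ty(1) by auto
  note r1 = rep_assoc[of w a "Node b z"]
  note r2 = rep_inv_assoc[of a b z]
  note r3 = rep_tensor[OF assms(1) rep_ident[of z]]
  note r4 = rep_assoc[of b a z]
  note r5 = rep_inv_assoc[of w b "Node a z"]
  note big = rep_comp[OF rep_comp[OF r1 rep_tensor[OF rep_ident[of w] rep_comp[OF rep_comp[OF r2 r3] r4]]] r5,
      unfolded tobj.simps]
  show ?thesis
    unfolding middle_swap_def
    by (rule rep_cong, rule big) (use assms ty ab in \<open>auto simp: fuse\<close>)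
qed

text \<open>On words both sides perform the swaps of \<open>h''\<close> with \<open>a\<close>, of
  \<open>h''\<close> with \<open>b\<close> and of \<open>h'\<close> with \<open>a\<close>. They
  differ only in the order of the last two, which involve disjoint factors and commute by naturality
  of \<open>swap\<close>.\<close>

lemma middle_swap_assoc:
  assumes o: "h \<in> Obj E" "h' \<in> Obj E" "h'' \<in> Obj E" "a \<in> Obj E" "b \<in> Obj E" "c \<in> Obj E"
  shows "assoc E (h \<otimes> a) (h' \<otimes> b) (h'' \<otimes> c) \<cdot> (middle_swap E h h' a b \<odot> ident E (h'' \<otimes> c)) \<cdot>
      middle_swap E (h \<otimes> h') h'' (a \<otimes> b) c =
    (ident E (h \<otimes> a) \<odot> middle_swap E h' h'' b c) \<cdot> middle_swap E h (h' \<otimes> h'') a (b \<otimes> c) \<cdot>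
      (assoc E h h' h'' \<odot> assoc E a b c)"
proof (rule rep_unique)
  let ?L = Leaf
  note m1 = rep_middle_swap[where w = "Node (?L h) (?L h')" and a = "?L h''" and b = "Node (?L a) (?L b)"
      and z = "?L c", unfolded tobj.simps, OF rep_symm_right]
  note m2 = rep_tensor[OF rep_middle_swap[where w = "?L h" and a = "?L h'" and b = "?L a" and z = "?L b",
      unfolded tobj.simps, OF rep_symm] rep_ident[of "Node (?L h'') (?L c)"], unfolded tobj.simps]
  note m3 = rep_assoc[of "Node (?L h) (?L a)" "Node (?L h') (?L b)" "Node (?L h'') (?L c)", unfolded tobj.simps]
  show "rep (Node (Node (Node (?L h) (?L h')) (?L h'')) (Node (Node (?L a) (?L b)) (?L c)))
     (Node (Node (?L h) (?L a)) (Node (Node (?L h') (?L b)) (Node (?L h'') (?L c))))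
     (assoc E (h \<otimes> a) (h' \<otimes> b) (h'' \<otimes> c) \<cdot> (middle_swap E h h' a b \<odot> ident E (h'' \<otimes> c)) \<cdot>
      middle_swap E (h \<otimes> h') h'' (a \<otimes> b) c)
     (\<lambda>t. ident E h \<odot> (swap h' a (b \<otimes> (h'' \<otimes> (c \<otimes> t))) \<cdot>
       (ident E h' \<odot> ((ident E a \<odot> swap h'' b (c \<otimes> t)) \<cdot> swap h'' a (b \<otimes> (c \<otimes> t))))))"
    by (rule rep_cong, rule rep_comp[OF rep_comp[OF m1 m2] m3]) (use o in \<open>auto simp: fuse\<close>)
  note n1 = rep_tensor[OF rep_assoc[of "?L h" "?L h'" "?L h''"] rep_assoc[of "?L a" "?L b" "?L c"],
      unfolded tobj.simps]
  note n2 = rep_middle_swap[where w = "?L h" and a = "Node (?L h') (?L h'')" and b = "?L a"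
      and z = "Node (?L b) (?L c)", unfolded tobj.simps, OF rep_symm_left]
  note n3 = rep_tensor[OF rep_ident[of "Node (?L h) (?L a)"]
      rep_middle_swap[where w = "?L h'" and a = "?L h''" and b = "?L b" and z = "?L c",
      unfolded tobj.simps, OF rep_symm], unfolded tobj.simps]
  show "rep (Node (Node (Node (?L h) (?L h')) (?L h'')) (Node (Node (?L a) (?L b)) (?L c)))
     (Node (Node (?L h) (?L a)) (Node (Node (?L h') (?L b)) (Node (?L h'') (?L c))))
     ((ident E (h \<otimes> a) \<odot> middle_swap E h' h'' b c) \<cdot> middle_swap E h (h' \<otimes> h'') a (b \<otimes> c) \<cdot>
      (assoc E h h' h'' \<odot> assoc E a b c))
     (\<lambda>t. ident E h \<odot> ((ident E a \<odot> (ident E h' \<odot> swap h'' b (c \<otimes> t))) \<cdot>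
       swap h' a (h'' \<otimes> (b \<otimes> (c \<otimes> t))) \<cdot> (ident E h' \<odot> swap h'' a (b \<otimes> (c \<otimes> t)))))"
    by (rule rep_cong, rule rep_comp[OF rep_comp[OF n1 n2] n3]) (use o in \<open>auto simp: fuse\<close>)
  let ?t = "tunit E"
  have "swap h' a (b \<otimes> (h'' \<otimes> (c \<otimes> ?t))) \<cdot> (ident E h' \<odot> (ident E a \<odot> swap h'' b (c \<otimes> ?t))) =
     (ident E a \<odot> (ident E h' \<odot> swap h'' b (c \<otimes> ?t))) \<cdot> swap h' a (h'' \<otimes> (b \<otimes> (c \<otimes> ?t)))"
    using o by (subst swap_natural) auto
  from comp_eq_reassoc[OF this, of "ident E h' \<odot> swap h'' a (b \<otimes> (c \<otimes> ?t))"]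
  show "ident E h \<odot> (swap h' a (b \<otimes> (h'' \<otimes> (c \<otimes> ?t))) \<cdot>
       (ident E h' \<odot> ((ident E a \<odot> swap h'' b (c \<otimes> ?t)) \<cdot> swap h'' a (b \<otimes> (c \<otimes> ?t))))) =
     ident E h \<odot> ((ident E a \<odot> (ident E h' \<odot> swap h'' b (c \<otimes> ?t))) \<cdot>
       swap h' a (h'' \<otimes> (b \<otimes> (c \<otimes> ?t))) \<cdot> (ident E h' \<odot> swap h'' a (b \<otimes> (c \<otimes> ?t))))"
    using o by (simp add: fuse)
qed

text \<open>The coherence needed for the interchange rule. On words both sides perform the swaps of
  \<open>h4\<close> with \<open>a\<close>, of \<open>h2\<close> with \<open>h3\<close> and, last, of
  \<open>h2\<close> with \<open>a\<close>; the first two occur in different orders and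
  commute.\<close>

lemma middle_swap_middle_swap:
  assumes o: "h1 \<in> Obj E" "h2 \<in> Obj E" "h3 \<in> Obj E" "h4 \<in> Obj E" "a \<in> Obj E" "b \<in> Obj E"
  shows "middle_swap E h1 h2 (h3 \<otimes> a) (h4 \<otimes> b) \<cdot> (ident E (h1 \<otimes> h2) \<odot> middle_swap E h3 h4 a b) \<cdot>
      assoc E (h1 \<otimes> h2) (h3 \<otimes> h4) (a \<otimes> b) =
    (assoc E h1 h3 a \<odot> assoc E h2 h4 b) \<cdot> middle_swap E (h1 \<otimes> h3) (h2 \<otimes> h4) a b \<cdot>
      (middle_swap E h1 h2 h3 h4 \<odot> ident E (a \<otimes> b))"
proof (rule rep_unique)
  let ?L = Leaf
  let ?s = "Node (Node (Node (?L h1) (?L h2)) (Node (?L h3) (?L h4))) (Node (?L a) (?L b))"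
  let ?r = "Node (Node (?L h1) (Node (?L h3) (?L a))) (Node (?L h2) (Node (?L h4) (?L b)))"
  note m1 = rep_assoc[of "Node (?L h1) (?L h2)" "Node (?L h3) (?L h4)" "Node (?L a) (?L b)", unfolded tobj.simps]
  note m2 = rep_tensor[OF rep_ident[of "Node (?L h1) (?L h2)"]
     rep_middle_swap[where w = "?L h3" and a = "?L h4" and b = "?L a" and z = "?L b",
      unfolded tobj.simps, OF rep_symm], unfolded tobj.simps]
  note m3 = rep_middle_swap[where w = "?L h1" and a = "?L h2" and b = "Node (?L h3) (?L a)"
      and z = "Node (?L h4) (?L b)", unfolded tobj.simps, OF rep_symm_right]
  show "rep ?s ?r (middle_swap E h1 h2 (h3 \<otimes> a) (h4 \<otimes> b) \<cdot>
      (ident E (h1 \<otimes> h2) \<odot> middle_swap E h3 h4 a b) \<cdot> assoc E (h1 \<otimes> h2) (h3 \<otimes> h4) (a \<otimes> b))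
    (\<lambda>t. ident E h1 \<odot> ((ident E h3 \<odot> swap h2 a (h4 \<otimes> (b \<otimes> t))) \<cdot> (swap h2 h3 (a \<otimes> (h4 \<otimes> (b \<otimes> t))) \<cdot>
      (ident E h2 \<odot> (ident E h3 \<odot> swap h4 a (b \<otimes> t))))))"
    by (rule rep_cong, rule rep_comp[OF rep_comp[OF m1 m2] m3]) (use o in \<open>auto simp: fuse\<close>)
  note n1 = rep_tensor[OF rep_middle_swap[where w = "?L h1" and a = "?L h2" and b = "?L h3" and z = "?L h4",
      unfolded tobj.simps, OF rep_symm] rep_ident[of "Node (?L a) (?L b)"], unfolded tobj.simps]
  note n2 = rep_middle_swap[where w = "Node (?L h1) (?L h3)" and a = "Node (?L h2) (?L h4)" and b = "?L a"
      and z = "?L b", unfolded tobj.simps, OF rep_symm_left]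
  note n3 = rep_tensor[OF rep_assoc[of "?L h1" "?L h3" "?L a"] rep_assoc[of "?L h2" "?L h4" "?L b"],
      unfolded tobj.simps]
  show "rep ?s ?r ((assoc E h1 h3 a \<odot> assoc E h2 h4 b) \<cdot> middle_swap E (h1 \<otimes> h3) (h2 \<otimes> h4) a b \<cdot>
      (middle_swap E h1 h2 h3 h4 \<odot> ident E (a \<otimes> b)))
    (\<lambda>t. ident E h1 \<odot> ((ident E h3 \<odot> (swap h2 a (h4 \<otimes> (b \<otimes> t)) \<cdot> (ident E h2 \<odot> swap h4 a (b \<otimes> t)))) \<cdot>
      swap h2 h3 (h4 \<otimes> (a \<otimes> (b \<otimes> t)))))"
    by (rule rep_cong, rule rep_comp[OF rep_comp[OF n1 n2] n3]) (use o in \<open>auto simp: fuse\<close>)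
  let ?t = "tunit E"
  have "swap h2 h3 (a \<otimes> (h4 \<otimes> (b \<otimes> ?t))) \<cdot> (ident E h2 \<odot> (ident E h3 \<odot> swap h4 a (b \<otimes> ?t))) =
     (ident E h3 \<odot> (ident E h2 \<odot> swap h4 a (b \<otimes> ?t))) \<cdot> swap h2 h3 (h4 \<otimes> (a \<otimes> (b \<otimes> ?t)))"
    using o by (subst swap_natural) auto
  then show "ident E h1 \<odot> ((ident E h3 \<odot> swap h2 a (h4 \<otimes> (b \<otimes> ?t))) \<cdot> (swap h2 h3 (a \<otimes> (h4 \<otimes> (b \<otimes> ?t))) \<cdot>
      (ident E h2 \<odot> (ident E h3 \<odot> swap h4 a (b \<otimes> ?t))))) =
    ident E h1 \<odot> ((ident E h3 \<odot> (swap h2 a (h4 \<otimes> (b \<otimes> ?t)) \<cdot> (ident E h2 \<odot> swap h4 a (b \<otimes> ?t)))) \<cdot>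
      swap h2 h3 (h4 \<otimes> (a \<otimes> (b \<otimes> ?t))))"
    using o by (simp add: fuse)
qed

text \<open>The trees of right-bracketed products, arranged to agree with \<open>tens_obj\<close>,
  including its irrelevant value at the empty list.\<close>

fun comb :: "'o list \<Rightarrow> 'o tree" where
  "comb [] = Leaf (tunit E)"
| "comb [x] = Leaf x"
| "comb (x # y # ys) = Node (Leaf x) (comb (y # ys))"

lemma comb_Cons: "xs \<noteq> [] \<Longrightarrow> comb (x # xs) = Node (Leaf x) (comb xs)"
  by (cases xs) auto

lemma leaves_comb [simp]: "xs \<noteq> [] \<Longrightarrow> leaves (comb xs) = xs"
  by (induction xs rule: comb.induct) auto

lemma tobj_comb: "tobj (comb (map X c)) = tens_obj E X c"
  by (induction c rule: induct_list012) auto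

lemma tens_obj_Cons: "d \<noteq> [] \<Longrightarrow> tens_obj E X (c # d) = X c \<otimes> tens_obj E X d"
  by (cases d) auto

lemma tens_obj_Obj [simp]: "X ` set c \<subseteq> Obj E \<Longrightarrow> tens_obj E X c \<in> Obj E"
  by (induction c rule: induct_list012) auto

text \<open>\<open>join\<close> is composed of associators, and these become identities on
  words.\<close>

lemma rep_join:
  assumes "c \<noteq> []" "d \<noteq> []" "X ` set c \<subseteq> Obj E" "X ` set d \<subseteq> Obj E"
  shows "rep (Node (comb (map X c)) (comb (map X d))) (comb (map X (c @ d))) (join E X c d)
    (\<lambda>t. ident E (wobj (map X (c @ d)) t))"
  using assms
proof (induction c rule: induct_list012)
  case (2 c)
  then show ?case using rep_ident[of "Node (Leaf (X c)) (comb (map X d))"]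
    by (simp add: comb_Cons tobj_comb)
next
  case (3 c b bs)
  let ?b = "comb (map X (b # bs))" and ?d = "comb (map X d)"
  have IH: "rep (Node ?b ?d) (comb (map X (b # bs @ d))) (join E X (b # bs) d)
    (\<lambda>t. ident E (wobj (map X (b # bs @ d)) t))"
    using 3 by auto
  have ob: "X c \<in> Obj E" "X b \<in> Obj E" "X ` set bs \<subseteq> Obj E" "X ` set d \<subseteq> Obj E" using 3 by auto
  have l: "leaves ?b = map X (b # bs)" "leaves ?d = map X d" using 3 by auto
  note r = rep_comp[OF rep_assoc[of "Leaf (X c)" ?b ?d]
      rep_tensor[OF rep_ident[of "Leaf (X c)"] IH, unfolded tobj.simps]]
  have "rep (Node (Node (Leaf (X c)) ?b) ?d) (Node (Leaf (X c)) (comb (map X (b # bs @ d))))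
    ((ident E (X c) \<odot> join E X (b # bs) d) \<cdot> assoc E (X c) (tobj ?b) (tobj ?d))
    (\<lambda>t. ident E (wobj (map X (c # b # bs @ d)) t))"
    by (rule rep_cong, rule r[unfolded tobj.simps]) (use ob l in auto)
  then show ?case by (simp add: tobj_comb del: comb.simps(2) list.map) (simp add: tobj_comb)
qed simp

text \<open>A right-bracketed product has no tail after its last factor, which forces the separate
  singleton clause of \<open>insert_iso\<close>. On words a tail is always present, and that clause
  becomes an instance of the general one.\<close>

lemma rep_insert_iso:
  assumes "X c \<in> Obj E" "X ` set e \<subseteq> Obj E"
  shows "rep (comb (map X (c # e))) (comb (map X (insert_at j c e))) (insert_iso E X c j e)
    (word_insert (X c) j (map X e))"
  using assms
proof (induction X c j e rule: insert_iso.induct)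
  case (1 X c e)
  have ob: "X c \<in> Obj E" "X ` set e \<subseteq> Obj E" using 1 by auto
  show ?case
    by (rule rep_cong)
      (use ob rep_ident[of "comb (map X (c # e))", unfolded tobj_comb] in \<open>auto simp del: comb.simps\<close>)
next
  case (2 X c j)
  then show ?case using rep_ident[of "Leaf (X c)"] by simp
next
  case (3 X c j a)
  have "rep (Node (Leaf (X c)) (Leaf (X a))) (Node (Leaf (X a)) (Leaf (X c))) (symm E (X c) (X a))
    (word_insert (X c) (Suc j) [X a])"
    by (rule rep_cong, rule rep_symm) (use 3 in \<open>auto, cases j, auto\<close>)
  then show ?case by (simp del: word_insert.simps)
next
  case (4 X c j a b bs)
  let ?L = Leaf and ?b = "comb (map X (b # bs))"
  have ob: "X c \<in> Obj E" "X a \<in> Obj E" "X b \<in> Obj E" "X ` set bs \<subseteq> Obj E" using 4 by auto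
  have IH: "rep (Node (?L (X c)) ?b) (comb (map X (insert_at j c (b # bs)))) (insert_iso E X c j (b # bs))
      (word_insert (X c) j (map X (b # bs)))"
    using 4 by (simp add: comb_Cons)
  note i1 = rep_inv_assoc[of "?L (X c)" "?L (X a)" ?b]
  note i2 = rep_tensor[OF rep_symm[of "X c" "X a"] rep_ident[of ?b]]
  note i3 = rep_assoc[of "?L (X a)" "?L (X c)" ?b]
  note i4 = rep_tensor[OF rep_ident[of "?L (X a)"] IH]
  note big = rep_comp[OF rep_comp[OF rep_comp[OF i1 i2] i3] i4, unfolded tobj.simps tobj_comb]
  have ne: "insert_at j (X c) (map X (b # bs)) \<noteq> []" by (simp add: insert_at_def)
  have l: "leaves ?b = map X (b # bs)" by (rule leaves_comb) simp
  note l' = leaves_comb[OF ne]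
  have "rep (Node (?L (X c)) (Node (?L (X a)) ?b)) (Node (?L (X a)) (comb (map X (insert_at j c (b # bs)))))
     (insert_iso E X c (Suc j) (a # b # bs)) (word_insert (X c) (Suc j) (map X (a # b # bs)))"
    unfolding insert_iso.simps
    by (rule rep_cong, rule big) (use ob l l' in \<open>auto simp: fuse map_insert_at\<close>)
  then show ?case using ne by (simp add: comb_Cons map_insert_at del: word_insert.simps)
qed

lemma rep_perm_iso:
  assumes "c \<noteq> []" "\<sigma> permutes {..<length c}" "X ` set c \<subseteq> Obj E"
  shows "rep (comb (map X c)) (comb (map X (lact \<sigma> c))) (perm_iso E X c \<sigma>) (word_perm (map X c) \<sigma>)"
  using assms
proof (induction c arbitrary: \<sigma> rule: induct_list012)
  case (2 c)
  have "\<sigma> i = i" for i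
    using permutes_lessThan[of \<sigma> 1 i] 2 by (cases "i = 0") auto
  then have "\<sigma> = id" by auto
  moreover have "rep (Leaf (X c)) (Leaf (X c)) (ident E (X c)) (word_perm [X c] id)"
    by (rule rep_cong, rule rep_ident[of "Leaf (X c)", unfolded tobj.simps]) (use 2 in auto)
  ultimately show ?case by (simp only: lact_id list.map comb.simps perm_iso.simps)
next
  case (3 c b bs)
  define \<tau> where "\<tau> = tail_perm \<sigma>"
  have \<sigma>: "\<sigma> permutes {..<Suc (length (b # bs))}" using 3 by simp
  have \<tau>: "\<tau> permutes {..<length (b # bs)}" unfolding \<tau>_def using \<sigma> by (rule tail_perm_permutes)
  have ob: "X c \<in> Obj E" "X b \<in> Obj E" "X ` set bs \<subseteq> Obj E" using 3 by auto
  have IH: "rep (comb (map X (b # bs))) (comb (map X (lact \<tau> (b # bs)))) (perm_iso E X (b # bs) \<tau>)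
      (word_perm (map X (b # bs)) \<tau>)"
    by (rule 3(2)) (use \<tau> ob in auto)
  have ne: "map X (lact \<tau> (b # bs)) \<noteq> []" using length_lact[of \<tau> "b # bs"] by (metis length_map list.size(3) list.size(4) nat.distinct(1) add_Suc_right)
  have set: "X ` set (lact \<tau> (b # bs)) \<subseteq> Obj E" using ob set_lact[OF \<tau>] by auto
  note r = rep_tensor[OF rep_ident[of "Leaf (X c)"] IH]
  have eq: "comb (map X (c # lact \<tau> (b # bs))) = Node (Leaf (X c)) (comb (map X (lact \<tau> (b # bs))))"
    using ne by (simp add: comb_Cons)
  have wp: "word_perm (X b # map X bs) \<tau> t \<in> Arr E"
    "Cod E (word_perm (X b # map X bs) \<tau> t) = wobj (map X (lact \<tau> (b # bs))) t" if "t \<in> Obj E" for t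
    using word_perm_typed[of \<tau> "map X (b # bs)" t] \<tau> ob that
    by (auto simp: map_lact[OF \<tau>, simplified] simp del: word_perm.simps)
  have "rep (Node (Leaf (X c)) (comb (map X (b # bs)))) (comb (map X (c # lact \<tau> (b # bs))))
    (ident E (X c) \<odot> perm_iso E X (b # bs) \<tau>)
    (\<lambda>t. ident E (X c) \<odot> word_perm (map X (b # bs)) \<tau> t)"
    unfolding eq
    by (rule rep_cong, rule r[unfolded tobj.simps])
      (use ob set wp leaves_comb[OF ne] in \<open>auto simp: comb_Cons simp del: word_perm.simps\<close>)
  from rep_comp[OF this rep_insert_iso[of X c "lact \<tau> (b # bs)" "\<sigma> 0"]] ob set
  have "rep (comb (map X (c # b # bs))) (comb (map X (lact \<sigma> (c # b # bs)))) (perm_iso E X (c # b # bs) \<sigma>)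
    (\<lambda>t. word_insert (X c) (\<sigma> 0) (map X (lact \<tau> (b # bs))) t \<cdot>
      (ident E (X c) \<odot> word_perm (map X (b # bs)) \<tau> t))"
    using lact_Cons[OF \<sigma>, of c] by (simp add: \<tau>_def)
  then show ?case by (rule rep_cong) (simp add: \<tau>_def[symmetric] map_lact[OF \<tau>, simplified])
qed simp

lemma perm_iso_typed:
  assumes "c \<noteq> []" "\<sigma> permutes {..<length c}" "X ` set c \<subseteq> Obj E"
  shows perm_iso_Arr: "perm_iso E X c \<sigma> \<in> Arr E"
    and Dom_perm_iso: "Dom E (perm_iso E X c \<sigma>) = tens_obj E X c"
    and Cod_perm_iso: "Cod E (perm_iso E X c \<sigma>) = tens_obj E X (lact \<sigma> c)"
  using rep_typed[OF rep_perm_iso[OF assms]] by (auto simp: tobj_comb)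

text \<open>Read on words this is \<open>word_perm_comp\<close>. It is the source of the symmetric
  group actions on endomorphism PROPs.\<close>

lemma perm_iso_comp:
  assumes "c \<noteq> []" "\<sigma> permutes {..<length c}" "\<sigma>' permutes {..<length c}" "X ` set c \<subseteq> Obj E"
  shows "perm_iso E X (lact \<sigma> c) \<sigma>' \<cdot> perm_iso E X c \<sigma> = perm_iso E X c (\<sigma>' \<circ> \<sigma>)"
proof (rule rep_unique)
  have s: "X ` set (lact \<sigma> c) \<subseteq> Obj E" using assms by simp
  show "rep (comb (map X c)) (comb (map X (lact \<sigma>' (lact \<sigma> c))))
    (perm_iso E X (lact \<sigma> c) \<sigma>' \<cdot> perm_iso E X c \<sigma>)
    (\<lambda>t. word_perm (map X (lact \<sigma> c)) \<sigma>' t \<cdot> word_perm (map X c) \<sigma> t)"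
    using assms s by (intro rep_comp[OF rep_perm_iso rep_perm_iso]) auto
  show "rep (comb (map X c)) (comb (map X (lact \<sigma>' (lact \<sigma> c)))) (perm_iso E X c (\<sigma>' \<circ> \<sigma>))
    (word_perm (map X c) (\<sigma>' \<circ> \<sigma>))"
    unfolding lact_lact[OF assms(2,3)] using assms by (intro rep_perm_iso permutes_compose)
  show "word_perm (map X (lact \<sigma> c)) \<sigma>' (tunit E) \<cdot> word_perm (map X c) \<sigma> (tunit E) =
      word_perm (map X c) (\<sigma>' \<circ> \<sigma>) (tunit E)"
    unfolding map_lact[OF assms(2)] using assms by (intro word_perm_comp) auto
qed

lemma perm_iso_id:
  assumes "c \<noteq> []" "X ` set c \<subseteq> Obj E"
  shows "perm_iso E X c id = ident E (tens_obj E X c)"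
proof (rule rep_unique)
  show "rep (comb (map X c)) (comb (map X c)) (perm_iso E X c id) (word_perm (map X c) id)"
    using rep_perm_iso[OF assms(1) permutes_id assms(2)] by simp
  show "rep (comb (map X c)) (comb (map X c)) (ident E (tens_obj E X c))
     (\<lambda>t. ident E (wobj (leaves (comb (map X c))) t))"
    using rep_ident[of "comb (map X c)"] assms by (simp add: tobj_comb)
  show "word_perm (map X c) id (tunit E) = ident E (wobj (leaves (comb (map X c))) (tunit E))"
    using assms by simp
qed

lemma join_typed:
  assumes "c \<noteq> []" "d \<noteq> []" "X ` set c \<subseteq> Obj E" "X ` set d \<subseteq> Obj E"
  shows join_Arr: "join E X c d \<in> Arr E"
    and Dom_join: "Dom E (join E X c d) = tens_obj E X c \<otimes> tens_obj E X d"
    and Cod_join: "Cod E (join E X c d) = tens_obj E X (c @ d)"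
  using rep_typed[OF rep_join[OF assms]] by (auto simp: tobj_comb simp flip: map_append)

lemma join_iso:
  assumes "c \<noteq> []" "d \<noteq> []" "X ` set c \<subseteq> Obj E" "X ` set d \<subseteq> Obj E"
  shows "iso E (join E X c d)"
  using assms
proof (induction c rule: induct_list012)
  case (3 c b bs)
  then have "join E X (b # bs) d \<in> Arr E" "Dom E (join E X (b # bs) d) = tens_obj E X (b # bs) \<otimes> tens_obj E X d"
    by (auto simp: join_typed)
  moreover have "tens_obj E X (b # bs) \<in> Obj E" using 3 by auto
  ultimately show ?case using 3 by auto
qed auto

text \<open>Both sides represent the identity on words.\<close>

lemma join_assoc:
  assumes "b \<noteq> []" "c \<noteq> []" "d \<noteq> []" "X ` set b \<subseteq> Obj E" "X ` set c \<subseteq> Obj E" "X ` set d \<subseteq> Obj E"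
  shows "join E X (b @ c) d \<cdot> (join E X b c \<odot> ident E (tens_obj E X d)) =
    join E X b (c @ d) \<cdot> (ident E (tens_obj E X b) \<odot> join E X c d) \<cdot>
      assoc E (tens_obj E X b) (tens_obj E X c) (tens_obj E X d)"
proof (rule rep_unique)
  let ?b = "comb (map X b)" and ?c = "comb (map X c)" and ?d = "comb (map X d)"
  let ?r = "comb (map X (b @ c @ d))"
  have ty: "wf ?b" "wf ?c" "wf ?d" using assms by auto
  have ob: "tens_obj E X b \<in> Obj E" "tens_obj E X c \<in> Obj E" "tens_obj E X d \<in> Obj E" using assms by auto
  show "rep (Node (Node ?b ?c) ?d) ?r (join E X (b @ c) d \<cdot> (join E X b c \<odot> ident E (tens_obj E X d)))
     (\<lambda>t. ident E (wobj (map X (b @ c @ d)) t))"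
    by (rule rep_cong, rule rep_comp[OF rep_tensor[OF rep_join rep_ident[of ?d, unfolded tobj_comb]]
          rep_join[of "b @ c" d, simplified append_assoc]])
      (use assms in \<open>auto simp: image_Un\<close>)
  show "rep (Node (Node ?b ?c) ?d) ?r (join E X b (c @ d) \<cdot> (ident E (tens_obj E X b) \<odot> join E X c d) \<cdot>
      assoc E (tens_obj E X b) (tens_obj E X c) (tens_obj E X d))
     (\<lambda>t. ident E (wobj (map X (b @ c @ d)) t))"
    by (rule rep_cong, rule rep_comp[OF rep_comp[OF rep_assoc[of ?b ?c ?d, unfolded tobj_comb]
          rep_tensor[OF rep_ident[of ?b, unfolded tobj_comb] rep_join]] rep_join[of b "c @ d"]])
      (use assms in \<open>auto simp: image_Un\<close>)
qed (use assms in auto)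

text \<open>On words the joins vanish, and \<open>word_perm_append\<close> remains.\<close>

lemma join_perm_iso:
  assumes "c \<noteq> []" "d \<noteq> []" "X ` set c \<subseteq> Obj E" "X ` set d \<subseteq> Obj E"
    "\<sigma> permutes {..<length c}" "\<tau> permutes {..<length d}"
  shows "join E X (lact \<sigma> c) (lact \<tau> d) \<cdot> (perm_iso E X c \<sigma> \<odot> perm_iso E X d \<tau>) =
    perm_iso E X (c @ d) (block_perm (length c) \<sigma> \<tau>) \<cdot> join E X c d"
proof (rule rep_unique)
  let ?p = "block_perm (length c) \<sigma> \<tau>"
  have p: "?p permutes {..<length (c @ d)}" using block_perm_permutes[OF assms(5,6)] by simp
  have l: "lact ?p (c @ d) = lact \<sigma> c @ lact \<tau> d" using assms(5,6) by (rule lact_append)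
  have s: "X ` set (lact \<sigma> c) \<subseteq> Obj E" "X ` set (lact \<tau> d) \<subseteq> Obj E" using assms by auto
  have c: "\<sigma> permutes {..<length (map X c)}" "\<tau> permutes {..<length (map X d)}" using assms by auto
  have l': "lact \<sigma> (map X c) = map X (lact \<sigma> c)" "lact \<tau> (map X d) = map X (lact \<tau> d)"
    using assms by (auto simp: map_lact)
  show "rep (Node (comb (map X c)) (comb (map X d))) (comb (map X (lact \<sigma> c @ lact \<tau> d)))
    (join E X (lact \<sigma> c) (lact \<tau> d) \<cdot> (perm_iso E X c \<sigma> \<odot> perm_iso E X d \<tau>))
    (\<lambda>t. word_perm (map X c) \<sigma> (wobj (lact \<tau> (map X d)) t) \<cdot> warr (map X c) (word_perm (map X d) \<tau> t))"
    by (rule rep_cong, rule rep_comp[OF rep_tensor[OF rep_perm_iso rep_perm_iso] rep_join])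
      (use assms s c in \<open>auto simp: word_perm_typed l'\<close>)
  show "rep (Node (comb (map X c)) (comb (map X d))) (comb (map X (lact \<sigma> c @ lact \<tau> d)))
    (perm_iso E X (c @ d) ?p \<cdot> join E X c d) (word_perm (map X (c @ d)) ?p)"
    by (rule rep_cong, rule rep_comp[OF rep_join rep_perm_iso[of "c @ d" ?p X, unfolded l]])
      (use assms p word_perm_typed[of ?p "map X (c @ d)"] in \<open>auto simp: image_Un\<close>)
  show "word_perm (map X c) \<sigma> (wobj (lact \<tau> (map X d)) (tunit E)) \<cdot>
      warr (map X c) (word_perm (map X d) \<tau> (tunit E)) = word_perm (map X (c @ d)) ?p (tunit E)"
    using word_perm_append[OF c] assms by simp
qed

lemma insert_iso_typed:
  assumes "X ` set (c # e) \<subseteq> Obj E"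
  shows "insert_iso E X c j e \<in> Arr E" "Dom E (insert_iso E X c j e) = tens_obj E X (c # e)"
    "Cod E (insert_iso E X c j e) = tens_obj E X (insert_at j c e)"
  using rep_typed(3-5)[OF rep_insert_iso[of X c e j]] assms by (auto simp: tobj_comb simp del: list.map)

end

section \<open>Naturality of the structural isomorphisms in a family of maps\<close>

locale tensor_family = closed_symmetric_monoidal_category E
  for E :: "('o, 'a) smc" (structure) +
  fixes CC :: "'c set" and X Y :: "'c \<Rightarrow> 'o" and f :: "'c \<Rightarrow> 'a"
  assumes f_hom: "c \<in> CC \<Longrightarrow> f c \<in> hom E (X c) (Y c)"
begin

lemma f_typed:
  assumes "c \<in> CC"
  shows "f c \<in> Arr E" "Dom E (f c) = X c" "Cod E (f c) = Y c"
  using f_hom[OF assms] by (auto simp: hom_iff)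

lemma XY_Obj:
  assumes "c \<in> CC"
  shows "X c \<in> Obj E" "Y c \<in> Obj E"
  using f_typed[OF assms] Dom_Obj[of "f c"] Cod_Obj[of "f c"] by auto

lemma XY_image: "set c \<subseteq> CC \<Longrightarrow> X ` set c \<subseteq> Obj E" "set c \<subseteq> CC \<Longrightarrow> Y ` set c \<subseteq> Obj E"
  using XY_Obj by auto

lemma tens_arr_typed:
  assumes "set c \<subseteq> CC"
  shows tens_arr_Arr: "tens_arr E f c \<in> Arr E" and Dom_tens_arr: "Dom E (tens_arr E f c) = tens_obj E X c"
    and Cod_tens_arr: "Cod E (tens_arr E f c) = tens_obj E Y c"
proof -
  have "tens_arr E f c \<in> Arr E \<and> Dom E (tens_arr E f c) = tens_obj E X c \<and>
    Cod E (tens_arr E f c) = tens_obj E Y c"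
    using assms by (induction c rule: induct_list012) (auto simp: f_typed)
  then show "tens_arr E f c \<in> Arr E" "Dom E (tens_arr E f c) = tens_obj E X c"
    "Cod E (tens_arr E f c) = tens_obj E Y c" by auto
qed

lemma tens_arr_Cons: "d \<noteq> [] \<Longrightarrow> tens_arr E f (c # d) = f c \<odot> tens_arr E f d"
  by (cases d) auto

text \<open>The calculus on words deals with structural maps over one family of objects. Naturality
  in \<open>f\<close> is proved instead along the recursion defining the isomorphism, here and in
  the next two lemmas.\<close>

lemma join_natural:
  assumes "c \<noteq> []" "d \<noteq> []" "set c \<subseteq> CC" "set d \<subseteq> CC"
  shows "join E Y c d \<cdot> (tens_arr E f c \<odot> tens_arr E f d) = tens_arr E f (c @ d) \<cdot> join E X c d"
  using assms
proof (induction c rule: induct_list012)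
  case (2 c)
  then show ?case using XY_image[of d] by (simp add: f_typed XY_Obj tens_arr_typed tens_arr_Cons)
next
  case (3 c b bs)
  let ?b = "b # bs"
  have IH: "join E Y ?b d \<cdot> (tens_arr E f ?b \<odot> tens_arr E f d) = tens_arr E f (?b @ d) \<cdot> join E X ?b d"
    using 3 by auto
  have s: "set ?b \<subseteq> CC" "set (?b @ d) \<subseteq> CC" "c \<in> CC" using 3 by auto
  note ty = join_typed[of ?b d X] join_typed[of ?b d Y] tens_arr_typed[OF s(1)] tens_arr_typed[OF s(2)]
    tens_arr_typed[OF \<open>set d \<subseteq> CC\<close>] f_typed[OF s(3)] XY_Obj[OF s(3)] XY_image[OF s(1)] XY_image[OF \<open>set d \<subseteq> CC\<close>]
  note ob = tens_obj_Obj[OF XY_image(1)[OF s(1)]] tens_obj_Obj[OF XY_image(2)[OF s(1)]]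
    tens_obj_Obj[OF XY_image(1)[OF \<open>set d \<subseteq> CC\<close>]] tens_obj_Obj[OF XY_image(2)[OF \<open>set d \<subseteq> CC\<close>]]
  have "join E Y (c # ?b) d \<cdot> (tens_arr E f (c # ?b) \<odot> tens_arr E f d) =
    (f c \<odot> (join E Y ?b d \<cdot> (tens_arr E f ?b \<odot> tens_arr E f d))) \<cdot>
      assoc E (X c) (tens_obj E X ?b) (tens_obj E X d)"
    using 3(4) ty ob by (simp add: fuse assoc_nat del: tens_obj.simps(3) tens_arr.simps(3)) (simp add: fuse assoc_nat)
  also have "\<dots> = tens_arr E f ((c # ?b) @ d) \<cdot> join E X (c # ?b) d"
    unfolding IH using 3(4) ty ob by (simp add: fuse)
  finally show ?case .
qed simp

lemma insert_iso_natural: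
  assumes "c \<in> CC" "set e \<subseteq> CC"
  shows "insert_iso E Y c j e \<cdot> tens_arr E f (c # e) = tens_arr E f (insert_at j c e) \<cdot> insert_iso E X c j e"
  using assms(2)
proof (induction j arbitrary: e)
  case 0
  then have "set (c # e) \<subseteq> CC" using assms by simp
  from tens_arr_typed[OF this] XY_image[OF this] show ?case by simp
next
  case (Suc j)
  consider "e = []" | a where "e = [a]" | a b bs where "e = a # b # bs" by (metis neq_Nil_conv)
  then show ?case
  proof cases
    case 1
    then show ?thesis using assms by (simp add: f_typed XY_Obj)
  next
    case 2
    then show ?thesis using assms Suc.prems by (cases j) (auto simp: symm_nat f_typed)
  next
    case 3
    let ?b = "b # bs" and ?F = "tens_arr E f (b # bs)" and ?i = "insert_at j c (b # bs)"
    have b: "set ?b \<subseteq> CC" "set ?i \<subseteq> CC" "set (c # ?b) \<subseteq> CC" and a: "a \<in> CC"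
      using Suc.prems 3 assms by auto
    have IH: "insert_iso E Y c j ?b \<cdot> (f c \<odot> ?F) = tens_arr E f ?i \<cdot> insert_iso E X c j ?b"
      using Suc.IH[OF b(1)] by simp
    \<comment> \<open>The associators and the symmetry of the recursive clause combine to one
      \<open>swap\<close>, whose naturality is already available.\<close>
    have i: "insert_iso E Z c (Suc j) e =
        (ident E (Z a) \<odot> insert_iso E Z c j ?b) \<cdot> swap (Z c) (Z a) (tens_obj E Z ?b)" for Z
      by (simp add: 3 swap_def)
    note ty = tens_arr_typed[OF b(1)] tens_arr_typed[OF b(2)] f_typed[OF a] f_typed[OF assms(1)]
      XY_Obj[OF a] XY_Obj[OF assms(1)]
      insert_iso_typed[OF XY_image(1)[OF b(3)]] insert_iso_typed[OF XY_image(2)[OF b(3)]]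
      tens_obj_Obj[OF XY_image(1)[OF b(1)]] tens_obj_Obj[OF XY_image(2)[OF b(1)]]
    have "insert_iso E Y c (Suc j) e \<cdot> tens_arr E f (c # e) =
      (ident E (Y a) \<odot> insert_iso E Y c j ?b) \<cdot>
        (swap (Y c) (Y a) (tens_obj E Y ?b) \<cdot> (f c \<odot> (f a \<odot> ?F)))"
      unfolding i using ty by (simp add: 3 assoc_comp)
    also have "swap (Y c) (Y a) (tens_obj E Y ?b) \<cdot> (f c \<odot> (f a \<odot> ?F)) =
      (f a \<odot> (f c \<odot> ?F)) \<cdot> swap (X c) (X a) (tens_obj E X ?b)"
      using ty by (subst swap_natural) auto
    also have "(ident E (Y a) \<odot> insert_iso E Y c j ?b) \<cdot> \<dots> =
      (f a \<odot> (insert_iso E Y c j ?b \<cdot> (f c \<odot> ?F))) \<cdot> swap (X c) (X a) (tens_obj E X ?b)"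
      using ty by (simp add: fuse)
    also have "\<dots> = tens_arr E f (insert_at (Suc j) c e) \<cdot> insert_iso E X c (Suc j) e"
      unfolding IH i using ty by (simp add: 3 tens_arr_Cons insert_at_def fuse)
    finally show ?thesis .
  qed
qed

lemma perm_iso_natural:
  assumes "c \<noteq> []" "set c \<subseteq> CC" "\<sigma> permutes {..<length c}"
  shows "perm_iso E Y c \<sigma> \<cdot> tens_arr E f c = tens_arr E f (lact \<sigma> c) \<cdot> perm_iso E X c \<sigma>"
  using assms
proof (induction c arbitrary: \<sigma> rule: induct_list012)
  case (2 c)
  then have "lact \<sigma> [c] = [c]" using set_lact[of \<sigma> "[c]"] length_lact[of \<sigma> "[c]"]
    by (cases "lact \<sigma> [c]") auto
  with 2 show ?case by (simp add: f_typed)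
next
  case (3 c b bs)
  define \<tau> where "\<tau> = tail_perm \<sigma>"
  let ?b = "b # bs" and ?F = "tens_arr E f (b # bs)" and ?l = "lact \<tau> (b # bs)"
  have \<sigma>: "\<sigma> permutes {..<Suc (length ?b)}" using 3 by simp
  have \<tau>: "\<tau> permutes {..<length ?b}" unfolding \<tau>_def using \<sigma> by (rule tail_perm_permutes)
  have c: "c \<in> CC" and b: "set ?b \<subseteq> CC" using 3 by auto
  have l: "set ?l \<subseteq> CC" "set (c # ?l) \<subseteq> CC" using set_lact[OF \<tau>] b c by auto
  have ne: "?l \<noteq> []" by simp
  have L: "lact \<sigma> (c # ?b) = insert_at (\<sigma> 0) c ?l" unfolding \<tau>_def using \<sigma> by (rule lact_Cons)
  have IH: "perm_iso E Y ?b \<tau> \<cdot> ?F = tens_arr E f ?l \<cdot> perm_iso E X ?b \<tau>"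
    using 3(2)[of \<tau>] b \<tau> by simp
  have i: "set (insert_at (\<sigma> 0) c ?l) \<subseteq> CC" using l by auto
  note ty = tens_arr_typed[OF b] tens_arr_typed[OF l(1)] tens_arr_typed[OF i] f_typed[OF c] XY_Obj[OF c]
    insert_iso_typed[OF XY_image(1)[OF l(2)]] insert_iso_typed[OF XY_image(2)[OF l(2)]]
    perm_iso_typed[OF _ \<tau> XY_image(1)[OF b]] perm_iso_typed[OF _ \<tau> XY_image(2)[OF b]]
    tens_obj_Cons[OF ne] tens_arr_Cons[OF ne]
  have "perm_iso E Y (c # ?b) \<sigma> \<cdot> tens_arr E f (c # ?b) =
     insert_iso E Y c (\<sigma> 0) ?l \<cdot> (f c \<odot> (perm_iso E Y ?b \<tau> \<cdot> ?F))"
    using ty by (simp add: \<tau>_def[symmetric] fuse)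
  also have "\<dots> = (insert_iso E Y c (\<sigma> 0) ?l \<cdot> tens_arr E f (c # ?l)) \<cdot> (ident E (X c) \<odot> perm_iso E X ?b \<tau>)"
    unfolding IH using ty by (simp add: fuse)
  also have "insert_iso E Y c (\<sigma> 0) ?l \<cdot> tens_arr E f (c # ?l) =
      tens_arr E f (insert_at (\<sigma> 0) c ?l) \<cdot> insert_iso E X c (\<sigma> 0) ?l"
    using c l by (intro insert_iso_natural) auto
  also have "(tens_arr E f (insert_at (\<sigma> 0) c ?l) \<cdot> insert_iso E X c (\<sigma> 0) ?l) \<cdot>
      (ident E (X c) \<odot> perm_iso E X ?b \<tau>) = tens_arr E f (lact \<sigma> (c # ?b)) \<cdot> perm_iso E X (c # ?b) \<sigma>"
    unfolding L using ty by (simp add: \<tau>_def[symmetric] assoc_comp)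
  finally show ?case .
qed simp

end

section \<open>Endomorphism PROPs\<close>

context closed_symmetric_monoidal_category
begin

lemma assoc_nat_right:
  assumes "x \<in> Obj E" "y \<in> Obj E" "h \<in> Arr E" "Cod E h = z"
  shows "assoc E x y z \<cdot> (ident E (x \<otimes> y) \<odot> h) = (ident E x \<odot> (ident E y \<odot> h)) \<cdot> assoc E x y (Dom E h)"
  using assoc_nat[of "ident E x" "ident E y" h x y z] assms by simp

lemma middle_swap_nat:
  assumes "f \<in> Arr E" "g \<in> Arr E" "h \<in> Arr E" "k \<in> Arr E"
    "Cod E f = w" "Cod E g = x" "Cod E h = y" "Cod E k = z"
    "Dom E f = w'" "Dom E g = x'" "Dom E h = y'" "Dom E k = z'"
  shows "middle_swap E w x y z \<cdot> ((f \<odot> g) \<odot> (h \<odot> k)) = ((f \<odot> h) \<odot> (g \<odot> k)) \<cdot> middle_swap E w' x' y' z'"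
  using middle_swap_natural[OF assms(1-4)] assms(5-) by simp

lemma middle_swap_nat_right:
  assumes "w \<in> Obj E" "x \<in> Obj E" "h \<in> Arr E" "k \<in> Arr E" "Cod E h = y" "Cod E k = z"
  shows "middle_swap E w x y z \<cdot> (ident E (w \<otimes> x) \<odot> (h \<odot> k)) =
    ((ident E w \<odot> h) \<odot> (ident E x \<odot> k)) \<cdot> middle_swap E w x (Dom E h) (Dom E k)"
  using middle_swap_natural[of "ident E w" "ident E x" h k] assms by simp

text \<open>\<open>middle_swap_assoc\<close> with an arrow attached to each pair of factors. With
  evaluations as these arrows it is the core of the associativity of horizontal composition.\<close>

lemma pairing_assoc:
  assumes o: "h \<in> Obj E" "h' \<in> Obj E" "h'' \<in> Obj E" "a \<in> Obj E" "a' \<in> Obj E" "a'' \<in> Obj E"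
    and u: "u \<in> Arr E" "Dom E u = h \<otimes> a" "u' \<in> Arr E" "Dom E u' = h' \<otimes> a'" "u'' \<in> Arr E" "Dom E u'' = h'' \<otimes> a''"
  shows "assoc E (Cod E u) (Cod E u') (Cod E u'') \<cdot> (((u \<odot> u') \<cdot> middle_swap E h h' a a') \<odot> u'') \<cdot>
      middle_swap E (h \<otimes> h') h'' (a \<otimes> a') a'' =
    (u \<odot> ((u' \<odot> u'') \<cdot> middle_swap E h' h'' a' a'')) \<cdot> middle_swap E h (h' \<otimes> h'') a (a' \<otimes> a'') \<cdot>
      (assoc E h h' h'' \<odot> assoc E a a' a'')"
proof -
  have "assoc E (Cod E u) (Cod E u') (Cod E u'') \<cdot> (((u \<odot> u') \<cdot> middle_swap E h h' a a') \<odot> u'') \<cdot>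
      middle_swap E (h \<otimes> h') h'' (a \<otimes> a') a'' =
    (assoc E (Cod E u) (Cod E u') (Cod E u'') \<cdot> ((u \<odot> u') \<odot> u'')) \<cdot>
      (middle_swap E h h' a a' \<odot> ident E (h'' \<otimes> a'')) \<cdot> middle_swap E (h \<otimes> h') h'' (a \<otimes> a') a''"
    using o u by (simp add: fuse)
  also have "assoc E (Cod E u) (Cod E u') (Cod E u'') \<cdot> ((u \<odot> u') \<odot> u'') =
    (u \<odot> (u' \<odot> u'')) \<cdot> assoc E (h \<otimes> a) (h' \<otimes> a') (h'' \<otimes> a'')"
    using u by (subst assoc_nat) auto
  also have "((u \<odot> (u' \<odot> u'')) \<cdot> assoc E (h \<otimes> a) (h' \<otimes> a') (h'' \<otimes> a'')) \<cdot>
      (middle_swap E h h' a a' \<odot> ident E (h'' \<otimes> a'')) \<cdot> middle_swap E (h \<otimes> h') h'' (a \<otimes> a') a'' =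
    (u \<odot> (u' \<odot> u'')) \<cdot> (assoc E (h \<otimes> a) (h' \<otimes> a') (h'' \<otimes> a'') \<cdot>
      (middle_swap E h h' a a' \<odot> ident E (h'' \<otimes> a'')) \<cdot> middle_swap E (h \<otimes> h') h'' (a \<otimes> a') a'')"
    using o u by (simp add: assoc_comp)
  also have "\<dots> = (u \<odot> ((u' \<odot> u'') \<cdot> middle_swap E h' h'' a' a'')) \<cdot> middle_swap E h (h' \<otimes> h'') a (a' \<otimes> a'') \<cdot>
      (assoc E h h' h'' \<odot> assoc E a a' a'')"
    unfolding middle_swap_assoc[OF o] using o u by (simp add: fuse)
  finally show ?thesis .
qed

text \<open>The core of the interchange rule, with \<open>v1\<close>, \<open>v2\<close> as inner and
  \<open>u1\<close>, \<open>u2\<close> as outer evaluations. Naturality brings each inner arrow next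
  to its outer one; the structural maps left over are compared by
  \<open>middle_swap_middle_swap\<close>.\<close>

lemma pairing_interchange:
  assumes o: "h1 \<in> Obj E" "h2 \<in> Obj E" "h3 \<in> Obj E" "h4 \<in> Obj E" "a1 \<in> Obj E" "a2 \<in> Obj E"
    and v: "v1 \<in> Arr E" "Dom E v1 = h3 \<otimes> a1" "v2 \<in> Arr E" "Dom E v2 = h4 \<otimes> a2"
    and u: "u1 \<in> Arr E" "Dom E u1 = h1 \<otimes> Cod E v1" "u2 \<in> Arr E" "Dom E u2 = h2 \<otimes> Cod E v2"
  shows "(u1 \<odot> u2) \<cdot> middle_swap E h1 h2 (Cod E v1) (Cod E v2) \<cdot>
      (ident E (h1 \<otimes> h2) \<odot> ((v1 \<odot> v2) \<cdot> middle_swap E h3 h4 a1 a2)) \<cdot>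
      assoc E (h1 \<otimes> h2) (h3 \<otimes> h4) (a1 \<otimes> a2) =
    ((u1 \<cdot> (ident E h1 \<odot> v1) \<cdot> assoc E h1 h3 a1) \<odot> (u2 \<cdot> (ident E h2 \<odot> v2) \<cdot> assoc E h2 h4 a2)) \<cdot>
      middle_swap E (h1 \<otimes> h3) (h2 \<otimes> h4) a1 a2 \<cdot> (middle_swap E h1 h2 h3 h4 \<odot> ident E (a1 \<otimes> a2))"
proof -
  have "(u1 \<odot> u2) \<cdot> middle_swap E h1 h2 (Cod E v1) (Cod E v2) \<cdot>
      (ident E (h1 \<otimes> h2) \<odot> ((v1 \<odot> v2) \<cdot> middle_swap E h3 h4 a1 a2)) \<cdot>
      assoc E (h1 \<otimes> h2) (h3 \<otimes> h4) (a1 \<otimes> a2) =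
    (u1 \<odot> u2) \<cdot> (middle_swap E h1 h2 (Cod E v1) (Cod E v2) \<cdot> (ident E (h1 \<otimes> h2) \<odot> (v1 \<odot> v2))) \<cdot>
      (ident E (h1 \<otimes> h2) \<odot> middle_swap E h3 h4 a1 a2) \<cdot> assoc E (h1 \<otimes> h2) (h3 \<otimes> h4) (a1 \<otimes> a2)"
    using o u v by (simp add: fuse)
  also have "middle_swap E h1 h2 (Cod E v1) (Cod E v2) \<cdot> (ident E (h1 \<otimes> h2) \<odot> (v1 \<odot> v2)) =
      ((ident E h1 \<odot> v1) \<odot> (ident E h2 \<odot> v2)) \<cdot> middle_swap E h1 h2 (h3 \<otimes> a1) (h4 \<otimes> a2)"
    using o v by (subst middle_swap_nat_right) auto
  also have "(u1 \<odot> u2) \<cdot> (((ident E h1 \<odot> v1) \<odot> (ident E h2 \<odot> v2)) \<cdot> middle_swap E h1 h2 (h3 \<otimes> a1) (h4 \<otimes> a2)) \<cdot>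
      (ident E (h1 \<otimes> h2) \<odot> middle_swap E h3 h4 a1 a2) \<cdot> assoc E (h1 \<otimes> h2) (h3 \<otimes> h4) (a1 \<otimes> a2) =
     ((u1 \<cdot> (ident E h1 \<odot> v1)) \<odot> (u2 \<cdot> (ident E h2 \<odot> v2))) \<cdot> (middle_swap E h1 h2 (h3 \<otimes> a1) (h4 \<otimes> a2) \<cdot>
      (ident E (h1 \<otimes> h2) \<odot> middle_swap E h3 h4 a1 a2) \<cdot> assoc E (h1 \<otimes> h2) (h3 \<otimes> h4) (a1 \<otimes> a2))"
    using o u v by (simp add: fuse)
  also have "\<dots> = ((u1 \<cdot> (ident E h1 \<odot> v1) \<cdot> assoc E h1 h3 a1) \<odot> (u2 \<cdot> (ident E h2 \<odot> v2) \<cdot> assoc E h2 h4 a2)) \<cdot>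
      middle_swap E (h1 \<otimes> h3) (h2 \<otimes> h4) a1 a2 \<cdot> (middle_swap E h1 h2 h3 h4 \<odot> ident E (a1 \<otimes> a2))"
    unfolding middle_swap_middle_swap[OF o] using o u v by (simp add: fuse)
  finally show ?thesis .
qed

lemma curry_typed:
  assumes "w \<in> Obj E" "x \<in> Obj E" "y \<in> Obj E" "f \<in> Arr E" "Dom E f = w \<otimes> x" "Cod E f = y"
  shows curry_Arr: "curry_arr E w x y f \<in> Arr E" and Dom_curry: "Dom E (curry_arr E w x y f) = w"
    and Cod_curry: "Cod E (curry_arr E w x y f) = ihom E x y"
    and ev_curry: "ev E x y \<cdot> (curry_arr E w x y f \<odot> ident E x) = f"
proof -
  have "f \<in> hom E (w \<otimes> x) y" using assms by (simp add: hom_iff)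
  from theI'[OF ev_universal[OF assms(1-3) this], folded curry_arr_def]
  show "curry_arr E w x y f \<in> Arr E" "Dom E (curry_arr E w x y f) = w"
    "Cod E (curry_arr E w x y f) = ihom E x y" "ev E x y \<cdot> (curry_arr E w x y f \<odot> ident E x) = f"
    by (auto simp: hom_iff)
qed

lemma ev_cancel:
  assumes "ev E x y \<cdot> (g \<odot> ident E x) = ev E x y \<cdot> (h \<odot> ident E x)" "x \<in> Obj E" "y \<in> Obj E"
    "g \<in> Arr E" "h \<in> Arr E" "Cod E g = ihom E x y" "Cod E h = ihom E x y" "Dom E g = Dom E h"
  shows "g = h"
proof -
  have "ev E x y \<cdot> (h \<odot> ident E x) \<in> hom E (Dom E h \<otimes> x) y" using assms by (simp add: hom_iff)
  from ev_universal[OF _ assms(2,3) this] assms show ?thesis by (auto simp: hom_iff)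
qed

end

section \<open>Left and right actions on profiles\<close>

lemma profiles_append [simp]: "c \<in> profiles CC \<Longrightarrow> d \<in> profiles CC \<Longrightarrow> c @ d \<in> profiles CC"
  by (auto simp: profiles_def)

lemma lact_profiles [simp]:
  "c \<in> profiles CC \<Longrightarrow> \<sigma> permutes {..<length c} \<Longrightarrow> lact \<sigma> c \<in> profiles CC"
  using set_lact[of \<sigma> c] length_lact[of \<sigma> c] by (auto simp: profiles_def)

lemma ract_lact: "\<tau> permutes S \<Longrightarrow> ract c \<tau> = lact (inv \<tau>) c"
  by (simp add: ract_def lact_def permutes_inv_inv)

lemma length_ract [simp]: "length (ract c \<tau>) = length c"
  by (simp add: ract_def)

lemma ract_id [simp]: "ract c id = c"
  by (simp add: ract_def)

lemma ract_profiles [simp]: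
  "c \<in> profiles CC \<Longrightarrow> \<sigma> permutes {..<length c} \<Longrightarrow> ract c \<sigma> \<in> profiles CC"
  by (simp add: ract_lact permutes_inv)

lemma lact_ract [simp]: "\<tau> permutes {..<length c} \<Longrightarrow> lact \<tau> (ract c \<tau>) = c"
  by (simp add: ract_lact lact_lact permutes_inv permutes_inv_o)

lemma ract_lact_inv [simp]: "\<tau> permutes {..<length c} \<Longrightarrow> ract (lact \<tau> c) \<tau> = c"
  by (simp add: ract_lact lact_lact permutes_inv permutes_inv_o)

lemma ract_ract:
  assumes "\<tau> permutes {..<length c}" "\<tau>' permutes {..<length c}"
  shows "ract (ract c \<tau>) \<tau>' = ract c (\<tau> \<circ> \<tau>')"
  unfolding ract_def using assms by (simp add: permute_list_compose)

lemma ract_append: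
  assumes "\<sigma> permutes {..<length c}" "\<tau> permutes {..<length d}"
  shows "ract (c @ d) (block_perm (length c) \<sigma> \<tau>) = ract c \<sigma> @ ract d \<tau>"
proof -
  let ?p = "block_perm (length c) \<sigma> \<tau>"
  have p: "?p permutes {..<length (ract c \<sigma> @ ract d \<tau>)}" using block_perm_permutes[OF assms] by simp
  have "lact ?p (ract c \<sigma> @ ract d \<tau>) = c @ d"
    using lact_append[of \<sigma> "ract c \<sigma>" \<tau> "ract d \<tau>"] assms by simp
  then show ?thesis using ract_lact_inv[OF p] by simp
qed

section \<open>The laws of an endomorphism PROP\<close>

locale obj_family = closed_symmetric_monoidal_category E
  for E :: "('o, 'a) smc" (structure) +
  fixes CC :: "'c set" and X :: "'c \<Rightarrow> 'o"
  assumes X_Obj: "c \<in> CC \<Longrightarrow> X c \<in> Obj E"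
begin

abbreviation "T c \<equiv> tens_obj E X c"
abbreviation "H d c \<equiv> ihom E (T c) (T d)"
abbreviation "Q \<equiv> endo_PROP E X"

lemma profileD: "c \<in> profiles CC \<Longrightarrow> c \<noteq> []" "c \<in> profiles CC \<Longrightarrow> X ` set c \<subseteq> Obj E"
  using X_Obj by (auto simp: profiles_def)

lemma T_Obj [simp]: "c \<in> profiles CC \<Longrightarrow> T c \<in> Obj E"
  by (simp add: profileD)

lemma perm_T [simp]:
  assumes "c \<in> profiles CC" "\<sigma> permutes {..<length c}"
  shows "perm_iso E X c \<sigma> \<in> Arr E" "Dom E (perm_iso E X c \<sigma>) = T c" "Cod E (perm_iso E X c \<sigma>) = T (lact \<sigma> c)"
  using assms by (simp_all add: perm_iso_typed profileD)

lemma perm_ract_T [simp]: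
  assumes "c \<in> profiles CC" "\<sigma> permutes {..<length c}"
  shows "perm_iso E X (ract c \<sigma>) \<sigma> \<in> Arr E" "Dom E (perm_iso E X (ract c \<sigma>) \<sigma>) = T (ract c \<sigma>)"
    "Cod E (perm_iso E X (ract c \<sigma>) \<sigma>) = T c"
  using perm_T[of "ract c \<sigma>" \<sigma>] assms by simp_all

lemma perm_id_T [simp]: "c \<in> profiles CC \<Longrightarrow> perm_iso E X c id = ident E (T c)"
  by (simp add: perm_iso_id profileD)

lemma join_T [simp]:
  assumes "c \<in> profiles CC" "d \<in> profiles CC"
  shows "join E X c d \<in> Arr E" "Dom E (join E X c d) = T c \<otimes> T d" "Cod E (join E X c d) = T (c @ d)"
    "iso E (join E X c d)"
  using assms by (simp_all add: join_typed join_iso profileD)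

text \<open>Uncurrying, the inverse of \<open>curry_arr\<close>. The operations of
  \<open>endo_PROP\<close> are specified by their adjoints, so two composites of them are compared
  after \<open>unc\<close>, which is injective by the universal property of
  \<open>ev\<close>.\<close>

definition unc :: "'c list \<Rightarrow> 'c list \<Rightarrow> 'a \<Rightarrow> 'a" where
  "unc d c g = ev E (T c) (T d) \<cdot> (g \<odot> ident E (T c))"

lemma unc_typed [simp]:
  assumes "d \<in> profiles CC" "c \<in> profiles CC" "g \<in> Arr E" "Cod E g = H d c"
  shows "unc d c g \<in> Arr E" "Dom E (unc d c g) = Dom E g \<otimes> T c" "Cod E (unc d c g) = T d"
  using assms by (auto simp: unc_def)

lemma unc_cancel:
  assumes "d \<in> profiles CC" "c \<in> profiles CC" "g \<in> hom E w (H d c)" "h \<in> hom E w (H d c)"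
    "unc d c g = unc d c h"
  shows "g = h"
  by (rule ev_cancel[of "T c" "T d"]) (use assms in \<open>auto simp: unc_def hom_iff\<close>)

lemma unc_comp:
  assumes "d \<in> profiles CC" "c \<in> profiles CC" "g \<in> Arr E" "Cod E g = H d c" "k \<in> Arr E" "Cod E k = Dom E g"
  shows "unc d c (g \<cdot> k) = unc d c g \<cdot> (k \<odot> ident E (T c))"
  using assms by (auto simp: unc_def fuse)

lemma unc_ident: "d \<in> profiles CC \<Longrightarrow> c \<in> profiles CC \<Longrightarrow> unc d c (ident E (H d c)) = ev E (T c) (T d)"
  by (simp add: unc_def)

lemma entry_endo [simp]: "entry Q d c = H d c"
  by (simp add: endo_PROP_def Let_def)

lemma act_endo_typed:
  assumes "d \<in> profiles CC" "c \<in> profiles CC" "\<sigma> permutes {..<length d}" "\<tau> permutes {..<length c}"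
  shows act_endo_Arr [simp]: "act Q \<sigma> \<tau> d c \<in> Arr E"
    and Dom_act_endo [simp]: "Dom E (act Q \<sigma> \<tau> d c) = H d c"
    and Cod_act_endo [simp]: "Cod E (act Q \<sigma> \<tau> d c) = H (lact \<sigma> d) (ract c \<tau>)"
    and unc_act_endo: "unc (lact \<sigma> d) (ract c \<tau>) (act Q \<sigma> \<tau> d c) =
      perm_iso E X d \<sigma> \<cdot> ev E (T c) (T d) \<cdot> (ident E (H d c) \<odot> perm_iso E X (ract c \<tau>) \<tau>)"
  using assms curry_typed[of "H d c" "T (ract c \<tau>)" "T (lact \<sigma> d)"
    "perm_iso E X d \<sigma> \<cdot> ev E (T c) (T d) \<cdot> (ident E (H d c) \<odot> perm_iso E X (ract c \<tau>) \<tau>)"]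
  by (auto simp: endo_PROP_def Let_def unc_def)

lemma vcomp_endo_typed:
  assumes "d \<in> profiles CC" "b \<in> profiles CC" "c \<in> profiles CC"
  shows vcomp_endo_Arr [simp]: "vcomp Q d b c \<in> Arr E"
    and Dom_vcomp_endo [simp]: "Dom E (vcomp Q d b c) = H d b \<otimes> H b c"
    and Cod_vcomp_endo [simp]: "Cod E (vcomp Q d b c) = H d c"
    and unc_vcomp_endo: "unc d c (vcomp Q d b c) =
      ev E (T b) (T d) \<cdot> (ident E (H d b) \<odot> ev E (T c) (T b)) \<cdot> assoc E (H d b) (H b c) (T c)"
  using assms curry_typed[of "H d b \<otimes> H b c" "T c" "T d"
    "ev E (T b) (T d) \<cdot> (ident E (H d b) \<odot> ev E (T c) (T b)) \<cdot> assoc E (H d b) (H b c) (T c)"]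
  by (auto simp: endo_PROP_def Let_def unc_def)

lemma hcomp_endo_typed:
  assumes "d1 \<in> profiles CC" "c1 \<in> profiles CC" "d2 \<in> profiles CC" "c2 \<in> profiles CC"
  shows hcomp_endo_Arr [simp]: "hcomp Q d1 c1 d2 c2 \<in> Arr E"
    and Dom_hcomp_endo [simp]: "Dom E (hcomp Q d1 c1 d2 c2) = H d1 c1 \<otimes> H d2 c2"
    and Cod_hcomp_endo [simp]: "Cod E (hcomp Q d1 c1 d2 c2) = H (d1 @ d2) (c1 @ c2)"
    and unc_hcomp_endo: "unc (d1 @ d2) (c1 @ c2) (hcomp Q d1 c1 d2 c2) =
      join E X d1 d2 \<cdot> (ev E (T c1) (T d1) \<odot> ev E (T c2) (T d2)) \<cdot>
      middle_swap E (H d1 c1) (H d2 c2) (T c1) (T c2) \<cdot>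
      (ident E (H d1 c1 \<otimes> H d2 c2) \<odot> inv_arr E (join E X c1 c2))"
  using assms curry_typed[of "H d1 c1 \<otimes> H d2 c2" "T (c1 @ c2)" "T (d1 @ d2)"
      "join E X d1 d2 \<cdot> (ev E (T c1) (T d1) \<odot> ev E (T c2) (T d2)) \<cdot>
      middle_swap E (H d1 c1) (H d2 c2) (T c1) (T c2) \<cdot>
      (ident E (H d1 c1 \<otimes> H d2 c2) \<odot> inv_arr E (join E X c1 c2))"]
  by (auto simp: endo_PROP_def Let_def unc_def)

text \<open>Formulated for an arbitrary arrow \<open>g\<close> into the internal hom, as are the
  next two rules: they then apply to nested operations and also to the pairs of arrows from which
  \<open>E\<^sub>f\<close> is built.\<close>

lemma unc_act:
  assumes "d \<in> profiles CC" "c \<in> profiles CC" "\<sigma> permutes {..<length d}" "\<tau> permutes {..<length c}"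
    "g \<in> Arr E" "Cod E g = H d c"
  shows "unc (lact \<sigma> d) (ract c \<tau>) (act Q \<sigma> \<tau> d c \<cdot> g) =
      perm_iso E X d \<sigma> \<cdot> unc d c g \<cdot> (ident E (Dom E g) \<odot> perm_iso E X (ract c \<tau>) \<tau>)"
  using assms by (simp add: unc_comp unc_act_endo) (simp add: unc_def fuse)

lemma unc_vcomp:
  assumes "d \<in> profiles CC" "b \<in> profiles CC" "c \<in> profiles CC"
    "g \<in> Arr E" "Cod E g = H d b" "h \<in> Arr E" "Cod E h = H b c"
  shows "unc d c (vcomp Q d b c \<cdot> (g \<odot> h)) =
      unc d b g \<cdot> (ident E (Dom E g) \<odot> unc b c h) \<cdot> assoc E (Dom E g) (Dom E h) (T c)"
  using assms by (simp add: unc_comp unc_vcomp_endo assoc_comp assoc_nat) (simp add: unc_def fuse)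

lemma unc_hcomp:
  assumes "d1 \<in> profiles CC" "c1 \<in> profiles CC" "d2 \<in> profiles CC" "c2 \<in> profiles CC"
    "g \<in> Arr E" "Cod E g = H d1 c1" "h \<in> Arr E" "Cod E h = H d2 c2"
  shows "unc (d1 @ d2) (c1 @ c2) (hcomp Q d1 c1 d2 c2 \<cdot> (g \<odot> h)) =
      join E X d1 d2 \<cdot> (unc d1 c1 g \<odot> unc d2 c2 h) \<cdot>
      middle_swap E (Dom E g) (Dom E h) (T c1) (T c2) \<cdot>
      (ident E (Dom E g \<otimes> Dom E h) \<odot> inv_arr E (join E X c1 c2))"
proof -
  let ?m = "middle_swap E (H d1 c1) (H d2 c2) (T c1) (T c2)"
  let ?n = "middle_swap E (Dom E g) (Dom E h) (T c1) (T c2)"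
  let ?j = "inv_arr E (join E X c1 c2)" and ?i = "ident E (Dom E g \<otimes> Dom E h)"
  have "?m \<cdot> ((g \<odot> h) \<odot> (ident E (T c1) \<odot> ident E (T c2))) =
      ((g \<odot> ident E (T c1)) \<odot> (h \<odot> ident E (T c2))) \<cdot> ?n"
    using assms by (intro middle_swap_nat) auto
  then have m: "?m \<cdot> ((g \<odot> h) \<odot> ident E (T c1 \<otimes> T c2)) \<cdot> (?i \<odot> ?j) =
      ((g \<odot> ident E (T c1)) \<odot> (h \<odot> ident E (T c2))) \<cdot> ?n \<cdot> (?i \<odot> ?j)"
    using assms by (intro comp_eq_reassoc) auto
  have "unc (d1 @ d2) (c1 @ c2) (hcomp Q d1 c1 d2 c2 \<cdot> (g \<odot> h)) =
     join E X d1 d2 \<cdot> (ev E (T c1) (T d1) \<odot> ev E (T c2) (T d2)) \<cdot>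
       (?m \<cdot> ((g \<odot> h) \<odot> ident E (T c1 \<otimes> T c2)) \<cdot> (?i \<odot> ?j))"
    using assms by (simp add: unc_comp unc_hcomp_endo fuse)
  also have "\<dots> = join E X d1 d2 \<cdot> (unc d1 c1 g \<odot> unc d2 c2 h) \<cdot> ?n \<cdot> (?i \<odot> ?j)"
    unfolding m using assms by (simp add: fuse unc_def)
  finally show ?thesis .
qed

text \<open>Both sides evaluate three maps in succession. The two ways of bracketing are compared by
  the pentagon for the three internal homs and the input.\<close>

lemma endo_vcomp_assoc:
  assumes p: "d \<in> profiles CC" "a \<in> profiles CC" "b \<in> profiles CC" "c \<in> profiles CC"
  shows "vcomp Q d b c \<cdot> (vcomp Q d a b \<odot> ident E (H b c)) =
    vcomp Q d a c \<cdot> (ident E (H d a) \<odot> vcomp Q a b c) \<cdot> assoc E (H d a) (H a b) (H b c)"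
proof (rule unc_cancel)
  let ?A = "H d a" and ?B = "H a b" and ?C = "H b c" and ?t = "T c"
  let ?e1 = "ev E (T a) (T d)" and ?e2 = "ev E (T b) (T a)" and ?e3 = "ev E (T c) (T b)"
  have "unc d c (vcomp Q d b c \<cdot> (vcomp Q d a b \<odot> ident E ?C)) =
    ?e1 \<cdot> (ident E ?A \<odot> ?e2) \<cdot> (assoc E ?A ?B (T b) \<cdot> (ident E (?A \<otimes> ?B) \<odot> ?e3)) \<cdot> assoc E (?A \<otimes> ?B) ?C ?t"
    using p by (simp add: unc_vcomp unc_vcomp_endo unc_ident assoc_comp)
  also have "assoc E ?A ?B (T b) \<cdot> (ident E (?A \<otimes> ?B) \<odot> ?e3) =
      (ident E ?A \<odot> (ident E ?B \<odot> ?e3)) \<cdot> assoc E ?A ?B (?C \<otimes> ?t)"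
    using p by (subst assoc_nat_right) auto
  also have "?e1 \<cdot> (ident E ?A \<odot> ?e2) \<cdot> ((ident E ?A \<odot> (ident E ?B \<odot> ?e3)) \<cdot> assoc E ?A ?B (?C \<otimes> ?t)) \<cdot>
      assoc E (?A \<otimes> ?B) ?C ?t =
    ?e1 \<cdot> (ident E ?A \<odot> (?e2 \<cdot> (ident E ?B \<odot> ?e3))) \<cdot> (assoc E ?A ?B (?C \<otimes> ?t) \<cdot> assoc E (?A \<otimes> ?B) ?C ?t)"
    using p by (simp add: fuse)
  also have "assoc E ?A ?B (?C \<otimes> ?t) \<cdot> assoc E (?A \<otimes> ?B) ?C ?t =
    (ident E ?A \<odot> assoc E ?B ?C ?t) \<cdot> assoc E ?A (?B \<otimes> ?C) ?t \<cdot> (assoc E ?A ?B ?C \<odot> ident E ?t)"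
    using p by (intro pentagon[symmetric]) auto
  also have "?e1 \<cdot> (ident E ?A \<odot> (?e2 \<cdot> (ident E ?B \<odot> ?e3))) \<cdot>
      ((ident E ?A \<odot> assoc E ?B ?C ?t) \<cdot> assoc E ?A (?B \<otimes> ?C) ?t \<cdot> (assoc E ?A ?B ?C \<odot> ident E ?t)) =
    (?e1 \<cdot> (ident E ?A \<odot> (?e2 \<cdot> (ident E ?B \<odot> ?e3) \<cdot> assoc E ?B ?C ?t)) \<cdot> assoc E ?A (?B \<otimes> ?C) ?t) \<cdot>
      (assoc E ?A ?B ?C \<odot> ident E ?t)"
    using p by (simp add: fuse)
  also have "\<dots> = unc d c ((vcomp Q d a c \<cdot> (ident E ?A \<odot> vcomp Q a b c)) \<cdot> assoc E ?A ?B ?C)"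
    using p by (subst unc_comp) (auto simp: unc_vcomp unc_vcomp_endo unc_ident)
  finally show "unc d c (vcomp Q d b c \<cdot> (vcomp Q d a b \<odot> ident E ?C)) =
      unc d c (vcomp Q d a c \<cdot> (ident E ?A \<odot> vcomp Q a b c) \<cdot> assoc E ?A ?B ?C)"
    using p by (simp add: assoc_comp)
qed (use p in \<open>auto simp: hom_iff\<close>)

text \<open>On outputs and on inputs separately this is \<open>perm_iso_comp\<close>. Inputs are
  permuted before evaluation, from \<open>ract c \<tau>\<close> back to \<open>c\<close>, which
  reverses the order of \<open>\<tau>\<close> and \<open>\<tau>'\<close>.\<close>

lemma endo_act_comp:
  assumes p: "d \<in> profiles CC" "c \<in> profiles CC"
    and s: "\<sigma> permutes {..<length d}" "\<tau> permutes {..<length c}"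
      "\<sigma>' permutes {..<length d}" "\<tau>' permutes {..<length c}"
  shows "act Q \<sigma>' \<tau>' (lact \<sigma> d) (ract c \<tau>) \<cdot> act Q \<sigma> \<tau> d c = act Q (\<sigma>' \<circ> \<sigma>) (\<tau> \<circ> \<tau>') d c"
proof (rule unc_cancel)
  have c: "\<sigma>' \<circ> \<sigma> permutes {..<length d}" "\<tau> \<circ> \<tau>' permutes {..<length c}"
    using s by (auto intro: permutes_compose)
  have l: "lact \<sigma>' (lact \<sigma> d) = lact (\<sigma>' \<circ> \<sigma>) d" "ract (ract c \<tau>) \<tau>' = ract c (\<tau> \<circ> \<tau>')"
    using s by (auto simp: lact_lact ract_ract)
  let ?r = "ract c (\<tau> \<circ> \<tau>')"
  have r: "?r \<in> profiles CC" "lact \<tau>' ?r = ract c \<tau>"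
    using p s c by (auto simp flip: l(2))
  have q1: "perm_iso E X (lact \<sigma> d) \<sigma>' \<cdot> perm_iso E X d \<sigma> = perm_iso E X d (\<sigma>' \<circ> \<sigma>)"
    using p s by (intro perm_iso_comp) (auto simp: profileD)
  have q2: "perm_iso E X (ract c \<tau>) \<tau> \<cdot> perm_iso E X ?r \<tau>' = perm_iso E X ?r (\<tau> \<circ> \<tau>')"
    using perm_iso_comp[of ?r \<tau>' \<tau> X] r p s by (simp add: profileD)
  have [simp]: "perm_iso E X ?r \<tau>' \<in> Arr E" "Dom E (perm_iso E X ?r \<tau>') = T ?r"
    "Cod E (perm_iso E X ?r \<tau>') = T (ract c \<tau>)"
    using perm_T[OF r(1), of \<tau>'] s r by auto
  have [simp]: "perm_iso E X (lact \<sigma> d) \<sigma>' \<in> Arr E" "Dom E (perm_iso E X (lact \<sigma> d) \<sigma>') = T (lact \<sigma> d)"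
    "Cod E (perm_iso E X (lact \<sigma> d) \<sigma>') = T (lact \<sigma>' (lact \<sigma> d))"
    using p s perm_T[of "lact \<sigma> d" \<sigma>'] by auto
  have "unc (lact (\<sigma>' \<circ> \<sigma>) d) ?r (act Q \<sigma>' \<tau>' (lact \<sigma> d) (ract c \<tau>) \<cdot> act Q \<sigma> \<tau> d c) =
    (perm_iso E X (lact \<sigma> d) \<sigma>' \<cdot> perm_iso E X d \<sigma>) \<cdot> ev E (T c) (T d) \<cdot>
     (ident E (H d c) \<odot> (perm_iso E X (ract c \<tau>) \<tau> \<cdot> perm_iso E X ?r \<tau>'))"
    using p s r unc_act[of "lact \<sigma> d" "ract c \<tau>" \<sigma>' \<tau>' "act Q \<sigma> \<tau> d c"]
    by (simp add: unc_act_endo l fuse)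
  also have "\<dots> = unc (lact (\<sigma>' \<circ> \<sigma>) d) ?r (act Q (\<sigma>' \<circ> \<sigma>) (\<tau> \<circ> \<tau>') d c)"
    unfolding q1 q2 using p c by (simp add: unc_act_endo)
  finally show "unc (lact (\<sigma>' \<circ> \<sigma>) d) ?r (act Q \<sigma>' \<tau>' (lact \<sigma> d) (ract c \<tau>) \<cdot> act Q \<sigma> \<tau> d c) =
    unc (lact (\<sigma>' \<circ> \<sigma>) d) ?r (act Q (\<sigma>' \<circ> \<sigma>) (\<tau> \<circ> \<tau>') d c)" .
  show "act Q (\<sigma>' \<circ> \<sigma>) (\<tau> \<circ> \<tau>') d c \<in> hom E (H d c) (H (lact (\<sigma>' \<circ> \<sigma>) d) ?r)"
    "act Q \<sigma>' \<tau>' (lact \<sigma> d) (ract c \<tau>) \<cdot> act Q \<sigma> \<tau> d c \<in> hom E (H d c) (H (lact (\<sigma>' \<circ> \<sigma>) d) ?r)"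
    using p s c by (auto simp: hom_iff l)
  show "lact (\<sigma>' \<circ> \<sigma>) d \<in> profiles CC" "?r \<in> profiles CC" using p s c by auto
qed

lemma endo_act_id: 
  assumes p: "d \<in> profiles CC" "c \<in> profiles CC"
  shows "act Q id id d c = ident E (H d c)"
proof (rule unc_cancel)
  show "unc d c (act Q id id d c) = unc d c (ident E (H d c))"
    using unc_act_endo[OF p permutes_id permutes_id] p by (simp add: unc_ident)
  show "act Q id id d c \<in> hom E (H d c) (H d c)"
    using p act_endo_typed[OF p permutes_id permutes_id] by (simp add: hom_iff)
qed (use p in \<open>auto simp: hom_iff\<close>)

lemma endo_vcomp_outer:
  assumes p: "d \<in> profiles CC" "b \<in> profiles CC" "c \<in> profiles CC"
    and s: "\<sigma> permutes {..<length d}" "\<mu> permutes {..<length c}"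
  shows "vcomp Q (lact \<sigma> d) b (ract c \<mu>) \<cdot> (act Q \<sigma> id d b \<odot> act Q id \<mu> b c) =
    act Q \<sigma> \<mu> d c \<cdot> vcomp Q d b c"
proof (rule unc_cancel)
  note [simp] = act_endo_typed[OF p(1,2) s(1) permutes_id, simplified]
    act_endo_typed[OF p(2,3) permutes_id s(2), simplified]
  let ?\<mu> = "perm_iso E X (ract c \<mu>) \<mu>"
  have "unc (lact \<sigma> d) (ract c \<mu>) (vcomp Q (lact \<sigma> d) b (ract c \<mu>) \<cdot> (act Q \<sigma> id d b \<odot> act Q id \<mu> b c)) =
    perm_iso E X d \<sigma> \<cdot> ev E (T b) (T d) \<cdot> (ident E (H d b) \<odot> ev E (T c) (T b)) \<cdot>
     ((ident E (H d b) \<odot> (ident E (H b c) \<odot> ?\<mu>)) \<cdot> assoc E (H d b) (H b c) (T (ract c \<mu>)))"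
    using p s by (simp add: unc_vcomp fuse)
  also have "(ident E (H d b) \<odot> (ident E (H b c) \<odot> ?\<mu>)) \<cdot> assoc E (H d b) (H b c) (T (ract c \<mu>)) =
     assoc E (H d b) (H b c) (T c) \<cdot> (ident E (H d b \<otimes> H b c) \<odot> ?\<mu>)"
    using p s by (subst assoc_nat_right) auto
  also have "perm_iso E X d \<sigma> \<cdot> ev E (T b) (T d) \<cdot> (ident E (H d b) \<odot> ev E (T c) (T b)) \<cdot>
      (assoc E (H d b) (H b c) (T c) \<cdot> (ident E (H d b \<otimes> H b c) \<odot> ?\<mu>)) =
    unc (lact \<sigma> d) (ract c \<mu>) (act Q \<sigma> \<mu> d c \<cdot> vcomp Q d b c)"
    using p s by (simp add: unc_act unc_vcomp_endo assoc_comp)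
  finally show "unc (lact \<sigma> d) (ract c \<mu>) (vcomp Q (lact \<sigma> d) b (ract c \<mu>) \<cdot>
      (act Q \<sigma> id d b \<odot> act Q id \<mu> b c)) = unc (lact \<sigma> d) (ract c \<mu>) (act Q \<sigma> \<mu> d c \<cdot> vcomp Q d b c)" .
  show "vcomp Q (lact \<sigma> d) b (ract c \<mu>) \<cdot> (act Q \<sigma> id d b \<odot> act Q id \<mu> b c)
    \<in> hom E (H d b \<otimes> H b c) (H (lact \<sigma> d) (ract c \<mu>))"
    using p s by (simp add: hom_iff)
qed (use p s in \<open>auto simp: hom_iff\<close>)

text \<open>The inner map has its outputs permuted by \<open>\<tau>\<close>, and the outer map
  permutes its inputs by \<open>inv \<tau>\<close> before evaluation; the two isomorphisms meet
  between the evaluations and cancel.\<close>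

lemma endo_vcomp_inner:
  assumes p: "d \<in> profiles CC" "b \<in> profiles CC" "c \<in> profiles CC" and s: "\<tau> permutes {..<length b}"
  shows "vcomp Q d (lact \<tau> b) c \<cdot> (act Q id (inv \<tau>) d b \<odot> act Q \<tau> id b c) = vcomp Q d b c"
proof (rule unc_cancel)
  have s': "inv \<tau> permutes {..<length b}" using s by (rule permutes_inv)
  have r: "ract b (inv \<tau>) = lact \<tau> b" using ract_lact[OF s'] s by (simp add: permutes_inv_inv)
  have l: "lact (inv \<tau>) (lact \<tau> b) = b" using s s' by (simp add: lact_lact permutes_inv_o)
  note [simp] = act_endo_typed[OF p(1,2) permutes_id s', simplified, unfolded r]
    act_endo_typed[OF p(2,3) s permutes_id, simplified]
  have lb: "lact \<tau> b \<in> profiles CC" using p s by simp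
  note [simp] = perm_T[OF lb, of "inv \<tau>", simplified, OF s', unfolded l]
  have inv: "perm_iso E X (lact \<tau> b) (inv \<tau>) \<cdot> perm_iso E X b \<tau> = ident E (T b)"
    using perm_iso_comp[of b \<tau> "inv \<tau>" X] p s s' by (simp add: profileD permutes_inv_o)
  have "unc d c (vcomp Q d (lact \<tau> b) c \<cdot> (act Q id (inv \<tau>) d b \<odot> act Q \<tau> id b c)) =
    ev E (T b) (T d) \<cdot> (ident E (H d b) \<odot> ((perm_iso E X (lact \<tau> b) (inv \<tau>) \<cdot> perm_iso E X b \<tau>) \<cdot>
      ev E (T c) (T b))) \<cdot> assoc E (H d b) (H b c) (T c)"
    using p s by (simp add: unc_vcomp fuse)
  also have "\<dots> = unc d c (vcomp Q d b c)"
    unfolding inv using p by (simp add: unc_vcomp_endo)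
  finally show "unc d c (vcomp Q d (lact \<tau> b) c \<cdot> (act Q id (inv \<tau>) d b \<odot> act Q \<tau> id b c)) =
      unc d c (vcomp Q d b c)" .
  show "vcomp Q d (lact \<tau> b) c \<cdot> (act Q id (inv \<tau>) d b \<odot> act Q \<tau> id b c) \<in> hom E (H d b \<otimes> H b c) (H d c)"
    using p s lb by (simp add: hom_iff)
qed (use p in \<open>auto simp: hom_iff\<close>)

text \<open>Obtained from \<open>join_assoc\<close> by cancelling the invertible composite
  \<open>?J\<close>. This is the form needed for inputs, which a horizontal composite splits rather
  than joins.\<close>

lemma join_inv_assoc:
  assumes p: "b \<in> profiles CC" "c \<in> profiles CC" "d \<in> profiles CC"
  shows "assoc E (T b) (T c) (T d) \<cdot> (inv_arr E (join E X b c) \<odot> ident E (T d)) \<cdot> inv_arr E (join E X (b @ c) d) =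
    (ident E (T b) \<odot> inv_arr E (join E X c d)) \<cdot> inv_arr E (join E X b (c @ d))"
    (is "?l = ?r")
proof (rule iso_right_cancel)
  let ?J = "join E X (b @ c) d \<cdot> (join E X b c \<odot> ident E (T d))"
  have j: "?J = join E X b (c @ d) \<cdot> (ident E (T b) \<odot> join E X c d) \<cdot> assoc E (T b) (T c) (T d)"
    using p by (intro join_assoc) (auto simp: profileD)
  have "?l \<cdot> ?J = assoc E (T b) (T c) (T d)" using p by (simp add: fuse)
  moreover have "?r \<cdot> ?J = assoc E (T b) (T c) (T d)" unfolding j using p by (simp add: fuse)
  ultimately show "?l \<cdot> ?J = ?r \<cdot> ?J" by simp
qed (use p in auto)

text \<open>\<open>join_assoc\<close> deals with the outputs, \<open>join_inv_assoc\<close> with the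
  inputs and \<open>pairing_assoc\<close> with the evaluations. The facts \<open>mid\<close> and
  \<open>mid'\<close> move the splitting of inputs across the middle interchange, so that the three
  can be applied one at a time.\<close>

lemma endo_hcomp_assoc:
  assumes p: "d1 \<in> profiles CC" "c1 \<in> profiles CC" "d2 \<in> profiles CC" "c2 \<in> profiles CC"
      "d3 \<in> profiles CC" "c3 \<in> profiles CC"
  shows "hcomp Q (d1 @ d2) (c1 @ c2) d3 c3 \<cdot> (hcomp Q d1 c1 d2 c2 \<odot> ident E (H d3 c3)) =
      hcomp Q d1 c1 (d2 @ d3) (c2 @ c3) \<cdot> (ident E (H d1 c1) \<odot> hcomp Q d2 c2 d3 c3) \<cdot>
        assoc E (H d1 c1) (H d2 c2) (H d3 c3)"
proof (rule unc_cancel)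
  let ?H1 = "H d1 c1" and ?H2 = "H d2 c2" and ?H3 = "H d3 c3"
  let ?e1 = "ev E (T c1) (T d1)" and ?e2 = "ev E (T c2) (T d2)" and ?e3 = "ev E (T c3) (T d3)"
  let ?j = "inv_arr E (join E X c1 c2)" and ?j' = "inv_arr E (join E X (c1 @ c2) c3)"
  let ?k = "inv_arr E (join E X c2 c3)" and ?k' = "inv_arr E (join E X c1 (c2 @ c3))"
  let ?H12 = "?H1 \<otimes> ?H2" and ?H23 = "?H2 \<otimes> ?H3"
  let ?M = "middle_swap E ?H1 ?H2 (T c1) (T c2)" and ?N = "middle_swap E ?H2 ?H3 (T c2) (T c3)"
  let ?M' = "middle_swap E ?H12 ?H3 (T c1 \<otimes> T c2) (T c3)" and ?N' = "middle_swap E ?H1 ?H23 (T c1) (T c2 \<otimes> T c3)"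
  let ?I = "(?H1 \<otimes> ?H2) \<otimes> ?H3"
  let ?l = "unc ((d1 @ d2) @ d3) ((c1 @ c2) @ c3)
    (hcomp Q (d1 @ d2) (c1 @ c2) d3 c3 \<cdot> (hcomp Q d1 c1 d2 c2 \<odot> ident E ?H3))"
  let ?r = "unc (d1 @ d2 @ d3) (c1 @ c2 @ c3)
    ((hcomp Q d1 c1 (d2 @ d3) (c2 @ c3) \<cdot> (ident E ?H1 \<odot> hcomp Q d2 c2 d3 c3)) \<cdot> assoc E ?H1 ?H2 ?H3)"
  let ?J = "join E X (d1 @ d2) d3 \<cdot> (join E X d1 d2 \<odot> ident E (T d3))"
  let ?K = "join E X d1 (d2 @ d3) \<cdot> (ident E (T d1) \<odot> join E X d2 d3)"
  let ?P = "((?e1 \<odot> ?e2) \<cdot> ?M) \<odot> ?e3" and ?R = "?e1 \<odot> ((?e2 \<odot> ?e3) \<cdot> ?N)"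
  have mid: "((ident E ?H12 \<odot> ?j) \<odot> ident E (?H3 \<otimes> T c3)) \<cdot> middle_swap E ?H12 ?H3 (T (c1 @ c2)) (T c3) =
      ?M' \<cdot> (ident E ?I \<odot> (?j \<odot> ident E (T c3)))"
    using p middle_swap_nat_right[of ?H12 ?H3 ?j "ident E (T c3)" "T c1 \<otimes> T c2" "T c3"] by simp
  have mid': "(ident E (?H1 \<otimes> T c1) \<odot> (ident E ?H23 \<odot> ?k)) \<cdot> middle_swap E ?H1 ?H23 (T c1) (T (c2 @ c3)) =
      ?N' \<cdot> (ident E (?H1 \<otimes> ?H23) \<odot> (ident E (T c1) \<odot> ?k))"
    using p middle_swap_nat_right[of ?H1 ?H23 "ident E (T c1)" ?k "T c1" "T c2 \<otimes> T c3"] by simp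
  have J: "?J = ?K \<cdot> assoc E (T d1) (T d2) (T d3)"
    using p join_assoc[of d1 d2 d3 X] by (simp add: profileD assoc_comp)
  have "?l = join E X (d1 @ d2) d3 \<cdot> ((join E X d1 d2 \<cdot> (?e1 \<odot> ?e2) \<cdot> ?M \<cdot> (ident E ?H12 \<odot> ?j)) \<odot> ?e3) \<cdot>
      middle_swap E ?H12 ?H3 (T (c1 @ c2)) (T c3) \<cdot> (ident E ?I \<odot> ?j')"
    using p unc_hcomp[of "d1 @ d2" "c1 @ c2" d3 c3 "hcomp Q d1 c1 d2 c2" "ident E ?H3"]
    by (simp add: unc_hcomp_endo unc_ident)
  also have "\<dots> = ?J \<cdot> ?P \<cdot> (((ident E ?H12 \<odot> ?j) \<odot> ident E (?H3 \<otimes> T c3)) \<cdot>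
      middle_swap E ?H12 ?H3 (T (c1 @ c2)) (T c3)) \<cdot> (ident E ?I \<odot> ?j')"
    using p by (simp add: fuse)
  also have "\<dots> = ?K \<cdot> (assoc E (T d1) (T d2) (T d3) \<cdot> ?P \<cdot> ?M') \<cdot>
      (ident E ?I \<odot> ((?j \<odot> ident E (T c3)) \<cdot> ?j'))"
    unfolding mid J using p by (simp add: fuse)
  also have "assoc E (T d1) (T d2) (T d3) \<cdot> ?P \<cdot> ?M' =
      ?R \<cdot> ?N' \<cdot> (assoc E ?H1 ?H2 ?H3 \<odot> assoc E (T c1) (T c2) (T c3))"
    using pairing_assoc[of ?H1 ?H2 ?H3 "T c1" "T c2" "T c3" ?e1 ?e2 ?e3] p by simp
  also have "?K \<cdot> (?R \<cdot> ?N' \<cdot> (assoc E ?H1 ?H2 ?H3 \<odot> assoc E (T c1) (T c2) (T c3))) \<cdot>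
      (ident E ?I \<odot> ((?j \<odot> ident E (T c3)) \<cdot> ?j')) =
    ?K \<cdot> ?R \<cdot> ?N' \<cdot> (assoc E ?H1 ?H2 ?H3 \<odot>
      (assoc E (T c1) (T c2) (T c3) \<cdot> (?j \<odot> ident E (T c3)) \<cdot> ?j'))"
    using p by (simp add: fuse)
  also have "\<dots> = ?K \<cdot> ?R \<cdot> (?N' \<cdot> (ident E (?H1 \<otimes> ?H23) \<odot> (ident E (T c1) \<odot> ?k))) \<cdot>
      (assoc E ?H1 ?H2 ?H3 \<odot> ?k')"
    unfolding join_inv_assoc[OF p(2,4,6)] using p by (simp add: fuse)
  also have "\<dots> = (join E X d1 (d2 @ d3) \<cdot>
      (?e1 \<odot> (join E X d2 d3 \<cdot> (?e2 \<odot> ?e3) \<cdot> ?N \<cdot> (ident E ?H23 \<odot> ?k))) \<cdot>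
      middle_swap E ?H1 ?H23 (T c1) (T (c2 @ c3)) \<cdot> (ident E (?H1 \<otimes> ?H23) \<odot> ?k')) \<cdot>
      (assoc E ?H1 ?H2 ?H3 \<odot> ident E (T (c1 @ c2 @ c3)))"
    unfolding mid'[symmetric] using p by (simp add: fuse)
  also have "\<dots> = ?r"
    using p unc_hcomp[of d1 c1 "d2 @ d3" "c2 @ c3" "ident E ?H1" "hcomp Q d2 c2 d3 c3"]
    by (subst unc_comp) (auto simp: unc_hcomp_endo unc_ident)
  finally show "unc (d1 @ d2 @ d3) (c1 @ c2 @ c3)
      (hcomp Q (d1 @ d2) (c1 @ c2) d3 c3 \<cdot> (hcomp Q d1 c1 d2 c2 \<odot> ident E ?H3)) =
    unc (d1 @ d2 @ d3) (c1 @ c2 @ c3)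
      (hcomp Q d1 c1 (d2 @ d3) (c2 @ c3) \<cdot> (ident E ?H1 \<odot> hcomp Q d2 c2 d3 c3) \<cdot> assoc E ?H1 ?H2 ?H3)"
    using p by (simp add: assoc_comp)
  show "hcomp Q (d1 @ d2) (c1 @ c2) d3 c3 \<cdot> (hcomp Q d1 c1 d2 c2 \<odot> ident E ?H3)
      \<in> hom E ?I (H (d1 @ d2 @ d3) (c1 @ c2 @ c3))"
    using p hcomp_endo_typed[of "d1 @ d2" "c1 @ c2" d3 c3] by (simp add: hom_iff)
qed (use p in \<open>auto simp: hom_iff\<close>)

text \<open>On outputs this is \<open>join_perm_iso\<close>. On inputs the same lemma has to be
  conjugated by inverse joins, which gives \<open>jp\<close>, since there the product is
  split.\<close>

lemma endo_hcomp_equivariant: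
  assumes p: "d1 \<in> profiles CC" "c1 \<in> profiles CC" "d2 \<in> profiles CC" "c2 \<in> profiles CC"
    and s: "\<sigma>1 permutes {..<length d1}" "\<tau>1 permutes {..<length c1}"
      "\<sigma>2 permutes {..<length d2}" "\<tau>2 permutes {..<length c2}"
  shows "hcomp Q (lact \<sigma>1 d1) (ract c1 \<tau>1) (lact \<sigma>2 d2) (ract c2 \<tau>2) \<cdot>
        (act Q \<sigma>1 \<tau>1 d1 c1 \<odot> act Q \<sigma>2 \<tau>2 d2 c2) =
      act Q (block_perm (length d1) \<sigma>1 \<sigma>2) (block_perm (length c1) \<tau>1 \<tau>2) (d1 @ d2) (c1 @ c2) \<cdot>
        hcomp Q d1 c1 d2 c2"
proof (rule unc_cancel)
  let ?B = "block_perm (length d1) \<sigma>1 \<sigma>2" and ?C = "block_perm (length c1) \<tau>1 \<tau>2"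
  have B: "?B permutes {..<length (d1 @ d2)}" "?C permutes {..<length (c1 @ c2)}"
    using block_perm_permutes s by auto
  have l: "lact ?B (d1 @ d2) = lact \<sigma>1 d1 @ lact \<sigma>2 d2" "ract (c1 @ c2) ?C = ract c1 \<tau>1 @ ract c2 \<tau>2"
    using s by (simp_all add: lact_append ract_append)
  let ?r1 = "ract c1 \<tau>1" and ?r2 = "ract c2 \<tau>2" and ?l1 = "lact \<sigma>1 d1" and ?l2 = "lact \<sigma>2 d2"
  let ?p1 = "perm_iso E X ?r1 \<tau>1" and ?p2 = "perm_iso E X ?r2 \<tau>2"
  let ?s1 = "perm_iso E X d1 \<sigma>1" and ?s2 = "perm_iso E X d2 \<sigma>2"
  let ?S = "perm_iso E X (d1 @ d2) ?B" and ?P = "perm_iso E X (?r1 @ ?r2) ?C"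
  let ?H1 = "H d1 c1" and ?H2 = "H d2 c2"
  let ?e1 = "ev E (T c1) (T d1)" and ?e2 = "ev E (T c2) (T d2)"
  let ?M = "middle_swap E ?H1 ?H2 (T c1) (T c2)" and ?i = "ident E (?H1 \<otimes> ?H2)"
  let ?j = "inv_arr E (join E X c1 c2)" and ?j' = "inv_arr E (join E X ?r1 ?r2)"
  have pr: "?r1 \<in> profiles CC" "?r2 \<in> profiles CC" "?l1 \<in> profiles CC" "?l2 \<in> profiles CC" using p s by auto
  have P: "?P \<in> Arr E" "Dom E ?P = T (?r1 @ ?r2)" "Cod E ?P = T (c1 @ c2)"
    using perm_ract_T[of "c1 @ c2" ?C] p B l by auto
  have S: "?S \<in> Arr E" "Dom E ?S = T (d1 @ d2)" "Cod E ?S = T (?l1 @ ?l2)"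
    using perm_T[of "d1 @ d2" ?B] p B l by auto
  have js: "join E X ?l1 ?l2 \<cdot> (?s1 \<odot> ?s2) = ?S \<cdot> join E X d1 d2"
    using p s by (intro join_perm_iso) (auto simp: profileD)
  have "join E X c1 c2 \<cdot> (?p1 \<odot> ?p2) = ?P \<cdot> join E X ?r1 ?r2"
    using join_perm_iso[of ?r1 ?r2 X \<tau>1 \<tau>2] pr s by (simp add: profileD)
  then have "?j \<cdot> (join E X c1 c2 \<cdot> (?p1 \<odot> ?p2)) \<cdot> ?j' = ?j \<cdot> (?P \<cdot> join E X ?r1 ?r2) \<cdot> ?j'" by simp
  then have jp: "(?p1 \<odot> ?p2) \<cdot> ?j' = ?j \<cdot> ?P"
    using p s pr P by (simp add: assoc_comp)
  have ms: "((ident E ?H1 \<odot> ?p1) \<odot> (ident E ?H2 \<odot> ?p2)) \<cdot> middle_swap E ?H1 ?H2 (T ?r1) (T ?r2) =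
     ?M \<cdot> (?i \<odot> (?p1 \<odot> ?p2))"
    using p s by (subst middle_swap_nat_right) auto
  have "unc (?l1 @ ?l2) (?r1 @ ?r2) (hcomp Q ?l1 ?r1 ?l2 ?r2 \<cdot> (act Q \<sigma>1 \<tau>1 d1 c1 \<odot> act Q \<sigma>2 \<tau>2 d2 c2)) =
     (join E X ?l1 ?l2 \<cdot> (?s1 \<odot> ?s2)) \<cdot> (?e1 \<odot> ?e2) \<cdot>
     (((ident E ?H1 \<odot> ?p1) \<odot> (ident E ?H2 \<odot> ?p2)) \<cdot> middle_swap E ?H1 ?H2 (T ?r1) (T ?r2)) \<cdot> (?i \<odot> ?j')"
    using p s pr by (simp add: unc_hcomp unc_act_endo fuse)
  also have "\<dots> = ?S \<cdot> join E X d1 d2 \<cdot> (?e1 \<odot> ?e2) \<cdot> ?M \<cdot> (?i \<odot> ((?p1 \<odot> ?p2) \<cdot> ?j'))"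
    unfolding js ms using p s pr S by (simp add: fuse)
  also have "\<dots> = unc (?l1 @ ?l2) (?r1 @ ?r2) (act Q ?B ?C (d1 @ d2) (c1 @ c2) \<cdot> hcomp Q d1 c1 d2 c2)"
    unfolding jp using p P S B unc_act[of "d1 @ d2" "c1 @ c2" ?B ?C "hcomp Q d1 c1 d2 c2"]
    by (simp add: l unc_hcomp_endo fuse)
  finally show "unc (?l1 @ ?l2) (?r1 @ ?r2)
      (hcomp Q ?l1 ?r1 ?l2 ?r2 \<cdot> (act Q \<sigma>1 \<tau>1 d1 c1 \<odot> act Q \<sigma>2 \<tau>2 d2 c2)) =
    unc (?l1 @ ?l2) (?r1 @ ?r2) (act Q ?B ?C (d1 @ d2) (c1 @ c2) \<cdot> hcomp Q d1 c1 d2 c2)" .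
  show "hcomp Q ?l1 ?r1 ?l2 ?r2 \<cdot> (act Q \<sigma>1 \<tau>1 d1 c1 \<odot> act Q \<sigma>2 \<tau>2 d2 c2)
      \<in> hom E (?H1 \<otimes> ?H2) (H (?l1 @ ?l2) (?r1 @ ?r2))"
    using p s by (simp add: hom_iff)
  show "act Q ?B ?C (d1 @ d2) (c1 @ c2) \<cdot> hcomp Q d1 c1 d2 c2 \<in> hom E (?H1 \<otimes> ?H2) (H (?l1 @ ?l2) (?r1 @ ?r2))"
    using p s act_endo_typed[of "d1 @ d2" "c1 @ c2" ?B ?C] B by (simp add: hom_iff l)
qed (use p s in auto)

text \<open>The outer horizontal composite splits its inputs over \<open>b1\<close> and
  \<open>b2\<close> exactly where the inner one has joined its outputs, so this join cancels.
  \<open>pairing_interchange\<close> settles what is left.\<close>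

lemma endo_interchange:
  assumes p: "d1 \<in> profiles CC" "b1 \<in> profiles CC" "c1 \<in> profiles CC"
      "d2 \<in> profiles CC" "b2 \<in> profiles CC" "c2 \<in> profiles CC"
  shows "vcomp Q (d1 @ d2) (b1 @ b2) (c1 @ c2) \<cdot> (hcomp Q d1 b1 d2 b2 \<odot> hcomp Q b1 c1 b2 c2) =
      hcomp Q d1 c1 d2 c2 \<cdot> (vcomp Q d1 b1 c1 \<odot> vcomp Q d2 b2 c2) \<cdot>
        middle_swap E (H d1 b1) (H d2 b2) (H b1 c1) (H b2 c2)"
proof (rule unc_cancel)
  let ?H1 = "H d1 b1" and ?H2 = "H d2 b2" and ?H3 = "H b1 c1" and ?H4 = "H b2 c2"
  let ?e1 = "ev E (T b1) (T d1)" and ?e2 = "ev E (T b2) (T d2)"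
  let ?e3 = "ev E (T c1) (T b1)" and ?e4 = "ev E (T c2) (T b2)"
  let ?jb = "join E X b1 b2" and ?jd = "join E X d1 d2" and ?jc = "inv_arr E (join E X c1 c2)"
  let ?M = "middle_swap E ?H1 ?H2 (T b1) (T b2)" and ?M' = "middle_swap E ?H3 ?H4 (T c1) (T c2)"
  let ?H12 = "?H1 \<otimes> ?H2" and ?H34 = "?H3 \<otimes> ?H4"
  let ?v1 = "?e1 \<cdot> (ident E ?H1 \<odot> ?e3) \<cdot> assoc E ?H1 ?H3 (T c1)"
  let ?v2 = "?e2 \<cdot> (ident E ?H2 \<odot> ?e4) \<cdot> assoc E ?H2 ?H4 (T c2)"
  let ?d = "d1 @ d2" and ?c = "c1 @ c2"
  let ?W = "middle_swap E ?H1 ?H2 ?H3 ?H4"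
  let ?N = "middle_swap E (?H1 \<otimes> ?H3) (?H2 \<otimes> ?H4) (T c1) (T c2)"
  have as: "assoc E ?H12 ?H34 (T c1 \<otimes> T c2) \<cdot> (ident E (?H12 \<otimes> ?H34) \<odot> ?jc) =
      (ident E ?H12 \<odot> (ident E ?H34 \<odot> ?jc)) \<cdot> assoc E ?H12 ?H34 (T ?c)"
    using p by (subst assoc_nat_right) auto
  have "unc ?d ?c (vcomp Q ?d (b1 @ b2) ?c \<cdot> (hcomp Q d1 b1 d2 b2 \<odot> hcomp Q b1 c1 b2 c2)) =
     (?jd \<cdot> (?e1 \<odot> ?e2) \<cdot> ?M \<cdot> (ident E ?H12 \<odot> inv_arr E ?jb)) \<cdot>
     (ident E ?H12 \<odot> (?jb \<cdot> (?e3 \<odot> ?e4) \<cdot> ?M' \<cdot> (ident E ?H34 \<odot> ?jc))) \<cdot> assoc E ?H12 ?H34 (T ?c)"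
    using p unc_vcomp[of ?d "b1 @ b2" ?c "hcomp Q d1 b1 d2 b2" "hcomp Q b1 c1 b2 c2"]
    by (simp add: unc_hcomp_endo)
  also have "\<dots> = ?jd \<cdot> (?e1 \<odot> ?e2) \<cdot> ?M \<cdot> (ident E ?H12 \<odot> ((?e3 \<odot> ?e4) \<cdot> ?M')) \<cdot>
     ((ident E ?H12 \<odot> (ident E ?H34 \<odot> ?jc)) \<cdot> assoc E ?H12 ?H34 (T ?c))"
    using p by (simp add: fuse)
  also have "\<dots> = ?jd \<cdot> ((?e1 \<odot> ?e2) \<cdot> ?M \<cdot> (ident E ?H12 \<odot> ((?e3 \<odot> ?e4) \<cdot> ?M')) \<cdot>
     assoc E ?H12 ?H34 (T c1 \<otimes> T c2)) \<cdot> (ident E (?H12 \<otimes> ?H34) \<odot> ?jc)"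
    unfolding as[symmetric] using p by (simp add: assoc_comp)
  also have "(?e1 \<odot> ?e2) \<cdot> ?M \<cdot> (ident E ?H12 \<odot> ((?e3 \<odot> ?e4) \<cdot> ?M')) \<cdot> assoc E ?H12 ?H34 (T c1 \<otimes> T c2) =
     (?v1 \<odot> ?v2) \<cdot> ?N \<cdot> (?W \<odot> ident E (T c1 \<otimes> T c2))"
    using pairing_interchange[of ?H1 ?H2 ?H3 ?H4 "T c1" "T c2" ?e3 ?e4 ?e1 ?e2] p by simp
  also have "?jd \<cdot> ((?v1 \<odot> ?v2) \<cdot> ?N \<cdot> (?W \<odot> ident E (T c1 \<otimes> T c2))) \<cdot> (ident E (?H12 \<otimes> ?H34) \<odot> ?jc) =
     (?jd \<cdot> (?v1 \<odot> ?v2) \<cdot> ?N \<cdot> (ident E ((?H1 \<otimes> ?H3) \<otimes> (?H2 \<otimes> ?H4)) \<odot> ?jc)) \<cdot> (?W \<odot> ident E (T ?c))"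
    using p by (simp add: fuse)
  also have "\<dots> = unc ?d ?c ((hcomp Q d1 c1 d2 c2 \<cdot> (vcomp Q d1 b1 c1 \<odot> vcomp Q d2 b2 c2)) \<cdot> ?W)"
    using p by (subst unc_comp) (auto simp: unc_hcomp unc_vcomp_endo)
  finally show "unc ?d ?c (vcomp Q ?d (b1 @ b2) ?c \<cdot> (hcomp Q d1 b1 d2 b2 \<odot> hcomp Q b1 c1 b2 c2)) =
     unc ?d ?c (hcomp Q d1 c1 d2 c2 \<cdot> (vcomp Q d1 b1 c1 \<odot> vcomp Q d2 b2 c2) \<cdot> ?W)"
    using p by (simp add: assoc_comp)
qed (use p in \<open>auto simp: hom_iff\<close>)

theorem colored_PROP_endo: "colored_PROP E CC Q"
proof
qed (auto simp: hom_iff endo_act_id endo_act_comp endo_vcomp_assoc endo_vcomp_outer endo_vcomp_inner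
    endo_hcomp_assoc endo_hcomp_equivariant endo_interchange)

end

section \<open>Maps of PROPs\<close>

text \<open>Typed operations without the laws of a PROP. This makes it possible to speak of maps out
  of \<open>E\<^sub>f\<close> before its laws are established.\<close>

locale PROP_data = closed_symmetric_monoidal_category E
  for E :: "('o, 'a) smc" (structure) +
  fixes CC :: "'c set" and P :: "('c, 'o, 'a) colored_prop"
  assumes entry_Obj: "d \<in> profiles CC \<Longrightarrow> c \<in> profiles CC \<Longrightarrow> entry P d c \<in> Obj E"
    and act_hom: "d \<in> profiles CC \<Longrightarrow> c \<in> profiles CC \<Longrightarrow>
      \<sigma> permutes {..<length d} \<Longrightarrow> \<tau> permutes {..<length c} \<Longrightarrow>
      act P \<sigma> \<tau> d c \<in> hom E (entry P d c) (entry P (lact \<sigma> d) (ract c \<tau>))"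
    and vcomp_hom: "d \<in> profiles CC \<Longrightarrow> b \<in> profiles CC \<Longrightarrow> c \<in> profiles CC \<Longrightarrow>
      vcomp P d b c \<in> hom E (entry P d b \<otimes> entry P b c) (entry P d c)"
    and hcomp_hom: "d1 \<in> profiles CC \<Longrightarrow> c1 \<in> profiles CC \<Longrightarrow> d2 \<in> profiles CC \<Longrightarrow> c2 \<in> profiles CC \<Longrightarrow>
      hcomp P d1 c1 d2 c2 \<in> hom E (entry P d1 c1 \<otimes> entry P d2 c2) (entry P (d1 @ d2) (c1 @ c2))"
begin

lemma typed [simp]:
  shows "d \<in> profiles CC \<Longrightarrow> c \<in> profiles CC \<Longrightarrow> entry P d c \<in> Obj E"
    and "d \<in> profiles CC \<Longrightarrow> c \<in> profiles CC \<Longrightarrow> \<sigma> permutes {..<length d} \<Longrightarrow> \<tau> permutes {..<length c} \<Longrightarrow>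
      act P \<sigma> \<tau> d c \<in> Arr E"
    and "d \<in> profiles CC \<Longrightarrow> c \<in> profiles CC \<Longrightarrow> \<sigma> permutes {..<length d} \<Longrightarrow> \<tau> permutes {..<length c} \<Longrightarrow>
      Dom E (act P \<sigma> \<tau> d c) = entry P d c"
    and "d \<in> profiles CC \<Longrightarrow> c \<in> profiles CC \<Longrightarrow> \<sigma> permutes {..<length d} \<Longrightarrow> \<tau> permutes {..<length c} \<Longrightarrow>
      Cod E (act P \<sigma> \<tau> d c) = entry P (lact \<sigma> d) (ract c \<tau>)"
    and "d \<in> profiles CC \<Longrightarrow> b \<in> profiles CC \<Longrightarrow> c \<in> profiles CC \<Longrightarrow> vcomp P d b c \<in> Arr E"
    and "d \<in> profiles CC \<Longrightarrow> b \<in> profiles CC \<Longrightarrow> c \<in> profiles CC \<Longrightarrow>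
      Dom E (vcomp P d b c) = entry P d b \<otimes> entry P b c"
    and "d \<in> profiles CC \<Longrightarrow> b \<in> profiles CC \<Longrightarrow> c \<in> profiles CC \<Longrightarrow> Cod E (vcomp P d b c) = entry P d c"
    and "d1 \<in> profiles CC \<Longrightarrow> c1 \<in> profiles CC \<Longrightarrow> d2 \<in> profiles CC \<Longrightarrow> c2 \<in> profiles CC \<Longrightarrow>
      hcomp P d1 c1 d2 c2 \<in> Arr E"
    and "d1 \<in> profiles CC \<Longrightarrow> c1 \<in> profiles CC \<Longrightarrow> d2 \<in> profiles CC \<Longrightarrow> c2 \<in> profiles CC \<Longrightarrow>
      Dom E (hcomp P d1 c1 d2 c2) = entry P d1 c1 \<otimes> entry P d2 c2"
    and "d1 \<in> profiles CC \<Longrightarrow> c1 \<in> profiles CC \<Longrightarrow> d2 \<in> profiles CC \<Longrightarrow> c2 \<in> profiles CC \<Longrightarrow>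
      Cod E (hcomp P d1 c1 d2 c2) = entry P (d1 @ d2) (c1 @ c2)"
  using entry_Obj[of d c] act_hom[of d c \<sigma> \<tau>] vcomp_hom[of d b c] hcomp_hom[of d1 c1 d2 c2]
  by (auto simp: hom_iff)

end

lemma (in closed_symmetric_monoidal_category) PROP_data_if_colored_PROP:
  assumes "colored_PROP E CC P"
  shows "PROP_data E CC P"
proof -
  interpret P: colored_PROP E CC P by (rule assms)
  show ?thesis
    by unfold_locales (fact P.entry_Obj P.act_hom P.vcomp_hom P.hcomp_hom)+
qed

locale PROP_map = closed_symmetric_monoidal_category E + F: PROP_data E CC F + Z: PROP_data E CC Z
  for E :: "('o, 'a) smc" (structure) and CC :: "'c set" and F Z :: "('c, 'o, 'a) colored_prop" +
  fixes \<phi> :: "'c list \<Rightarrow> 'c list \<Rightarrow> 'a"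
  assumes PROP_Z: "colored_PROP E CC Z" and map: "is_prop_map E CC F Z \<phi>"
begin

lemmas Z_bimodule = colored_PROP.axioms(1)[OF PROP_Z]

lemma \<phi>_typed [simp]:
  assumes "d \<in> profiles CC" "c \<in> profiles CC"
  shows "\<phi> d c \<in> Arr E" "Dom E (\<phi> d c) = entry F d c" "Cod E (\<phi> d c) = entry Z d c"
  using map assms by (auto simp: is_prop_map_def hom_iff)

lemma \<phi>_act:
  assumes "d \<in> profiles CC" "c \<in> profiles CC" "\<sigma> permutes {..<length d}" "\<tau> permutes {..<length c}"
  shows "\<phi> (lact \<sigma> d) (ract c \<tau>) \<cdot> act F \<sigma> \<tau> d c = act Z \<sigma> \<tau> d c \<cdot> \<phi> d c"
  using map assms by (auto simp: is_prop_map_def)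

lemma \<phi>_vcomp:
  assumes "d \<in> profiles CC" "b \<in> profiles CC" "c \<in> profiles CC"
  shows "\<phi> d c \<cdot> vcomp F d b c = vcomp Z d b c \<cdot> (\<phi> d b \<odot> \<phi> b c)"
  using map assms by (auto simp: is_prop_map_def)

lemma \<phi>_hcomp:
  assumes "d1 \<in> profiles CC" "c1 \<in> profiles CC" "d2 \<in> profiles CC" "c2 \<in> profiles CC"
  shows "\<phi> (d1 @ d2) (c1 @ c2) \<cdot> hcomp F d1 c1 d2 c2 = hcomp Z d1 c1 d2 c2 \<cdot> (\<phi> d1 c1 \<odot> \<phi> d2 c2)"
  using map assms by (auto simp: is_prop_map_def)

lemma \<phi>_vcomp2:
  assumes "d \<in> profiles CC" "b \<in> profiles CC" "c \<in> profiles CC" "k \<in> Arr E" "Cod E k = entry F d b \<otimes> entry F b c"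
  shows "\<phi> d c \<cdot> vcomp F d b c \<cdot> k = vcomp Z d b c \<cdot> (\<phi> d b \<odot> \<phi> b c) \<cdot> k"
  by (rule comp_eq_reassoc[OF \<phi>_vcomp]) (use assms in auto)

lemma \<phi>_hcomp2:
  assumes "d1 \<in> profiles CC" "c1 \<in> profiles CC" "d2 \<in> profiles CC" "c2 \<in> profiles CC"
    "k \<in> Arr E" "Cod E k = entry F d1 c1 \<otimes> entry F d2 c2"
  shows "\<phi> (d1 @ d2) (c1 @ c2) \<cdot> hcomp F d1 c1 d2 c2 \<cdot> k = hcomp Z d1 c1 d2 c2 \<cdot> (\<phi> d1 c1 \<odot> \<phi> d2 c2) \<cdot> k"
  by (rule comp_eq_reassoc[OF \<phi>_hcomp]) (use assms in auto)

text \<open>Here and in the following lemmas a law of \<open>Z\<close> is pulled back along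
  \<open>\<phi>\<close>: the two sides of the law for \<open>F\<close> agree after composition with
  \<open>\<phi>\<close>. No single \<open>\<phi>\<close> is assumed monic, so the composition stays
  in the statement.\<close>

lemma map_act_id:
  assumes p: "d \<in> profiles CC" "c \<in> profiles CC"
  shows "\<phi> d c \<cdot> act F id id d c = \<phi> d c \<cdot> ident E (entry F d c)"
  using p \<phi>_act[OF p permutes_id permutes_id] sigma_bimodule.act_id[OF Z_bimodule p] by simp

lemma map_act_comp:
  assumes p: "d \<in> profiles CC" "c \<in> profiles CC" and s: "\<sigma> permutes {..<length d}" "\<tau> permutes {..<length c}"
      "\<sigma>' permutes {..<length d}" "\<tau>' permutes {..<length c}"
  shows "\<phi> (lact (\<sigma>' \<circ> \<sigma>) d) (ract c (\<tau> \<circ> \<tau>')) \<cdot> act F \<sigma>' \<tau>' (lact \<sigma> d) (ract c \<tau>) \<cdot> act F \<sigma> \<tau> d c =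
    \<phi> (lact (\<sigma>' \<circ> \<sigma>) d) (ract c (\<tau> \<circ> \<tau>')) \<cdot> act F (\<sigma>' \<circ> \<sigma>) (\<tau> \<circ> \<tau>') d c"
proof -
  let ?d = "lact \<sigma> d" and ?c = "ract c \<tau>"
  have c: "\<sigma>' \<circ> \<sigma> permutes {..<length d}" "\<tau> \<circ> \<tau>' permutes {..<length c}"
    using s by (auto intro: permutes_compose)
  have l: "lact (\<sigma>' \<circ> \<sigma>) d = lact \<sigma>' ?d" "ract c (\<tau> \<circ> \<tau>') = ract ?c \<tau>'"
    using s by (auto simp: lact_lact ract_ract)
  have q: "?d \<in> profiles CC" "?c \<in> profiles CC" "\<sigma>' permutes {..<length ?d}" "\<tau>' permutes {..<length ?c}"
    using p s by auto
  have "\<phi> (lact \<sigma>' ?d) (ract ?c \<tau>') \<cdot> act F \<sigma>' \<tau>' ?d ?c \<cdot> act F \<sigma> \<tau> d c =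
      act Z \<sigma>' \<tau>' ?d ?c \<cdot> \<phi> ?d ?c \<cdot> act F \<sigma> \<tau> d c"
    by (rule comp_eq_reassoc[OF \<phi>_act]) (use p s q in auto)
  also have "\<phi> ?d ?c \<cdot> act F \<sigma> \<tau> d c = act Z \<sigma> \<tau> d c \<cdot> \<phi> d c" using p s by (intro \<phi>_act) auto
  also have "act Z \<sigma>' \<tau>' ?d ?c \<cdot> act Z \<sigma> \<tau> d c \<cdot> \<phi> d c = (act Z \<sigma>' \<tau>' ?d ?c \<cdot> act Z \<sigma> \<tau> d c) \<cdot> \<phi> d c"
    using p s q by (simp add: assoc_comp)
  also have "act Z \<sigma>' \<tau>' ?d ?c \<cdot> act Z \<sigma> \<tau> d c = act Z (\<sigma>' \<circ> \<sigma>) (\<tau> \<circ> \<tau>') d c"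
    using p s by (intro sigma_bimodule.act_comp[OF Z_bimodule]) auto
  also have "\<dots> \<cdot> \<phi> d c = \<phi> (lact (\<sigma>' \<circ> \<sigma>) d) (ract c (\<tau> \<circ> \<tau>')) \<cdot> act F (\<sigma>' \<circ> \<sigma>) (\<tau> \<circ> \<tau>') d c"
    using p c by (intro \<phi>_act[symmetric]) auto
  finally show ?thesis unfolding l .
qed

lemma map_vcomp_assoc:
  assumes p: "d \<in> profiles CC" "a \<in> profiles CC" "b \<in> profiles CC" "c \<in> profiles CC"
  shows "\<phi> d c \<cdot> vcomp F d b c \<cdot> (vcomp F d a b \<odot> ident E (entry F b c)) =
      \<phi> d c \<cdot> vcomp F d a c \<cdot> (ident E (entry F d a) \<odot> vcomp F a b c) \<cdot>
        assoc E (entry F d a) (entry F a b) (entry F b c)"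
proof -
  let ?A = "assoc E (entry Z d a) (entry Z a b) (entry Z b c)"
  let ?A' = "assoc E (entry F d a) (entry F a b) (entry F b c)"
  let ?f = "\<phi> d a" and ?g = "\<phi> a b" and ?h = "\<phi> b c"
  have "\<phi> d c \<cdot> vcomp F d b c \<cdot> (vcomp F d a b \<odot> ident E (entry F b c)) =
    (vcomp Z d b c \<cdot> (vcomp Z d a b \<odot> ident E (entry Z b c))) \<cdot> ((?f \<odot> ?g) \<odot> ?h)"
    using p by (simp add: \<phi>_vcomp2 \<phi>_vcomp fuse)
  also have "vcomp Z d b c \<cdot> (vcomp Z d a b \<odot> ident E (entry Z b c)) =
      vcomp Z d a c \<cdot> (ident E (entry Z d a) \<odot> vcomp Z a b c) \<cdot> ?A"
    using p by (intro colored_PROP.vcomp_assoc[OF PROP_Z])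
  also have "(vcomp Z d a c \<cdot> (ident E (entry Z d a) \<odot> vcomp Z a b c) \<cdot> ?A) \<cdot> ((?f \<odot> ?g) \<odot> ?h) =
      vcomp Z d a c \<cdot> (ident E (entry Z d a) \<odot> vcomp Z a b c) \<cdot> (?A \<cdot> ((?f \<odot> ?g) \<odot> ?h))"
    using p by (simp add: assoc_comp)
  also have "?A \<cdot> ((?f \<odot> ?g) \<odot> ?h) = (?f \<odot> (?g \<odot> ?h)) \<cdot> ?A'"
    using p by (subst assoc_nat) auto
  also have "vcomp Z d a c \<cdot> (ident E (entry Z d a) \<odot> vcomp Z a b c) \<cdot> ((?f \<odot> (?g \<odot> ?h)) \<cdot> ?A') =
     \<phi> d c \<cdot> vcomp F d a c \<cdot> (ident E (entry F d a) \<odot> vcomp F a b c) \<cdot> ?A'"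
    using p by (simp add: \<phi>_vcomp2 \<phi>_vcomp fuse)
  finally show ?thesis .
qed

lemma map_vcomp_outer:
  assumes p: "d \<in> profiles CC" "b \<in> profiles CC" "c \<in> profiles CC"
    and s: "\<sigma> permutes {..<length d}" "\<mu> permutes {..<length c}"
  shows "\<phi> (lact \<sigma> d) (ract c \<mu>) \<cdot> vcomp F (lact \<sigma> d) b (ract c \<mu>) \<cdot> (act F \<sigma> id d b \<odot> act F id \<mu> b c) =
    \<phi> (lact \<sigma> d) (ract c \<mu>) \<cdot> act F \<sigma> \<mu> d c \<cdot> vcomp F d b c"
proof -
  let ?d = "lact \<sigma> d" and ?c = "ract c \<mu>"
  note [simp] = Z.typed(2-4)[OF p(1,2) s(1) permutes_id, simplified] Z.typed(2-4)[OF p(2,3) permutes_id s(2), simplified]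
    F.typed(2-4)[OF p(1,2) s(1) permutes_id, simplified] F.typed(2-4)[OF p(2,3) permutes_id s(2), simplified]
  have a: "\<phi> ?d b \<cdot> act F \<sigma> id d b = act Z \<sigma> id d b \<cdot> \<phi> d b" "\<phi> b ?c \<cdot> act F id \<mu> b c = act Z id \<mu> b c \<cdot> \<phi> b c"
    using \<phi>_act[OF p(1,2) s(1) permutes_id] \<phi>_act[OF p(2,3) permutes_id s(2)] by simp_all
  have "\<phi> ?d ?c \<cdot> vcomp F ?d b ?c \<cdot> (act F \<sigma> id d b \<odot> act F id \<mu> b c) =
     (vcomp Z ?d b ?c \<cdot> (act Z \<sigma> id d b \<odot> act Z id \<mu> b c)) \<cdot> (\<phi> d b \<odot> \<phi> b c)"
    using p s by (simp add: \<phi>_vcomp2 a fuse)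
  also have "vcomp Z ?d b ?c \<cdot> (act Z \<sigma> id d b \<odot> act Z id \<mu> b c) = act Z \<sigma> \<mu> d c \<cdot> vcomp Z d b c"
    using p s by (intro colored_PROP.vcomp_equivariant_outer[OF PROP_Z])
  also have "(act Z \<sigma> \<mu> d c \<cdot> vcomp Z d b c) \<cdot> (\<phi> d b \<odot> \<phi> b c) = (act Z \<sigma> \<mu> d c \<cdot> \<phi> d c) \<cdot> vcomp F d b c"
    using p s by (simp add: \<phi>_vcomp assoc_comp)
  also have "act Z \<sigma> \<mu> d c \<cdot> \<phi> d c = \<phi> ?d ?c \<cdot> act F \<sigma> \<mu> d c"
    using p s by (intro \<phi>_act[symmetric])
  finally show ?thesis using p s by (simp add: assoc_comp id_def)
qed

lemma map_vcomp_inner: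
  assumes p: "d \<in> profiles CC" "b \<in> profiles CC" "c \<in> profiles CC" and s: "\<tau> permutes {..<length b}"
  shows "\<phi> d c \<cdot> vcomp F d (lact \<tau> b) c \<cdot> (act F id (inv \<tau>) d b \<odot> act F \<tau> id b c) = \<phi> d c \<cdot> vcomp F d b c"
proof -
  have s': "inv \<tau> permutes {..<length b}" using s by (rule permutes_inv)
  have r: "ract b (inv \<tau>) = lact \<tau> b" using ract_lact[OF s'] s by (simp add: permutes_inv_inv)
  note [simp] = Z.typed(2-4)[OF p(1,2) permutes_id s', simplified, unfolded r]
    Z.typed(2-4)[OF p(2,3) s permutes_id, simplified]
    F.typed(2-4)[OF p(1,2) permutes_id s', simplified, unfolded r] F.typed(2-4)[OF p(2,3) s permutes_id, simplified]
  have a: "\<phi> d (lact \<tau> b) \<cdot> act F id (inv \<tau>) d b = act Z id (inv \<tau>) d b \<cdot> \<phi> d b"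
    "\<phi> (lact \<tau> b) c \<cdot> act F \<tau> id b c = act Z \<tau> id b c \<cdot> \<phi> b c"
    using \<phi>_act[OF p(1,2) permutes_id s'] \<phi>_act[OF p(2,3) s permutes_id] by (simp_all add: r)
  have "\<phi> d c \<cdot> vcomp F d (lact \<tau> b) c \<cdot> (act F id (inv \<tau>) d b \<odot> act F \<tau> id b c) =
     (vcomp Z d (lact \<tau> b) c \<cdot> (act Z id (inv \<tau>) d b \<odot> act Z \<tau> id b c)) \<cdot> (\<phi> d b \<odot> \<phi> b c)"
    using p s by (simp add: \<phi>_vcomp2 a fuse)
  also have "vcomp Z d (lact \<tau> b) c \<cdot> (act Z id (inv \<tau>) d b \<odot> act Z \<tau> id b c) = vcomp Z d b c"
    using p s by (intro colored_PROP.vcomp_equivariant_inner[OF PROP_Z])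
  finally show ?thesis using p by (simp add: \<phi>_vcomp id_def)
qed

lemma map_hcomp_assoc:
  assumes p: "d1 \<in> profiles CC" "c1 \<in> profiles CC" "d2 \<in> profiles CC" "c2 \<in> profiles CC"
      "d3 \<in> profiles CC" "c3 \<in> profiles CC"
  shows "\<phi> (d1 @ d2 @ d3) (c1 @ c2 @ c3) \<cdot>
      hcomp F (d1 @ d2) (c1 @ c2) d3 c3 \<cdot> (hcomp F d1 c1 d2 c2 \<odot> ident E (entry F d3 c3)) =
    \<phi> (d1 @ d2 @ d3) (c1 @ c2 @ c3) \<cdot>
      hcomp F d1 c1 (d2 @ d3) (c2 @ c3) \<cdot> (ident E (entry F d1 c1) \<odot> hcomp F d2 c2 d3 c3) \<cdot>
        assoc E (entry F d1 c1) (entry F d2 c2) (entry F d3 c3)"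
proof -
  let ?A = "assoc E (entry Z d1 c1) (entry Z d2 c2) (entry Z d3 c3)"
  let ?A' = "assoc E (entry F d1 c1) (entry F d2 c2) (entry F d3 c3)"
  let ?f = "\<phi> d1 c1" and ?g = "\<phi> d2 c2" and ?h = "\<phi> d3 c3"
  have "\<phi> (d1 @ d2 @ d3) (c1 @ c2 @ c3) \<cdot>
      hcomp F (d1 @ d2) (c1 @ c2) d3 c3 \<cdot> (hcomp F d1 c1 d2 c2 \<odot> ident E (entry F d3 c3)) =
    (hcomp Z (d1 @ d2) (c1 @ c2) d3 c3 \<cdot> (hcomp Z d1 c1 d2 c2 \<odot> ident E (entry Z d3 c3))) \<cdot> ((?f \<odot> ?g) \<odot> ?h)"
    using p \<phi>_hcomp2[of "d1 @ d2" "c1 @ c2" d3 c3] Z.typed(8-10)[of "d1 @ d2" "c1 @ c2" d3 c3]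
    by (simp add: \<phi>_hcomp fuse)
  also have "hcomp Z (d1 @ d2) (c1 @ c2) d3 c3 \<cdot> (hcomp Z d1 c1 d2 c2 \<odot> ident E (entry Z d3 c3)) =
      hcomp Z d1 c1 (d2 @ d3) (c2 @ c3) \<cdot> (ident E (entry Z d1 c1) \<odot> hcomp Z d2 c2 d3 c3) \<cdot> ?A"
    using p by (intro colored_PROP.hcomp_assoc[OF PROP_Z])
  also have "(hcomp Z d1 c1 (d2 @ d3) (c2 @ c3) \<cdot> (ident E (entry Z d1 c1) \<odot> hcomp Z d2 c2 d3 c3) \<cdot> ?A) \<cdot>
       ((?f \<odot> ?g) \<odot> ?h) =
      hcomp Z d1 c1 (d2 @ d3) (c2 @ c3) \<cdot> (ident E (entry Z d1 c1) \<odot> hcomp Z d2 c2 d3 c3) \<cdot>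
       (?A \<cdot> ((?f \<odot> ?g) \<odot> ?h))"
    using p by (simp add: assoc_comp)
  also have "?A \<cdot> ((?f \<odot> ?g) \<odot> ?h) = (?f \<odot> (?g \<odot> ?h)) \<cdot> ?A'"
    using p by (subst assoc_nat) auto
  also have "hcomp Z d1 c1 (d2 @ d3) (c2 @ c3) \<cdot> (ident E (entry Z d1 c1) \<odot> hcomp Z d2 c2 d3 c3) \<cdot>
       ((?f \<odot> (?g \<odot> ?h)) \<cdot> ?A') =
     \<phi> (d1 @ d2 @ d3) (c1 @ c2 @ c3) \<cdot>
      hcomp F d1 c1 (d2 @ d3) (c2 @ c3) \<cdot> (ident E (entry F d1 c1) \<odot> hcomp F d2 c2 d3 c3) \<cdot> ?A'"
    using p by (simp add: \<phi>_hcomp2 \<phi>_hcomp fuse)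
  finally show ?thesis .
qed

lemma map_hcomp_equivariant:
  assumes p: "d1 \<in> profiles CC" "c1 \<in> profiles CC" "d2 \<in> profiles CC" "c2 \<in> profiles CC"
    and s: "\<sigma>1 permutes {..<length d1}" "\<tau>1 permutes {..<length c1}"
      "\<sigma>2 permutes {..<length d2}" "\<tau>2 permutes {..<length c2}"
  shows "\<phi> (lact \<sigma>1 d1 @ lact \<sigma>2 d2) (ract c1 \<tau>1 @ ract c2 \<tau>2) \<cdot>
      hcomp F (lact \<sigma>1 d1) (ract c1 \<tau>1) (lact \<sigma>2 d2) (ract c2 \<tau>2) \<cdot>
        (act F \<sigma>1 \<tau>1 d1 c1 \<odot> act F \<sigma>2 \<tau>2 d2 c2) =
    \<phi> (lact \<sigma>1 d1 @ lact \<sigma>2 d2) (ract c1 \<tau>1 @ ract c2 \<tau>2) \<cdot>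
      act F (block_perm (length d1) \<sigma>1 \<sigma>2) (block_perm (length c1) \<tau>1 \<tau>2) (d1 @ d2) (c1 @ c2) \<cdot>
        hcomp F d1 c1 d2 c2"
proof -
  let ?B = "block_perm (length d1) \<sigma>1 \<sigma>2" and ?C = "block_perm (length c1) \<tau>1 \<tau>2"
  have B: "?B permutes {..<length (d1 @ d2)}" "?C permutes {..<length (c1 @ c2)}"
    using block_perm_permutes s by auto
  have l: "lact ?B (d1 @ d2) = lact \<sigma>1 d1 @ lact \<sigma>2 d2" "ract (c1 @ c2) ?C = ract c1 \<tau>1 @ ract c2 \<tau>2"
    using s by (simp_all add: lact_append ract_append)
  have pp: "d1 @ d2 \<in> profiles CC" "c1 @ c2 \<in> profiles CC" using p by auto
  note [simp] = Z.typed(2-4)[OF pp B, unfolded l] F.typed(2-4)[OF pp B, unfolded l]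
  have "\<phi> (lact \<sigma>1 d1 @ lact \<sigma>2 d2) (ract c1 \<tau>1 @ ract c2 \<tau>2) \<cdot>
      hcomp F (lact \<sigma>1 d1) (ract c1 \<tau>1) (lact \<sigma>2 d2) (ract c2 \<tau>2) \<cdot>
        (act F \<sigma>1 \<tau>1 d1 c1 \<odot> act F \<sigma>2 \<tau>2 d2 c2) =
     (hcomp Z (lact \<sigma>1 d1) (ract c1 \<tau>1) (lact \<sigma>2 d2) (ract c2 \<tau>2) \<cdot>
        (act Z \<sigma>1 \<tau>1 d1 c1 \<odot> act Z \<sigma>2 \<tau>2 d2 c2)) \<cdot> (\<phi> d1 c1 \<odot> \<phi> d2 c2)"
    using p s by (simp add: \<phi>_hcomp2 \<phi>_act fuse)
  also have "hcomp Z (lact \<sigma>1 d1) (ract c1 \<tau>1) (lact \<sigma>2 d2) (ract c2 \<tau>2) \<cdot>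
        (act Z \<sigma>1 \<tau>1 d1 c1 \<odot> act Z \<sigma>2 \<tau>2 d2 c2) = act Z ?B ?C (d1 @ d2) (c1 @ c2) \<cdot> hcomp Z d1 c1 d2 c2"
    using p s by (intro colored_PROP.hcomp_equivariant[OF PROP_Z])
  also have "(act Z ?B ?C (d1 @ d2) (c1 @ c2) \<cdot> hcomp Z d1 c1 d2 c2) \<cdot> (\<phi> d1 c1 \<odot> \<phi> d2 c2) =
      (act Z ?B ?C (d1 @ d2) (c1 @ c2) \<cdot> \<phi> (d1 @ d2) (c1 @ c2)) \<cdot> hcomp F d1 c1 d2 c2"
    using p s by (simp add: \<phi>_hcomp assoc_comp)
  also have "act Z ?B ?C (d1 @ d2) (c1 @ c2) \<cdot> \<phi> (d1 @ d2) (c1 @ c2) =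
      \<phi> (lact \<sigma>1 d1 @ lact \<sigma>2 d2) (ract c1 \<tau>1 @ ract c2 \<tau>2) \<cdot> act F ?B ?C (d1 @ d2) (c1 @ c2)"
    using \<phi>_act[OF pp B] by (simp add: l)
  finally show ?thesis using p s by (simp add: assoc_comp)
qed

lemma map_interchange:
  assumes p: "d1 \<in> profiles CC" "b1 \<in> profiles CC" "c1 \<in> profiles CC"
      "d2 \<in> profiles CC" "b2 \<in> profiles CC" "c2 \<in> profiles CC"
  shows "\<phi> (d1 @ d2) (c1 @ c2) \<cdot>
      vcomp F (d1 @ d2) (b1 @ b2) (c1 @ c2) \<cdot> (hcomp F d1 b1 d2 b2 \<odot> hcomp F b1 c1 b2 c2) =
    \<phi> (d1 @ d2) (c1 @ c2) \<cdot> hcomp F d1 c1 d2 c2 \<cdot> (vcomp F d1 b1 c1 \<odot> vcomp F d2 b2 c2) \<cdot>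
        middle_swap E (entry F d1 b1) (entry F d2 b2) (entry F b1 c1) (entry F b2 c2)"
proof -
  let ?M = "middle_swap E (entry Z d1 b1) (entry Z d2 b2) (entry Z b1 c1) (entry Z b2 c2)"
  let ?M' = "middle_swap E (entry F d1 b1) (entry F d2 b2) (entry F b1 c1) (entry F b2 c2)"
  let ?\<Phi> = "(\<phi> d1 b1 \<odot> \<phi> d2 b2) \<odot> (\<phi> b1 c1 \<odot> \<phi> b2 c2)"
  have "\<phi> (d1 @ d2) (c1 @ c2) \<cdot>
      vcomp F (d1 @ d2) (b1 @ b2) (c1 @ c2) \<cdot> (hcomp F d1 b1 d2 b2 \<odot> hcomp F b1 c1 b2 c2) =
     (vcomp Z (d1 @ d2) (b1 @ b2) (c1 @ c2) \<cdot> (hcomp Z d1 b1 d2 b2 \<odot> hcomp Z b1 c1 b2 c2)) \<cdot> ?\<Phi>"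
    using p by (simp add: \<phi>_vcomp2 \<phi>_hcomp fuse)
  also have "vcomp Z (d1 @ d2) (b1 @ b2) (c1 @ c2) \<cdot> (hcomp Z d1 b1 d2 b2 \<odot> hcomp Z b1 c1 b2 c2) =
     hcomp Z d1 c1 d2 c2 \<cdot> (vcomp Z d1 b1 c1 \<odot> vcomp Z d2 b2 c2) \<cdot> ?M"
    using p by (intro colored_PROP.interchange[OF PROP_Z])
  also have "(hcomp Z d1 c1 d2 c2 \<cdot> (vcomp Z d1 b1 c1 \<odot> vcomp Z d2 b2 c2) \<cdot> ?M) \<cdot> ?\<Phi> =
     hcomp Z d1 c1 d2 c2 \<cdot> (vcomp Z d1 b1 c1 \<odot> vcomp Z d2 b2 c2) \<cdot> (?M \<cdot> ?\<Phi>)"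
    using p by (simp add: assoc_comp)
  also have "?M \<cdot> ?\<Phi> = ((\<phi> d1 b1 \<odot> \<phi> b1 c1) \<odot> (\<phi> d2 b2 \<odot> \<phi> b2 c2)) \<cdot> ?M'"
    using p by (intro middle_swap_nat) auto
  also have "hcomp Z d1 c1 d2 c2 \<cdot> (vcomp Z d1 b1 c1 \<odot> vcomp Z d2 b2 c2) \<cdot>
      (((\<phi> d1 b1 \<odot> \<phi> b1 c1) \<odot> (\<phi> d2 b2 \<odot> \<phi> b2 c2)) \<cdot> ?M') =
    \<phi> (d1 @ d2) (c1 @ c2) \<cdot> hcomp F d1 c1 d2 c2 \<cdot> (vcomp F d1 b1 c1 \<odot> vcomp F d2 b2 c2) \<cdot> ?M'"
    using p by (simp add: \<phi>_hcomp2 \<phi>_vcomp fuse)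
  finally show ?thesis .
qed

end

text \<open>Each law of \<open>F\<close> holds after \<open>\<phi>\<close> and after
  \<open>\<psi>\<close>, because \<open>A\<close> and \<open>B\<close> satisfy it, and joint
  monicity then removes the two maps.\<close>

theorem colored_PROP_jointly_monic:
  fixes E :: "('o, 'a) smc" (structure) and CC :: "'c set"
  assumes A: "PROP_map E CC F A \<phi>" and B: "PROP_map E CC F B \<psi>"
    and mono: "\<And>d c w g h. d \<in> profiles CC \<Longrightarrow> c \<in> profiles CC \<Longrightarrow> g \<in> hom E w (entry F d c) \<Longrightarrow>
      h \<in> hom E w (entry F d c) \<Longrightarrow> \<phi> d c \<cdot> g = \<phi> d c \<cdot> h \<Longrightarrow> \<psi> d c \<cdot> g = \<psi> d c \<cdot> h \<Longrightarrow> g = h"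
  shows "colored_PROP E CC F"
proof -
  interpret A: PROP_map E CC F A \<phi> by (rule A)
  interpret B: PROP_map E CC F B \<psi> by (rule B)
  show ?thesis
  proof
    fix d c :: "'c list" assume p: "d \<in> profiles CC" "c \<in> profiles CC"
    show "act F id id d c = ident E (entry F d c)"
      by (rule mono[OF p _ _ A.map_act_id[OF p] B.map_act_id[OF p]])
        (use p A.F.act_hom[OF p permutes_id permutes_id] in \<open>auto simp: A.hom_iff\<close>)
    fix \<sigma> \<tau> \<sigma>' \<tau>'
    assume s: "\<sigma> permutes {..<length d}" "\<tau> permutes {..<length c}"
      "\<sigma>' permutes {..<length d}" "\<tau>' permutes {..<length c}"
    have cs: "\<sigma>' \<circ> \<sigma> permutes {..<length d}" "\<tau> \<circ> \<tau>' permutes {..<length c}"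
      using s by (auto intro: permutes_compose)
    have q: "lact (\<sigma>' \<circ> \<sigma>) d \<in> profiles CC" "ract c (\<tau> \<circ> \<tau>') \<in> profiles CC" using p cs by auto
    show "act F \<sigma>' \<tau>' (lact \<sigma> d) (ract c \<tau>) \<cdot> act F \<sigma> \<tau> d c = act F (\<sigma>' \<circ> \<sigma>) (\<tau> \<circ> \<tau>') d c"
      by (rule mono[OF q _ _ A.map_act_comp[OF p s] B.map_act_comp[OF p s]])
        (use p s cs in \<open>auto simp: A.hom_iff lact_lact ract_ract\<close>)
  next
    fix d b c :: "'c list" and \<sigma> \<mu>
    assume p: "d \<in> profiles CC" "b \<in> profiles CC" "c \<in> profiles CC"
      and s: "\<sigma> permutes {..<length d}" "\<mu> permutes {..<length c}"
    have q: "lact \<sigma> d \<in> profiles CC" "ract c \<mu> \<in> profiles CC" using p s by auto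
    note [simp] = A.F.typed(2-4)[OF p(1,2) s(1) permutes_id, simplified]
      A.F.typed(2-4)[OF p(2,3) permutes_id s(2), simplified]
    show "vcomp F (lact \<sigma> d) b (ract c \<mu>) \<cdot> (act F \<sigma> id d b \<odot> act F id \<mu> b c) = act F \<sigma> \<mu> d c \<cdot> vcomp F d b c"
      by (rule mono[OF q _ _ A.map_vcomp_outer[OF p s] B.map_vcomp_outer[OF p s]])
        (use p s q in \<open>auto simp: A.hom_iff\<close>)
  next
    fix d b c :: "'c list" and \<tau>
    assume p: "d \<in> profiles CC" "b \<in> profiles CC" "c \<in> profiles CC" and s: "\<tau> permutes {..<length b}"
    have s': "inv \<tau> permutes {..<length b}" using s by (rule permutes_inv)
    have r: "ract b (inv \<tau>) = lact \<tau> b" using ract_lact[OF s'] s by (simp add: permutes_inv_inv)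
    note [simp] = A.F.typed(2-4)[OF p(1,2) permutes_id s', simplified, unfolded r]
      A.F.typed(2-4)[OF p(2,3) s permutes_id, simplified]
    show "vcomp F d (lact \<tau> b) c \<cdot> (act F id (inv \<tau>) d b \<odot> act F \<tau> id b c) = vcomp F d b c"
      by (rule mono[OF p(1,3) _ _ A.map_vcomp_inner[OF p s] B.map_vcomp_inner[OF p s]])
        (use p s in \<open>auto simp: A.hom_iff\<close>)
  next
    fix d a b c :: "'c list"
    assume p: "d \<in> profiles CC" "a \<in> profiles CC" "b \<in> profiles CC" "c \<in> profiles CC"
    show "vcomp F d b c \<cdot> (vcomp F d a b \<odot> ident E (entry F b c)) =
      vcomp F d a c \<cdot> (ident E (entry F d a) \<odot> vcomp F a b c) \<cdot> assoc E (entry F d a) (entry F a b) (entry F b c)"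
      by (rule mono[OF p(1,4) _ _ A.map_vcomp_assoc[OF p] B.map_vcomp_assoc[OF p]])
        (use p in \<open>auto simp: A.hom_iff\<close>)
  next
    fix d1 c1 d2 c2 d3 c3 :: "'c list"
    assume p: "d1 \<in> profiles CC" "c1 \<in> profiles CC" "d2 \<in> profiles CC" "c2 \<in> profiles CC"
      "d3 \<in> profiles CC" "c3 \<in> profiles CC"
    have q: "d1 @ d2 @ d3 \<in> profiles CC" "c1 @ c2 @ c3 \<in> profiles CC" using p by auto
    show "hcomp F (d1 @ d2) (c1 @ c2) d3 c3 \<cdot> (hcomp F d1 c1 d2 c2 \<odot> ident E (entry F d3 c3)) =
      hcomp F d1 c1 (d2 @ d3) (c2 @ c3) \<cdot> (ident E (entry F d1 c1) \<odot> hcomp F d2 c2 d3 c3) \<cdot>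
        assoc E (entry F d1 c1) (entry F d2 c2) (entry F d3 c3)"
      by (rule mono[OF q _ _ A.map_hcomp_assoc[OF p] B.map_hcomp_assoc[OF p]])
        (use p A.F.typed(8-10)[of "d1 @ d2" "c1 @ c2" d3 c3] in \<open>auto simp: A.hom_iff\<close>)
  next
    fix d1 c1 d2 c2 :: "'c list" and \<sigma>1 \<tau>1 \<sigma>2 \<tau>2
    assume p: "d1 \<in> profiles CC" "c1 \<in> profiles CC" "d2 \<in> profiles CC" "c2 \<in> profiles CC"
      and s: "\<sigma>1 permutes {..<length d1}" "\<tau>1 permutes {..<length c1}"
        "\<sigma>2 permutes {..<length d2}" "\<tau>2 permutes {..<length c2}"
    let ?B = "block_perm (length d1) \<sigma>1 \<sigma>2" and ?C = "block_perm (length c1) \<tau>1 \<tau>2"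
    have B: "?B permutes {..<length (d1 @ d2)}" "?C permutes {..<length (c1 @ c2)}"
      using block_perm_permutes s by auto
    have l: "lact ?B (d1 @ d2) = lact \<sigma>1 d1 @ lact \<sigma>2 d2" "ract (c1 @ c2) ?C = ract c1 \<tau>1 @ ract c2 \<tau>2"
      using s by (simp_all add: lact_append ract_append)
    have pp: "d1 @ d2 \<in> profiles CC" "c1 @ c2 \<in> profiles CC" using p by auto
    have q: "lact \<sigma>1 d1 @ lact \<sigma>2 d2 \<in> profiles CC" "ract c1 \<tau>1 @ ract c2 \<tau>2 \<in> profiles CC" using p s by auto
    show "hcomp F (lact \<sigma>1 d1) (ract c1 \<tau>1) (lact \<sigma>2 d2) (ract c2 \<tau>2) \<cdot>
        (act F \<sigma>1 \<tau>1 d1 c1 \<odot> act F \<sigma>2 \<tau>2 d2 c2) = act F ?B ?C (d1 @ d2) (c1 @ c2) \<cdot> hcomp F d1 c1 d2 c2"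
      by (rule mono[OF q _ _ A.map_hcomp_equivariant[OF p s] B.map_hcomp_equivariant[OF p s]])
        (use p s A.F.typed(2-4)[OF pp B] in \<open>auto simp: A.hom_iff l\<close>)
  next
    fix d1 b1 c1 d2 b2 c2 :: "'c list"
    assume p: "d1 \<in> profiles CC" "b1 \<in> profiles CC" "c1 \<in> profiles CC"
      "d2 \<in> profiles CC" "b2 \<in> profiles CC" "c2 \<in> profiles CC"
    have q: "d1 @ d2 \<in> profiles CC" "c1 @ c2 \<in> profiles CC" using p by auto
    show "vcomp F (d1 @ d2) (b1 @ b2) (c1 @ c2) \<cdot> (hcomp F d1 b1 d2 b2 \<odot> hcomp F b1 c1 b2 c2) =
      hcomp F d1 c1 d2 c2 \<cdot> (vcomp F d1 b1 c1 \<odot> vcomp F d2 b2 c2) \<cdot>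
        middle_swap E (entry F d1 b1) (entry F d2 b2) (entry F b1 c1) (entry F b2 c2)"
      by (rule mono[OF q _ _ A.map_interchange[OF p] B.map_interchange[OF p]])
        (use p in \<open>auto simp: A.hom_iff\<close>)
  qed (use A.F.entry_Obj A.F.act_hom A.F.vcomp_hom A.F.hcomp_hom in auto)
qed

lemma (in closed_symmetric_monoidal_category) PROP_map_if_prop_map:
  assumes "colored_PROP E CC F" "colored_PROP E CC Z" "is_prop_map E CC F Z \<phi>"
  shows "PROP_map E CC F Z \<phi>"
  using assms by (intro PROP_map.intro PROP_map_axioms.intro PROP_data_if_colored_PROP
      closed_symmetric_monoidal_category_axioms)

section \<open>The PROP of a family of maps\<close>

context tensor_family
begin

sublocale X: obj_family E CC X
  by standard (rule XY_Obj)

sublocale Y: obj_family E CC Y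
  by standard (rule XY_Obj)

abbreviation "ft c \<equiv> tens_arr E f c"

lemma ft_typed [simp]:
  assumes "c \<in> profiles CC"
  shows "ft c \<in> Arr E" "Dom E (ft c) = X.T c" "Cod E (ft c) = Y.T c"
  using assms tens_arr_typed[of c] by (auto simp: profiles_def)

text \<open>\<open>u\<close> and \<open>v\<close> have the same image in the internal hom from \<open>X\<^sub>c\<close> to \<open>Y\<^sub>d\<close>; for the
  structure maps of two algebras this says that \<open>f\<close> is a morphism.\<close>

definition compat :: "'c list \<Rightarrow> 'c list \<Rightarrow> 'a \<Rightarrow> 'a \<Rightarrow> bool" where
  "compat d c u v \<longleftrightarrow> u \<in> Arr E \<and> v \<in> Arr E \<and> Dom E u = Dom E v \<and> Cod E u = X.H d c \<and> Cod E v = Y.H d c \<and>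
     ft d \<cdot> X.unc d c u = Y.unc d c v \<cdot> (ident E (Dom E u) \<odot> ft c)"

lemma compatD:
  assumes "compat d c u v"
  shows "u \<in> Arr E" "v \<in> Arr E" "Dom E u = Dom E v" "Cod E u = X.H d c" "Cod E v = Y.H d c"
    "ft d \<cdot> X.unc d c u = Y.unc d c v \<cdot> (ident E (Dom E v) \<odot> ft c)"
  using assms by (auto simp: compat_def)

lemma compat_comp:
  assumes p: "d \<in> profiles CC" "c \<in> profiles CC"
    and uv: "compat d c u v" and k: "k \<in> Arr E" "Cod E k = Dom E u"
  shows "compat d c (u \<cdot> k) (v \<cdot> k)"
proof -
  note D = compatD[OF uv]
  have "ft d \<cdot> X.unc d c (u \<cdot> k) = (ft d \<cdot> X.unc d c u) \<cdot> (k \<odot> ident E (X.T c))"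
    using p k D(1-5) by (simp add: X.unc_comp assoc_comp)
  also have "\<dots> = Y.unc d c (v \<cdot> k) \<cdot> (ident E (Dom E k) \<odot> ft c)"
    unfolding D(6) using p k D(1-5) by (simp add: Y.unc_comp fuse)
  finally show ?thesis using p k D(1-5) by (simp add: compat_def)
qed

text \<open>\<open>f\<close> is carried from the outputs to the inputs: past the output permutation
  by naturality, past \<open>u\<close> by compatibility, and past the input permutation by
  naturality again.\<close>

lemma compat_act:
  assumes p: "d \<in> profiles CC" "c \<in> profiles CC" "\<sigma> permutes {..<length d}" "\<tau> permutes {..<length c}"
    and uv: "compat d c u v"
  shows "compat (lact \<sigma> d) (ract c \<tau>) (act X.Q \<sigma> \<tau> d c \<cdot> u) (act Y.Q \<sigma> \<tau> d c \<cdot> v)"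
proof -
  note D = compatD[OF uv]
  let ?w = "ident E (Dom E v)"
  let ?pX = "perm_iso E X (ract c \<tau>) \<tau>" and ?pY = "perm_iso E Y (ract c \<tau>) \<tau>"
  have n1: "perm_iso E Y d \<sigma> \<cdot> ft d = ft (lact \<sigma> d) \<cdot> perm_iso E X d \<sigma>"
    using p by (intro perm_iso_natural) (auto simp: profiles_def)
  have n2: "?pY \<cdot> ft (ract c \<tau>) = ft c \<cdot> ?pX"
    using p perm_iso_natural[of "ract c \<tau>" \<tau>] ract_profiles[OF p(2,4)] by (simp add: profiles_def)
  have "ft (lact \<sigma> d) \<cdot> X.unc (lact \<sigma> d) (ract c \<tau>) (act X.Q \<sigma> \<tau> d c \<cdot> u) =
      (ft (lact \<sigma> d) \<cdot> perm_iso E X d \<sigma>) \<cdot> X.unc d c u \<cdot> (?w \<odot> ?pX)"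
    using p D(1-5) by (simp add: X.unc_act assoc_comp)
  also have "\<dots> = perm_iso E Y d \<sigma> \<cdot> (ft d \<cdot> X.unc d c u) \<cdot> (?w \<odot> ?pX)"
    unfolding n1[symmetric] using p D(1-5) by (simp add: assoc_comp)
  also have "\<dots> = perm_iso E Y d \<sigma> \<cdot> Y.unc d c v \<cdot> (?w \<odot> (ft c \<cdot> ?pX))"
    unfolding D(6) using p D(1-5) by (simp add: fuse)
  also have "\<dots> = Y.unc (lact \<sigma> d) (ract c \<tau>) (act Y.Q \<sigma> \<tau> d c \<cdot> v) \<cdot> (?w \<odot> ft (ract c \<tau>))"
    unfolding n2[symmetric] using p D(1-5) by (simp add: Y.unc_act fuse)
  finally show ?thesis using p D(1-5) by (simp add: compat_def)
qed

text \<open>Compatibility of \<open>u\<close> and \<open>v\<close> moves \<open>f\<close> from the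
  profile \<open>d\<close> to \<open>b\<close>, and compatibility of \<open>u'\<close> and
  \<open>v'\<close> moves it on from \<open>b\<close> to \<open>c\<close>.\<close>

lemma compat_vcomp:
  assumes p: "d \<in> profiles CC" "b \<in> profiles CC" "c \<in> profiles CC"
    and uv: "compat d b u v" and uv': "compat b c u' v'"
  shows "compat d c (vcomp X.Q d b c \<cdot> (u \<odot> u')) (vcomp Y.Q d b c \<cdot> (v \<odot> v'))"
proof -
  note D = compatD[OF uv] and D' = compatD[OF uv']
  let ?w = "ident E (Dom E v)" and ?w' = "ident E (Dom E v')"
  let ?A = "\<lambda>t. assoc E (Dom E v) (Dom E v') t"
  have "ft d \<cdot> X.unc d c (vcomp X.Q d b c \<cdot> (u \<odot> u')) =
     (ft d \<cdot> X.unc d b u) \<cdot> (?w \<odot> X.unc b c u') \<cdot> ?A (X.T c)"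
    using p D(1-5) D'(1-5) by (simp add: X.unc_vcomp assoc_comp)
  also have "\<dots> = Y.unc d b v \<cdot> (?w \<odot> (ft b \<cdot> X.unc b c u')) \<cdot> ?A (X.T c)"
    unfolding D(6) using p D(1-5) D'(1-5) by (simp add: fuse)
  also have "\<dots> = Y.unc d b v \<cdot> (?w \<odot> Y.unc b c v') \<cdot> ((?w \<odot> (?w' \<odot> ft c)) \<cdot> ?A (X.T c))"
    unfolding D'(6) using p D(1-5) D'(1-5) by (simp add: fuse)
  also have "(?w \<odot> (?w' \<odot> ft c)) \<cdot> ?A (X.T c) = ?A (Y.T c) \<cdot> (ident E (Dom E v \<otimes> Dom E v') \<odot> ft c)"
    using p D(1-5) D'(1-5) by (subst assoc_nat_right) auto
  also have "Y.unc d b v \<cdot> (?w \<odot> Y.unc b c v') \<cdot> (?A (Y.T c) \<cdot> (ident E (Dom E v \<otimes> Dom E v') \<odot> ft c)) =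
     Y.unc d c (vcomp Y.Q d b c \<cdot> (v \<odot> v')) \<cdot> (ident E (Dom E v \<otimes> Dom E v') \<odot> ft c)"
    using p D(1-5) D'(1-5) by (simp add: Y.unc_vcomp assoc_comp)
  finally show ?thesis using p D(1-5) D'(1-5) by (simp add: compat_def)
qed

text \<open>Joins are natural in \<open>f\<close>. Outputs use this directly, inputs in the
  conjugated form \<open>n3\<close>, because they are split by an inverse join.\<close>

lemma compat_hcomp:
  assumes p: "d1 \<in> profiles CC" "c1 \<in> profiles CC" "d2 \<in> profiles CC" "c2 \<in> profiles CC"
    and uv: "compat d1 c1 u v" and uv': "compat d2 c2 u' v'"
  shows "compat (d1 @ d2) (c1 @ c2) (hcomp X.Q d1 c1 d2 c2 \<cdot> (u \<odot> u')) (hcomp Y.Q d1 c1 d2 c2 \<cdot> (v \<odot> v'))"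
proof -
  note D = compatD[OF uv] and D' = compatD[OF uv']
  let ?w = "ident E (Dom E v)" and ?w' = "ident E (Dom E v')" and ?W = "ident E (Dom E v \<otimes> Dom E v')"
  let ?M = "\<lambda>s t. middle_swap E (Dom E v) (Dom E v') s t"
  let ?jX = "join E X c1 c2" and ?jY = "join E Y c1 c2"
  have n1: "join E Y d1 d2 \<cdot> (ft d1 \<odot> ft d2) = ft (d1 @ d2) \<cdot> join E X d1 d2"
    and n2: "?jY \<cdot> (ft c1 \<odot> ft c2) = ft (c1 @ c2) \<cdot> ?jX"
    using p join_natural[of d1 d2] join_natural[of c1 c2] by (auto simp: profiles_def)
  from n2 have "inv_arr E ?jY \<cdot> (?jY \<cdot> (ft c1 \<odot> ft c2)) \<cdot> inv_arr E ?jX =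
     inv_arr E ?jY \<cdot> (ft (c1 @ c2) \<cdot> ?jX) \<cdot> inv_arr E ?jX" by simp
  then have n3: "(ft c1 \<odot> ft c2) \<cdot> inv_arr E ?jX = inv_arr E ?jY \<cdot> ft (c1 @ c2)"
    using p by (simp add: assoc_comp)
  have n4: "((?w \<odot> ft c1) \<odot> (?w' \<odot> ft c2)) \<cdot> ?M (X.T c1) (X.T c2) = ?M (Y.T c1) (Y.T c2) \<cdot> (?W \<odot> (ft c1 \<odot> ft c2))"
    using p D(1-5) D'(1-5) by (subst middle_swap_nat_right) auto
  have "ft (d1 @ d2) \<cdot> X.unc (d1 @ d2) (c1 @ c2) (hcomp X.Q d1 c1 d2 c2 \<cdot> (u \<odot> u')) =
     (ft (d1 @ d2) \<cdot> join E X d1 d2) \<cdot> (X.unc d1 c1 u \<odot> X.unc d2 c2 u') \<cdot> ?M (X.T c1) (X.T c2) \<cdot>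
       (?W \<odot> inv_arr E ?jX)"
    using p D(1-5) D'(1-5) by (simp add: X.unc_hcomp assoc_comp)
  also have "\<dots> = join E Y d1 d2 \<cdot> ((ft d1 \<cdot> X.unc d1 c1 u) \<odot> (ft d2 \<cdot> X.unc d2 c2 u')) \<cdot>
      ?M (X.T c1) (X.T c2) \<cdot> (?W \<odot> inv_arr E ?jX)"
    unfolding n1[symmetric] using p D(1-5) D'(1-5) by (simp add: fuse)
  also have "\<dots> = join E Y d1 d2 \<cdot> (Y.unc d1 c1 v \<odot> Y.unc d2 c2 v') \<cdot>
      (((?w \<odot> ft c1) \<odot> (?w' \<odot> ft c2)) \<cdot> ?M (X.T c1) (X.T c2)) \<cdot> (?W \<odot> inv_arr E ?jX)"
    unfolding D(6) D'(6) using p D(1-5) D'(1-5) by (simp add: fuse)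
  also have "\<dots> = join E Y d1 d2 \<cdot> (Y.unc d1 c1 v \<odot> Y.unc d2 c2 v') \<cdot> ?M (Y.T c1) (Y.T c2) \<cdot>
      (?W \<odot> ((ft c1 \<odot> ft c2) \<cdot> inv_arr E ?jX))"
    unfolding n4 using p D(1-5) D'(1-5) by (simp add: fuse)
  also have "\<dots> = Y.unc (d1 @ d2) (c1 @ c2) (hcomp Y.Q d1 c1 d2 c2 \<cdot> (v \<odot> v')) \<cdot> (?W \<odot> ft (c1 @ c2))"
    unfolding n3 using p D(1-5) D'(1-5) by (simp add: Y.unc_hcomp fuse)
  finally show ?thesis using p D(1-5) D'(1-5) by (simp add: compat_def)
qed

end

text \<open>Each \<open>R d c\<close>, with projections \<open>p d c\<close> and
  \<open>q d c\<close>, is a pullback whose cone condition is expressed by \<open>compat\<close>.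
  The value \<open>undefined\<close> away from profiles is the one demanded by
  \<open>is_prop_map\<close>.\<close>

locale morphism_PROP = tensor_family E CC X Y f
  for E :: "('o, 'a) smc" (structure) and CC :: "'c set" and X Y f +
  fixes R :: "'c list \<Rightarrow> 'c list \<Rightarrow> 'o" and p q :: "'c list \<Rightarrow> 'c list \<Rightarrow> 'a"
  assumes undefined_pq: "d \<notin> profiles CC \<or> c \<notin> profiles CC \<Longrightarrow> p d c = undefined \<and> q d c = undefined"
    and Dom_p: "d \<in> profiles CC \<Longrightarrow> c \<in> profiles CC \<Longrightarrow> Dom E (p d c) = R d c"
    and compat_pq: "d \<in> profiles CC \<Longrightarrow> c \<in> profiles CC \<Longrightarrow> compat d c (p d c) (q d c)"
    and universal: "d \<in> profiles CC \<Longrightarrow> c \<in> profiles CC \<Longrightarrow> compat d c u v \<Longrightarrow>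
      \<exists>!h. h \<in> hom E (Dom E u) (R d c) \<and> p d c \<cdot> h = u \<and> q d c \<cdot> h = v"
begin

lemma pq_typed [simp]:
  assumes "d \<in> profiles CC" "c \<in> profiles CC"
  shows "p d c \<in> Arr E" "Dom E (p d c) = R d c" "Cod E (p d c) = X.H d c"
    "q d c \<in> Arr E" "Dom E (q d c) = R d c" "Cod E (q d c) = Y.H d c"
  using compatD(1-5)[OF compat_pq[OF assms]] Dom_p[OF assms] by auto

lemma R_Obj [simp]: "d \<in> profiles CC \<Longrightarrow> c \<in> profiles CC \<Longrightarrow> R d c \<in> Obj E"
  using Dom_Obj[of "p d c"] by simp

definition into :: "'c list \<Rightarrow> 'c list \<Rightarrow> 'a \<Rightarrow> 'a \<Rightarrow> 'a" where
  "into d c u v = (THE h. h \<in> hom E (Dom E u) (R d c) \<and> p d c \<cdot> h = u \<and> q d c \<cdot> h = v)"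

lemma into_typed:
  assumes "d \<in> profiles CC" "c \<in> profiles CC" "compat d c u v"
  shows "into d c u v \<in> hom E (Dom E u) (R d c)" "p d c \<cdot> into d c u v = u" "q d c \<cdot> into d c u v = v"
  using theI'[OF universal[OF assms]] by (auto simp: into_def)

lemma pq_jointly_monic:
  assumes "d \<in> profiles CC" "c \<in> profiles CC" "g \<in> hom E w (R d c)" "h \<in> hom E w (R d c)"
    "p d c \<cdot> g = p d c \<cdot> h" "q d c \<cdot> g = q d c \<cdot> h"
  shows "g = h"
proof -
  have "compat d c (p d c \<cdot> g) (q d c \<cdot> g)"
    using assms by (intro compat_comp compat_pq) (auto simp: hom_iff)
  from universal[OF assms(1,2) this] assms show ?thesis by (auto simp: hom_iff)
qed

text \<open>The PROP \<open>E\<^sub>f\<close> of the overview: its operations are the only ones for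
  which both projections are maps of PROPs.\<close>

definition PF :: "('c, 'o, 'a) colored_prop" where
  "PF = \<lparr>entry = R,
     act = (\<lambda>\<sigma> \<tau> d c. into (lact \<sigma> d) (ract c \<tau>) (act X.Q \<sigma> \<tau> d c \<cdot> p d c) (act Y.Q \<sigma> \<tau> d c \<cdot> q d c)),
     vcomp = (\<lambda>d b c. into d c (vcomp X.Q d b c \<cdot> (p d b \<odot> p b c)) (vcomp Y.Q d b c \<cdot> (q d b \<odot> q b c))),
     hcomp = (\<lambda>d1 c1 d2 c2. into (d1 @ d2) (c1 @ c2)
       (hcomp X.Q d1 c1 d2 c2 \<cdot> (p d1 c1 \<odot> p d2 c2)) (hcomp Y.Q d1 c1 d2 c2 \<cdot> (q d1 c1 \<odot> q d2 c2)))\<rparr>"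

lemma PF_entry [simp]: "entry PF = R"
  by (simp add: PF_def)

lemma PF_act:
  assumes "d \<in> profiles CC" "c \<in> profiles CC" "\<sigma> permutes {..<length d}" "\<tau> permutes {..<length c}"
  shows "act PF \<sigma> \<tau> d c \<in> hom E (R d c) (R (lact \<sigma> d) (ract c \<tau>))"
    "p (lact \<sigma> d) (ract c \<tau>) \<cdot> act PF \<sigma> \<tau> d c = act X.Q \<sigma> \<tau> d c \<cdot> p d c"
    "q (lact \<sigma> d) (ract c \<tau>) \<cdot> act PF \<sigma> \<tau> d c = act Y.Q \<sigma> \<tau> d c \<cdot> q d c"
  using into_typed[OF _ _ compat_act[OF assms compat_pq[OF assms(1,2)]]] assms by (auto simp: PF_def)

lemma PF_vcomp:
  assumes "d \<in> profiles CC" "b \<in> profiles CC" "c \<in> profiles CC"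
  shows "vcomp PF d b c \<in> hom E (R d b \<otimes> R b c) (R d c)"
    "p d c \<cdot> vcomp PF d b c = vcomp X.Q d b c \<cdot> (p d b \<odot> p b c)"
    "q d c \<cdot> vcomp PF d b c = vcomp Y.Q d b c \<cdot> (q d b \<odot> q b c)"
  using into_typed[OF _ _ compat_vcomp[OF assms compat_pq[OF assms(1,2)] compat_pq[OF assms(2,3)]]] assms
  by (auto simp: PF_def)

lemma PF_hcomp:
  assumes "d1 \<in> profiles CC" "c1 \<in> profiles CC" "d2 \<in> profiles CC" "c2 \<in> profiles CC"
  shows "hcomp PF d1 c1 d2 c2 \<in> hom E (R d1 c1 \<otimes> R d2 c2) (R (d1 @ d2) (c1 @ c2))"
    "p (d1 @ d2) (c1 @ c2) \<cdot> hcomp PF d1 c1 d2 c2 = hcomp X.Q d1 c1 d2 c2 \<cdot> (p d1 c1 \<odot> p d2 c2)"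
    "q (d1 @ d2) (c1 @ c2) \<cdot> hcomp PF d1 c1 d2 c2 = hcomp Y.Q d1 c1 d2 c2 \<cdot> (q d1 c1 \<odot> q d2 c2)"
  using into_typed[OF _ _ compat_hcomp[OF assms compat_pq[OF assms(1,2)] compat_pq[OF assms(3,4)]]] assms
  by (auto simp: PF_def)

lemma p_prop_map: "is_prop_map E CC PF X.Q p"
  using undefined_pq by (auto simp: is_prop_map_def hom_iff PF_act PF_vcomp PF_hcomp)

lemma q_prop_map: "is_prop_map E CC PF Y.Q q"
  using undefined_pq by (auto simp: is_prop_map_def hom_iff PF_act PF_vcomp PF_hcomp)

lemma colored_PROP_PF: "colored_PROP E CC PF"
proof (rule colored_PROP_jointly_monic)
  have PF: "PROP_data E CC PF"
    by unfold_locales (simp_all add: PF_act PF_vcomp PF_hcomp)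
  note i = PROP_map.intro PROP_map_axioms.intro PROP_data_if_colored_PROP
    closed_symmetric_monoidal_category_axioms X.colored_PROP_endo Y.colored_PROP_endo
  show "PROP_map E CC PF X.Q p" by (intro i PF p_prop_map)
  show "PROP_map E CC PF Y.Q q" by (intro i PF q_prop_map)
qed (use pq_jointly_monic in auto)

end

section \<open>Pullbacks, pushouts and lifting\<close>

lemma strongly_inaccessible_finite:
  fixes U :: "'u rel"
  assumes "strongly_inaccessible U" "finite A"
  shows "|A| <o U"
proof (rule ordLess_transitive)
  show "|A| <o natLeq" using assms(2) by (simp add: finite_iff_ordLess_natLeq)
  show "natLeq <o U" using assms(1) by (simp add: strongly_inaccessible_def)
qed

text \<open>\<open>complete\<close> and \<open>cocomplete\<close> concern index categories with
  objects and arrows in \<open>'u\<close>. Finite shapes therefore need distinct names in that type,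
  and these exist because \<open>U\<close> exceeds \<open>natLeq\<close>.\<close>

lemma strongly_inaccessible_distinct:
  fixes U :: "'u rel"
  assumes "strongly_inaccessible U"
  obtains i :: "nat \<Rightarrow> 'u" where "inj i"
proof -
  have U: "Card_order U" "natLeq <o U" using assms by (auto simp: strongly_inaccessible_def)
  have "infinite (Field U)"
  proof
    assume "finite (Field U)"
    then have "|Field U| <o natLeq" by (simp add: finite_iff_ordLess_natLeq)
    then have "U <o natLeq"
      by (rule ordIso_ordLess_trans[OF ordIso_symmetric[OF card_of_Field_ordIso[OF U(1)]]])
    from ordLess_transitive[OF this U(2)] show False by (simp add: ordLess_irreflexive)
  qed
  then have "infinite (UNIV :: 'u set)" using finite_subset[of "Field U" UNIV] by auto
  then show ?thesis using infinite_countable_subset[of "UNIV :: 'u set"] that by auto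
qed

text \<open>The shape \<open>0 \<rightarrow> 2 \<leftarrow> 1\<close> of a pullback diagram; the arrows 0, 1, 2 are the identities, and 3 and 4
  the other two.\<close>

definition cospan_shape :: "(nat \<Rightarrow> 'u) \<Rightarrow> ('u, 'u) cat" where
  "cospan_shape i = \<lparr>Obj = i ` {..<3}, Arr = i ` {..<5},
     Dom = (\<lambda>a. if a = i 3 then i 0 else if a = i 4 then i 1 else a),
     Cod = (\<lambda>a. if a \<in> {i 3, i 4} then i 2 else a),
     ident = (\<lambda>x. x), comp = (\<lambda>b a. if a \<in> {i 3, i 4} then a else b)\<rparr>"

text \<open>The shape \<open>1 \<leftarrow> 0 \<rightarrow> 2\<close> of a pushout diagram, with the same convention.\<close>

definition span_shape :: "(nat \<Rightarrow> 'u) \<Rightarrow> ('u, 'u) cat" where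
  "span_shape i = \<lparr>Obj = i ` {..<3}, Arr = i ` {..<5},
     Dom = (\<lambda>a. if a \<in> {i 3, i 4} then i 0 else a),
     Cod = (\<lambda>a. if a = i 3 then i 1 else if a = i 4 then i 2 else a),
     ident = (\<lambda>x. x), comp = (\<lambda>b a. if a \<in> {i 3, i 4} then a else b)\<rparr>"

lemma lessThan_3_5: "{..<3::nat} = {0, 1, 2}" "{..<5::nat} = {0, 1, 2, 3, 4}"
  by auto

lemma category_cospan_shape: "inj i \<Longrightarrow> category (cospan_shape i)"
  by unfold_locales (auto simp: cospan_shape_def hom_def lessThan_3_5 inj_eq split: if_splits)

lemma category_span_shape: "inj i \<Longrightarrow> category (span_shape i)"
  by unfold_locales (auto simp: span_shape_def hom_def lessThan_3_5 inj_eq split: if_splits)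

lemma (in category) pullback_exists:
  fixes U :: "'u rel"
  assumes U: "strongly_inaccessible U" and cpl: "complete U C"
    and f: "f \<in> hom C a c" and g: "g \<in> hom C b c"
  obtains w p q where "p \<in> hom C w a" "q \<in> hom C w b" "f \<cdot> p = g \<cdot> q"
    "\<And>z u v. u \<in> hom C z a \<Longrightarrow> v \<in> hom C z b \<Longrightarrow> f \<cdot> u = g \<cdot> v \<Longrightarrow>
      \<exists>!h. h \<in> hom C z w \<and> p \<cdot> h = u \<and> q \<cdot> h = v"
proof -
  obtain i :: "nat \<Rightarrow> 'u" where i: "inj i" using strongly_inaccessible_distinct[OF U] .
  note fg = f[unfolded hom_iff] g[unfolded hom_iff]
  have ob: "a \<in> Obj C" "b \<in> Obj C" "c \<in> Obj C" using fg by auto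
  let ?J = "cospan_shape i"
  let ?F = "\<lparr>omap = (\<lambda>x. if x = i 0 then a else if x = i 1 then b else c),
     amap = (\<lambda>x. if x = i 0 then ident C a else if x = i 1 then ident C b else if x = i 2 then ident C c
       else if x = i 3 then f else g)\<rparr>"
  have small: "small_category U ?J"
    unfolding small_category_def using category_cospan_shape[OF i] strongly_inaccessible_finite[OF U]
    by (auto simp: cospan_shape_def)
  have "is_functor ?J C ?F"
    unfolding is_functor_def using fg ob
    by (auto simp: cospan_shape_def hom_def lessThan_3_5 inj_eq[OF i] split: if_splits)
  with small cpl obtain L k where L: "is_limit ?J C ?F L k" unfolding complete_def by blast
  have cone: "is_cone ?J C ?F M m \<longleftrightarrow> m (i 0) \<in> hom C M a \<and> m (i 1) \<in> hom C M b \<and> m (i 2) \<in> hom C M c \<and>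
      f \<cdot> m (i 0) = m (i 2) \<and> g \<cdot> m (i 1) = m (i 2)" for M m
    unfolding is_cone_def using fg ob
    by (auto simp: cospan_shape_def hom_def lessThan_3_5 inj_eq[OF i])
  have Lk: "k (i 0) \<in> hom C L a" "k (i 1) \<in> hom C L b" "f \<cdot> k (i 0) = k (i 2)" "g \<cdot> k (i 1) = k (i 2)"
    using L unfolding is_limit_def cone by auto
  show thesis
  proof (rule that[of "k (i 0)" L "k (i 1)"])
    fix z u v assume uv: "u \<in> hom C z a" "v \<in> hom C z b" "f \<cdot> u = g \<cdot> v"
    let ?m = "\<lambda>x. if x = i 0 then u else if x = i 1 then v else f \<cdot> u"
    have "is_cone ?J C ?F z ?m"
      unfolding cone using uv fg by (auto simp: inj_eq[OF i] hom_iff)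
    with L have *: "\<exists>!h. h \<in> hom C z L \<and> (\<forall>j \<in> Obj ?J. k j \<cdot> h = ?m j)"
      unfolding is_limit_def by blast
    \<comment> \<open>A limit cone also has a leg to the corner of the cospan. It equals
      \<open>f\<close> after the first leg, so its condition follows from that on the first
      leg.\<close>
    have "(\<forall>j \<in> Obj ?J. k j \<cdot> h = ?m j) \<longleftrightarrow> k (i 0) \<cdot> h = u \<and> k (i 1) \<cdot> h = v" if "h \<in> hom C z L" for h
    proof -
      have "k (i 2) \<cdot> h = f \<cdot> k (i 0) \<cdot> h" unfolding Lk(3)[symmetric]
        using that Lk fg by (intro assoc_comp) (auto simp: hom_iff)
      then show ?thesis by (auto simp: cospan_shape_def lessThan_3_5 inj_eq[OF i])
    qed
    then show "\<exists>!h. h \<in> hom C z L \<and> k (i 0) \<cdot> h = u \<and> k (i 1) \<cdot> h = v"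
      using * by (smt (verit, del_insts))
  qed (use Lk in auto)
qed

lemma (in category) pushout_exists:
  fixes U :: "'u rel"
  assumes U: "strongly_inaccessible U" and cpl: "cocomplete U C"
    and f: "f \<in> Arr C" and g: "g \<in> Arr C" and fg: "Dom C f = Dom C g"
  obtains p q where "is_pushout C f g p q"
proof -
  obtain i :: "nat \<Rightarrow> 'u" where i: "inj i" using strongly_inaccessible_distinct[OF U] .
  let ?a = "Dom C g" and ?b = "Cod C f" and ?c = "Cod C g"
  have ob: "?a \<in> Obj C" "?b \<in> Obj C" "?c \<in> Obj C" using f g by auto
  let ?J = "span_shape i"
  let ?F = "\<lparr>omap = (\<lambda>x. if x = i 0 then ?a else if x = i 1 then ?b else ?c),
     amap = (\<lambda>x. if x = i 0 then ident C ?a else if x = i 1 then ident C ?b else if x = i 2 then ident C ?c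
       else if x = i 3 then f else g)\<rparr>"
  have small: "small_category U ?J"
    unfolding small_category_def using category_span_shape[OF i] strongly_inaccessible_finite[OF U]
    by (auto simp: span_shape_def)
  have "is_functor ?J C ?F"
    unfolding is_functor_def using f g fg ob
    by (auto simp: span_shape_def hom_def lessThan_3_5 inj_eq[OF i] split: if_splits)
  with small cpl obtain L k where L: "is_colimit ?J C ?F L k" unfolding cocomplete_def by blast
  have cocone: "is_cocone ?J C ?F M m \<longleftrightarrow> m (i 0) \<in> hom C ?a M \<and> m (i 1) \<in> hom C ?b M \<and> m (i 2) \<in> hom C ?c M \<and>
      m (i 1) \<cdot> f = m (i 0) \<and> m (i 2) \<cdot> g = m (i 0)" for M m
    unfolding is_cocone_def using f g fg ob
    by (auto simp: span_shape_def hom_def lessThan_3_5 inj_eq[OF i])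
  have Lk: "k (i 1) \<in> hom C ?b L" "k (i 2) \<in> hom C ?c L" "k (i 1) \<cdot> f = k (i 0)" "k (i 2) \<cdot> g = k (i 0)"
    using L unfolding is_colimit_def cocone by auto
  show thesis
  proof (rule that[of "k (i 1)" "k (i 2)"])
    have univ: "\<exists>!h. h \<in> hom C L z \<and> h \<cdot> k (i 1) = u \<and> h \<cdot> k (i 2) = v"
      if uv: "u \<in> hom C ?b z" "v \<in> hom C ?c z" "u \<cdot> f = v \<cdot> g" for z u v
    proof -
      let ?m = "\<lambda>x. if x = i 1 then u else if x = i 2 then v else u \<cdot> f"
      have "is_cocone ?J C ?F z ?m"
        unfolding cocone using uv f g fg by (auto simp: inj_eq[OF i] hom_iff)
      with L have *: "\<exists>!h. h \<in> hom C L z \<and> (\<forall>j \<in> Obj ?J. h \<cdot> k j = ?m j)"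
        unfolding is_colimit_def by blast
      \<comment> \<open>Dually, the leg from the corner of the span is the first leg precomposed
        with \<open>f\<close> and imposes nothing new.\<close>
      have "(\<forall>j \<in> Obj ?J. h \<cdot> k j = ?m j) \<longleftrightarrow> h \<cdot> k (i 1) = u \<and> h \<cdot> k (i 2) = v" if "h \<in> hom C L z" for h
      proof -
        have "h \<cdot> k (i 0) = (h \<cdot> k (i 1)) \<cdot> f" unfolding Lk(3)[symmetric]
          using that Lk f by (intro assoc_comp[symmetric]) (auto simp: hom_iff)
        then show ?thesis by (auto simp: span_shape_def lessThan_3_5 inj_eq[OF i])
      qed
      then show ?thesis using * by (smt (verit, del_insts))
    qed
    have "Cod C (k (i 1)) = L" using Lk(1) by (simp add: hom_iff)
    with univ show "is_pushout C f g (k (i 1)) (k (i 2))"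
      unfolding is_pushout_def using f g fg Lk[unfolded hom_iff] by (intro conjI) simp_all
  qed
qed

text \<open>The retract argument: factor \<open>p\<close> into a cofibration \<open>i\<close> and an
  acyclic fibration \<open>r\<close>. Lifting \<open>i\<close> against \<open>p\<close>, with the
  identity on top and \<open>r\<close> below, makes \<open>p\<close> a retract of
  \<open>r\<close>.\<close>

lemma (in model_category) acyclic_fib_if_lifts:
  assumes p: "p \<in> Arr C" and l: "\<And>i. i \<in> cof M \<Longrightarrow> lifts C i p"
  shows "p \<in> fib M \<inter> weq M"
proof -
  obtain z i r where i: "i \<in> hom C (Dom C p) z" "i \<in> cof M" and r: "r \<in> hom C z (Cod C p)" "r \<in> fib M \<inter> weq M"
    and eq: "p = r \<cdot> i"
    using factor_acyclic_fib[OF Arr_hom[OF p]] by blast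
  note ty = i(1)[unfolded hom_iff] r(1)[unfolded hom_iff]
  have "p \<cdot> ident C (Dom C p) = r \<cdot> i" using p eq by simp
  moreover have "ident C (Dom C p) \<in> hom C (Dom C i) (Dom C p)" "r \<in> hom C (Cod C i) (Cod C p)"
    using ty p by (simp_all add: hom_iff)
  ultimately have "\<exists>h \<in> hom C (Cod C i) (Dom C p). h \<cdot> i = ident C (Dom C p) \<and> p \<cdot> h = r"
    using l[OF i(2)] unfolding lifts_def by blast
  then obtain h where h: "h \<in> hom C z (Dom C p)" "h \<cdot> i = ident C (Dom C p)" "p \<cdot> h = r"
    using ty by auto
  have "retract_of C p r"
    unfolding retract_of_def
  proof (intro conjI bexI)
    show "r \<cdot> i = ident C (Cod C p) \<cdot> p" using p eq by simp
    show "p \<cdot> h = ident C (Cod C p) \<cdot> r" using h ty by simp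
  qed (use h ty p in \<open>auto simp: hom_iff\<close>)
  then show ?thesis using fib_retract weq_retract r(2) by blast
qed

text \<open>A lifting problem against the fibration from \<open>y\<close> to a terminal object,
  where the square commutes automatically.\<close>

lemma (in model_category) fibrant_extension:
  assumes "fibrant C M y" "j \<in> cof M \<inter> weq M" "m \<in> hom C (Dom C j) y"
  obtains n where "n \<in> hom C (Cod C j) y" "n \<cdot> j = m"
proof -
  obtain t e where t: "terminal C t" "e \<in> hom C y t" "e \<in> fib M"
    using assms(1) by (auto simp: fibrant_def)
  have j: "j \<in> Arr C" using assms(2) cof_Arr by auto
  obtain v where v: "v \<in> hom C (Cod C j) t" using t(1) j unfolding terminal_def by (meson Cod_Obj)
  have "e \<cdot> m \<in> hom C (Dom C j) t" "v \<cdot> j \<in> hom C (Dom C j) t"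
    using t v j assms(3) by (auto simp: hom_iff)
  moreover have "\<exists>!k. k \<in> hom C (Dom C j) t" using t(1) j by (simp add: terminal_def)
  ultimately have "e \<cdot> m = v \<cdot> j" by blast
  moreover have "Dom C e = y" "Cod C e = t" using t(2) by (auto simp: hom_iff)
  ultimately have "\<exists>n \<in> hom C (Cod C j) y. n \<cdot> j = m \<and> e \<cdot> n = v"
    using acyclic_cof_lifts[OF assms(2) t(3)] assms(3) v unfolding lifts_def by blast
  then show thesis using that by blast
qed

section \<open>Consequences of the pushout-product axiom\<close>

context symmetric_monoidal_model_category
begin

text \<open>\<open>m1\<close> and \<open>m2\<close> glue to a map on the source of the
  pushout-product of \<open>i\<close> and \<open>g\<close>. This pushout-product is an acyclic
  cofibration since \<open>g\<close> is one, so the glued map extends to the fibrant object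
  \<open>y\<close>.\<close>

lemma pushout_product_extension:
  assumes U: "strongly_inaccessible U" and i: "i \<in> cof M" and g: "g \<in> cof M \<inter> weq M" and y: "fibrant E M y"
    and m1: "m1 \<in> hom E (Cod E i \<otimes> Dom E g) y" and m2: "m2 \<in> hom E (Dom E i \<otimes> Cod E g) y"
    and eq: "m1 \<cdot> (i \<odot> ident E (Dom E g)) = m2 \<cdot> (ident E (Dom E i) \<odot> g)"
  obtains n where "n \<in> hom E (Cod E i \<otimes> Cod E g) y" "n \<cdot> (ident E (Cod E i) \<odot> g) = m1"
    "n \<cdot> (i \<odot> ident E (Cod E g)) = m2"
proof -
  have A: "i \<in> Arr E" "g \<in> Arr E" using i g cof_Arr by auto
  let ?f = "i \<odot> ident E (Dom E g)" and ?g = "ident E (Dom E i) \<odot> g"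
  obtain p q where po: "is_pushout E ?f ?g p q"
    by (rule pushout_exists[OF U cocomplete, of ?f ?g]) (use A in auto)
  note pq = po[unfolded is_pushout_def]
  have univ: "\<exists>!h. h \<in> hom E (Cod E p) z \<and> h \<cdot> p = u \<and> h \<cdot> q = v"
    if "u \<in> hom E (Cod E i \<otimes> Dom E g) z" "v \<in> hom E (Dom E i \<otimes> Cod E g) z" "u \<cdot> ?f = v \<cdot> ?g" for z u v
  proof -
    have "Cod E ?f = Cod E i \<otimes> Dom E g" "Cod E ?g = Dom E i \<otimes> Cod E g" using A by auto
    with pq that show ?thesis by metis
  qed
  obtain h where h: "h \<in> hom E (Cod E p) (Cod E i \<otimes> Cod E g)"
    "h \<cdot> p = ident E (Cod E i) \<odot> g" "h \<cdot> q = i \<odot> ident E (Cod E g)"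
    using univ[of "ident E (Cod E i) \<odot> g" "Cod E i \<otimes> Cod E g" "i \<odot> ident E (Cod E g)"] A
    by (auto simp: hom_iff interchange_law)
  have "h \<in> cof M \<inter> weq M"
    using pushout_product i g po h unfolding pushout_product_axiom_def by blast
  moreover obtain m where m: "m \<in> hom E (Cod E p) y" "m \<cdot> p = m1" "m \<cdot> q = m2"
    using univ[OF m1 m2 eq] by blast
  moreover have "Dom E h = Cod E p" using h by (simp add: hom_iff)
  ultimately obtain n where n: "n \<in> hom E (Cod E h) y" "n \<cdot> h = m"
    using fibrant_extension[OF y, of h m] by metis
  show thesis
  proof (rule that)
    have ty: "n \<in> Arr E" "Dom E n = Cod E h" "h \<in> Arr E" "p \<in> Arr E" "q \<in> Arr E" "Dom E h = Cod E p" "Cod E q = Cod E p"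
      using n h pq by (auto simp: hom_iff)
    show "n \<in> hom E (Cod E i \<otimes> Cod E g) y" using n h by (auto simp: hom_iff)
    show "n \<cdot> (ident E (Cod E i) \<odot> g) = m1"
      unfolding h(2)[symmetric] using ty n(2) m(2) assoc_comp[of p h n] by simp
    show "n \<cdot> (i \<odot> ident E (Cod E g)) = m2"
      unfolding h(3)[symmetric] using ty n(2) m(3) assoc_comp[of q h n] by simp
  qed
qed

text \<open>Tensoring is a left adjoint: maps out of \<open>z \<otimes> a\<close> correspond to maps
  from \<open>z\<close> to an internal hom, of which there is exactly one. The symmetry transfers
  this to \<open>a \<otimes> z\<close>.\<close>

lemma initial_tensor:
  assumes "initial E z" "a \<in> Obj E"
  shows "initial E (a \<otimes> z)"
proof -
  have z: "z \<in> Obj E" using assms by (simp add: initial_def)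
  have "\<exists>!h. h \<in> hom E (a \<otimes> z) x" if x: "x \<in> Obj E" for x
  proof -
    obtain k where k: "k \<in> hom E z (ihom E a x)" and uk: "\<And>k'. k' \<in> hom E z (ihom E a x) \<Longrightarrow> k' = k"
      using assms x unfolding initial_def by (metis ihom_Obj)
    show ?thesis
    proof (rule ex1I)
      show "(ev E a x \<cdot> (k \<odot> ident E a)) \<cdot> symm E a z \<in> hom E (a \<otimes> z) x"
        using k z assms x by (auto simp: hom_iff)
      fix h assume h: "h \<in> hom E (a \<otimes> z) x"
      have "h \<cdot> symm E z a \<in> hom E (z \<otimes> a) x" using h z assms by (auto simp: hom_iff)
      then obtain k' where k': "k' \<in> hom E z (ihom E a x)" "ev E a x \<cdot> (k' \<odot> ident E a) = h \<cdot> symm E z a"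
        using ev_universal[OF z assms(2) x] by blast
      have "h = (h \<cdot> symm E z a) \<cdot> symm E a z" using h z assms by (simp add: hom_iff assoc_comp)
      then show "h = (ev E a x \<cdot> (k \<odot> ident E a)) \<cdot> symm E a z" using k'(2) uk[OF k'(1)] by simp
    qed
  qed
  then show ?thesis using z assms by (simp add: initial_def)
qed

text \<open>The pushout-product axiom for \<open>i\<close> and the map \<open>g\<close> from an
  initial object to \<open>x\<close>. The pushout is \<open>Dom E i \<otimes> x\<close>, because the
  two corners involving the initial object are themselves initial.\<close>

lemma cof_tensor:
  assumes i: "i \<in> cof M" and x: "cofibrant E M x"
  shows "i \<odot> ident E x \<in> cof M"
proof -
  obtain z g where z: "initial E z" and g: "g \<in> hom E z x" "g \<in> cof M"
    using x by (auto simp: cofibrant_def)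
  have A: "i \<in> Arr E" "g \<in> Arr E" "Dom E g = z" "Cod E g = x" "z \<in> Obj E" "x \<in> Obj E"
    using i g x cof_Arr z by (auto simp: hom_iff initial_def cofibrant_def)
  let ?f = "i \<odot> ident E (Dom E g)" and ?g = "ident E (Dom E i) \<odot> g"
  have unique: "u = v" if "a \<in> Obj E" "u \<in> hom E (a \<otimes> z) t" "v \<in> hom E (a \<otimes> z) t" "t \<in> Obj E" for a u v t
    using initial_tensor[OF z that(1)] that unfolding initial_def by blast
  obtain p where p: "p \<in> hom E (Cod E i \<otimes> z) (Dom E i \<otimes> x)"
    using initial_tensor[OF z, of "Cod E i"] A unfolding initial_def by (metis Cod_Obj Dom_Obj tensor_Obj)
  note pt = p[unfolded hom_iff]
  let ?q = "ident E (Dom E i \<otimes> x)"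
  \<comment> \<open>\<open>g\<close> starts in an initial object, and tensoring preserves initial objects\<close>
  have "is_pushout E ?f ?g p ?q"
    unfolding is_pushout_def
  proof (intro conjI allI ballI impI)
    show "p \<cdot> ?f = ?q \<cdot> ?g"
      by (rule unique[of "Dom E i" _ "Dom E i \<otimes> x"]) (use A pt in \<open>auto simp: hom_iff\<close>)
    fix t u v
    assume u: "u \<in> hom E (Cod E ?f) t" and v: "v \<in> hom E (Cod E ?g) t" and "u \<cdot> ?f = v \<cdot> ?g"
    show "\<exists>!h. h \<in> hom E (Cod E p) t \<and> h \<cdot> p = u \<and> h \<cdot> ?q = v"
    proof (rule ex1I[of _ v])
      have "v \<cdot> p = u"
        by (rule unique[of "Cod E i" _ t]) (use A pt u v in \<open>auto simp: hom_iff\<close>)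
      then show "v \<in> hom E (Cod E p) t \<and> v \<cdot> p = u \<and> v \<cdot> ?q = v"
        using A pt v by (auto simp: hom_iff)
    qed (use A pt in \<open>auto simp: hom_iff\<close>)
  qed (use A pt in auto)
  moreover have "(i \<odot> ident E x) \<cdot> p = ident E (Cod E i) \<odot> g"
    by (rule unique[of "Cod E i" _ "Cod E i \<otimes> x"]) (use A pt in \<open>auto simp: hom_iff\<close>)
  ultimately show ?thesis
    using pushout_product[unfolded pushout_product_axiom_def, rule_format, OF i g(2), of p ?q "i \<odot> ident E x"] A pt
    by (auto simp: hom_iff)
qed

end

section \<open>Lifting algebra structures\<close>

context closed_symmetric_monoidal_category
begin

lemma prop_map_comp:
  assumes P: "colored_PROP E CC P" and \<phi>: "is_prop_map E CC P F \<phi>" and \<psi>: "is_prop_map E CC F Z \<psi>"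
    and F: "colored_PROP E CC F" and Z: "colored_PROP E CC Z"
  shows "is_prop_map E CC P Z (\<lambda>d c. if d \<in> profiles CC \<and> c \<in> profiles CC then \<psi> d c \<cdot> \<phi> d c else undefined)"
proof -
  interpret \<phi>: PROP_map E CC P F \<phi>
    by (rule PROP_map_if_prop_map) fact+
  interpret \<psi>: PROP_map E CC F Z \<psi>
    by (rule PROP_map_if_prop_map) fact+
  have act: "(\<psi> (lact \<sigma> d) (ract c \<tau>) \<cdot> \<phi> (lact \<sigma> d) (ract c \<tau>)) \<cdot> act P \<sigma> \<tau> d c = act Z \<sigma> \<tau> d c \<cdot> \<psi> d c \<cdot> \<phi> d c"
    if p: "d \<in> profiles CC" "c \<in> profiles CC" "\<sigma> permutes {..<length d}" "\<tau> permutes {..<length c}" for d c \<sigma> \<tau>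
  proof -
    have "(\<psi> (lact \<sigma> d) (ract c \<tau>) \<cdot> \<phi> (lact \<sigma> d) (ract c \<tau>)) \<cdot> act P \<sigma> \<tau> d c =
      (\<psi> (lact \<sigma> d) (ract c \<tau>) \<cdot> act F \<sigma> \<tau> d c) \<cdot> \<phi> d c"
      using p by (simp add: assoc_comp \<phi>.\<phi>_act)
    then show ?thesis using p by (simp add: assoc_comp \<psi>.\<phi>_act)
  qed
  have vcomp: "(\<psi> d c \<cdot> \<phi> d c) \<cdot> vcomp P d b c = vcomp Z d b c \<cdot> ((\<psi> d b \<cdot> \<phi> d b) \<odot> (\<psi> b c \<cdot> \<phi> b c))"
    if p: "d \<in> profiles CC" "b \<in> profiles CC" "c \<in> profiles CC" for d b c
    using p by (simp add: fuse \<phi>.\<phi>_vcomp \<psi>.\<phi>_vcomp2)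
  have hcomp: "(\<psi> (d1 @ d2) (c1 @ c2) \<cdot> \<phi> (d1 @ d2) (c1 @ c2)) \<cdot> hcomp P d1 c1 d2 c2 =
      hcomp Z d1 c1 d2 c2 \<cdot> ((\<psi> d1 c1 \<cdot> \<phi> d1 c1) \<odot> (\<psi> d2 c2 \<cdot> \<phi> d2 c2))"
    if p: "d1 \<in> profiles CC" "c1 \<in> profiles CC" "d2 \<in> profiles CC" "c2 \<in> profiles CC" for d1 c1 d2 c2
    using p by (simp add: fuse \<phi>.\<phi>_hcomp \<psi>.\<phi>_hcomp2)
  show ?thesis
    unfolding is_prop_map_def using act vcomp hcomp by (auto simp: hom_iff)
qed

lemma PROP_cat_hom:
  "F \<in> hom (PROP_cat E CC) P Z \<longleftrightarrow>
    (\<exists>\<phi>. F = (P, \<phi>, Z) \<and> colored_PROP E CC P \<and> colored_PROP E CC Z \<and> is_prop_map E CC P Z \<phi>)"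
  by (auto simp: hom_def PROP_cat_def)

lemma PROP_cat_comp:
  "comp (PROP_cat E CC) (F', \<psi>, Z) (P, \<phi>, F) =
    (P, \<lambda>d c. if d \<in> profiles CC \<and> c \<in> profiles CC then \<psi> d c \<cdot> \<phi> d c else undefined, Z)"
  by (simp add: PROP_cat_def)

lemma PROP_cat_comp_hom:
  "f \<in> hom (PROP_cat E CC) P F \<Longrightarrow> g \<in> hom (PROP_cat E CC) F Z \<Longrightarrow>
    comp (PROP_cat E CC) g f \<in> hom (PROP_cat E CC) P Z"
  by (auto simp: PROP_cat_hom PROP_cat_comp intro: prop_map_comp)

text \<open>Cofibrancy of \<open>P\<close> provides a map from an initial PROP that has the lifting
  property by which \<open>PROP_model\<close> defines \<open>cof\<close>. The square with
  \<open>\<alpha>\<close> below and \<open>\<pi>\<close> on the right commutes by initiality, and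
  its diagonal is the required lift.\<close>

lemma cofibrant_PROP_lift:
  fixes CC :: "'c set"
  assumes P: "cofibrant (PROP_cat E CC) (PROP_model E CC M) P"
    and \<alpha>: "(P, \<alpha>, Z) \<in> hom (PROP_cat E CC) P Z" and \<pi>: "(F, \<pi>, Z) \<in> hom (PROP_cat E CC) F Z"
    and af: "\<And>d c. d \<in> profiles CC \<Longrightarrow> c \<in> profiles CC \<Longrightarrow> \<pi> d c \<in> fib M \<inter> weq M"
  obtains \<beta> where "(P, \<beta>, F) \<in> hom (PROP_cat E CC) P F"
    "\<And>d c. d \<in> profiles CC \<Longrightarrow> c \<in> profiles CC \<Longrightarrow> \<pi> d c \<cdot> \<beta> d c = \<alpha> d c"
proof -
  let ?C = "PROP_cat E CC"
  have sel: "Dom ?C (A, \<gamma>, B) = A" "Cod ?C (A, \<gamma>, B) = B" for A B \<gamma> by (auto simp: PROP_cat_def)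
  obtain z g where z: "initial ?C z" and g: "g \<in> hom ?C z P" and gc: "g \<in> cof (PROP_model E CC M)"
    using P by (auto simp: cofibrant_def)
  have "(F, \<pi>, Z) \<in> Arr ?C" using \<pi> by (simp add: hom_def)
  then have "(F, \<pi>, Z) \<in> PROP_fib E CC M \<inter> PROP_weq E CC M"
    using af by (auto simp: PROP_fib_def PROP_weq_def)
  then have l: "lifts ?C g (F, \<pi>, Z)" using gc by (simp add: PROP_model_def)
  have F: "F \<in> Obj ?C" "Z \<in> Obj ?C" using \<pi> by (auto simp: PROP_cat_hom) (auto simp: PROP_cat_def)
  obtain u where u: "u \<in> hom ?C z F" using z F unfolding initial_def by blast
  have "comp ?C (F, \<pi>, Z) u \<in> hom ?C z Z" "comp ?C (P, \<alpha>, Z) g \<in> hom ?C z Z"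
    using PROP_cat_comp_hom[OF u \<pi>] PROP_cat_comp_hom[OF g \<alpha>] by auto
  moreover have "\<exists>!k. k \<in> hom ?C z Z" using z F by (simp add: initial_def)
  ultimately have "comp ?C (F, \<pi>, Z) u = comp ?C (P, \<alpha>, Z) g" by blast
  moreover have "Dom ?C g = z" "Cod ?C g = P" using g by (auto simp: hom_def)
  ultimately have "\<exists>h \<in> hom ?C P F. comp ?C (F, \<pi>, Z) h = (P, \<alpha>, Z)"
    using l u \<alpha> unfolding lifts_def sel by blast
  then obtain \<beta> where \<beta>: "(P, \<beta>, F) \<in> hom ?C P F" "comp ?C (F, \<pi>, Z) (P, \<beta>, F) = (P, \<alpha>, Z)"
    by (auto simp: PROP_cat_hom)
  then show thesis
    by (intro that[of \<beta>]) (auto simp: PROP_cat_comp dest: fun_cong)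
qed

end

section \<open>Existence of the pullback PROP and its acyclic projections\<close>

locale model_family = symmetric_monoidal_model_category U E M + tensor_family E CC X Y f
  for U :: "'u rel" and E :: "('o, 'a) smc" (structure) and M :: "'a model_str" and CC :: "'c set"
    and X Y f +
  assumes inaccessible: "strongly_inaccessible U"
begin

text \<open>\<open>?k1\<close> is postcomposition and \<open>?k2\<close> precomposition with the
  tensor products of \<open>f\<close>, as maps of internal homs into \<open>?K\<close>. Uncurrying
  identifies commutation of a cone over this cospan with \<open>compat\<close>.\<close>

lemma compat_pullback:
  assumes p: "d \<in> profiles CC" "c \<in> profiles CC"
  shows "\<exists>w u v. Dom E u = w \<and> compat d c u v \<and> (\<forall>u' v'. compat d c u' v' \<longrightarrow>
    (\<exists>!h. h \<in> hom E (Dom E u') w \<and> u \<cdot> h = u' \<and> v \<cdot> h = v'))"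
proof -
  let ?k1 = "curry_arr E (X.H d c) (X.T c) (Y.T d) (ft d \<cdot> ev E (X.T c) (X.T d))"
  let ?k2 = "curry_arr E (Y.H d c) (X.T c) (Y.T d) (ev E (Y.T c) (Y.T d) \<cdot> (ident E (Y.H d c) \<odot> ft c))"
  let ?K = "ihom E (X.T c) (Y.T d)"
  have k1: "?k1 \<in> Arr E" "Dom E ?k1 = X.H d c" "Cod E ?k1 = ?K"
    "ev E (X.T c) (Y.T d) \<cdot> (?k1 \<odot> ident E (X.T c)) = ft d \<cdot> ev E (X.T c) (X.T d)"
    using p by (auto intro!: curry_typed)
  have k2: "?k2 \<in> Arr E" "Dom E ?k2 = Y.H d c" "Cod E ?k2 = ?K"
    "ev E (X.T c) (Y.T d) \<cdot> (?k2 \<odot> ident E (X.T c)) = ev E (Y.T c) (Y.T d) \<cdot> (ident E (Y.H d c) \<odot> ft c)"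
    using p by (auto intro!: curry_typed)
  have compat: "compat d c u v \<longleftrightarrow> u \<in> hom E w (X.H d c) \<and> v \<in> hom E w (Y.H d c) \<and> ?k1 \<cdot> u = ?k2 \<cdot> v"
    if w: "Dom E u = w" for u v w
  proof (cases "u \<in> hom E w (X.H d c) \<and> v \<in> hom E w (Y.H d c)")
    case True
    then have uv: "u \<in> Arr E" "v \<in> Arr E" "Cod E u = X.H d c" "Cod E v = Y.H d c" "Dom E u = w" "Dom E v = w"
      by (auto simp: hom_iff)
    have 1: "ev E (X.T c) (Y.T d) \<cdot> ((?k1 \<cdot> u) \<odot> ident E (X.T c)) = ft d \<cdot> X.unc d c u"
    proof -
      have "ev E (X.T c) (Y.T d) \<cdot> ((?k1 \<cdot> u) \<odot> ident E (X.T c)) =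
        (ev E (X.T c) (Y.T d) \<cdot> (?k1 \<odot> ident E (X.T c))) \<cdot> (u \<odot> ident E (X.T c))"
        using p uv k1(1-3) by (simp add: fuse)
      then show ?thesis unfolding k1(4) using p uv by (simp add: X.unc_def assoc_comp)
    qed
    have 2: "ev E (X.T c) (Y.T d) \<cdot> ((?k2 \<cdot> v) \<odot> ident E (X.T c)) = Y.unc d c v \<cdot> (ident E w \<odot> ft c)"
    proof -
      have "ev E (X.T c) (Y.T d) \<cdot> ((?k2 \<cdot> v) \<odot> ident E (X.T c)) =
        (ev E (X.T c) (Y.T d) \<cdot> (?k2 \<odot> ident E (X.T c))) \<cdot> (v \<odot> ident E (X.T c))"
        using p uv k2(1-3) by (simp add: fuse)
      then show ?thesis unfolding k2(4) using p uv by (auto simp: Y.unc_def fuse)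
    qed
    have "?k1 \<cdot> u = ?k2 \<cdot> v \<longleftrightarrow> ft d \<cdot> X.unc d c u = Y.unc d c v \<cdot> (ident E w \<odot> ft c)"
    proof
      assume "ft d \<cdot> X.unc d c u = Y.unc d c v \<cdot> (ident E w \<odot> ft c)"
      then have e: "ev E (X.T c) (Y.T d) \<cdot> ((?k1 \<cdot> u) \<odot> ident E (X.T c)) =
          ev E (X.T c) (Y.T d) \<cdot> ((?k2 \<cdot> v) \<odot> ident E (X.T c))"
        unfolding 1 2 .
      show "?k1 \<cdot> u = ?k2 \<cdot> v"
        by (rule ev_cancel[OF e]) (use p uv k1(1-3) k2(1-3) in auto)
    qed (use 1 2 in auto)
    then show ?thesis using True uv by (simp add: compat_def)
  next
    case False
    then show ?thesis using w by (auto simp: compat_def hom_iff)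
  qed
  obtain w u v where uv: "u \<in> hom E w (X.H d c)" "v \<in> hom E w (Y.H d c)" "?k1 \<cdot> u = ?k2 \<cdot> v"
    and univ: "\<And>z u' v'. u' \<in> hom E z (X.H d c) \<Longrightarrow> v' \<in> hom E z (Y.H d c) \<Longrightarrow> ?k1 \<cdot> u' = ?k2 \<cdot> v' \<Longrightarrow>
      \<exists>!h. h \<in> hom E z w \<and> u \<cdot> h = u' \<and> v \<cdot> h = v'"
    by (rule pullback_exists[OF inaccessible complete, of ?k1 "X.H d c" ?K ?k2 "Y.H d c"])
      (use k1 k2 in \<open>auto simp: hom_iff\<close>)
  have w: "Dom E u = w" using uv by (simp add: hom_iff)
  show ?thesis
  proof (intro exI conjI allI impI)
    show "compat d c u v" using compat[OF w] uv by blast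
    fix u' v' assume "compat d c u' v'"
    then show "\<exists>!h. h \<in> hom E (Dom E u') w \<and> u \<cdot> h = u' \<and> v \<cdot> h = v'"
      unfolding compat[OF refl] by (intro univ) auto
  qed (rule w)
qed

text \<open>Pullbacks are chosen at once for all pairs of profiles; \<open>?r\<close> then resets
  the projections to \<open>undefined\<close> elsewhere.\<close>

lemma morphism_PROP_exists: "\<exists>R p q. morphism_PROP E CC X Y f R p q"
proof -
  define B where "B d c t \<longleftrightarrow> (case t of (w, u, v) \<Rightarrow> Dom E u = w \<and> compat d c u v \<and>
      (\<forall>u' v'. compat d c u' v' \<longrightarrow> (\<exists>!h. h \<in> hom E (Dom E u') w \<and> u \<cdot> h = u' \<and> v \<cdot> h = v')))" for d c t
  define t where "t d c = (SOME t. B d c t)" for d c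
  define R where "R d c = fst (t d c)" for d c
  define p where "p d c = fst (snd (t d c))" for d c
  define q where "q d c = snd (snd (t d c))" for d c
  have "\<exists>t. B d c t" if "d \<in> profiles CC" "c \<in> profiles CC" for d c
    using compat_pullback[OF that] by (simp add: B_def)
  then have "B d c (R d c, p d c, q d c)" if "d \<in> profiles CC" "c \<in> profiles CC" for d c
    using someI_ex[of "B d c"] that by (simp add: R_def p_def q_def t_def)
  then have *: "Dom E (p d c) = R d c" "compat d c (p d c) (q d c)"
      "compat d c u' v' \<Longrightarrow> \<exists>!h. h \<in> hom E (Dom E u') (R d c) \<and> p d c \<cdot> h = u' \<and> q d c \<cdot> h = v'"
    if "d \<in> profiles CC" "c \<in> profiles CC" for d c u' v'
    using that unfolding B_def by auto
  let ?r = "\<lambda>(k :: 'c list \<Rightarrow> 'c list \<Rightarrow> 'a) d c. if d \<in> profiles CC \<and> c \<in> profiles CC then k d c else undefined"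
  have "morphism_PROP E CC X Y f R (?r p) (?r q)"
    by (intro morphism_PROP.intro morphism_PROP_axioms.intro tensor_family_axioms) (simp_all add: *, blast)
  then show ?thesis by blast
qed

end

locale model_morphism_PROP = model_family U E M CC X Y f + morphism_PROP E CC X Y f R p q
  for U :: "'u rel" and E :: "('o, 'a) smc" (structure) and M :: "'a model_str" and CC :: "'c set"
    and X Y f R p q
begin

text \<open>A lift has two components, and the one for \<open>X\<close> must be \<open>v\<close>.
  The one for \<open>Y\<close>, uncurried, is a map \<open>n\<close> on
  \<open>Cod E i \<otimes> Y_c\<close> that is prescribed along \<open>f_c\<close> by compatibility
  with \<open>v\<close> and along \<open>i\<close> by agreement with \<open>u\<close>. These are the
  data of an extension along the pushout-product of \<open>i\<close> and \<open>f_c\<close>.\<close>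

lemma p_acyclic_fib:
  assumes pr: "d \<in> profiles CC" "c \<in> profiles CC"
    and y: "fibrant E M (Y.T d)" and fc: "ft c \<in> cof M \<inter> weq M"
  shows "p d c \<in> fib M \<inter> weq M"
proof (rule acyclic_fib_if_lifts)
  fix i assume i: "i \<in> cof M"
  then have iA: "i \<in> Arr E" using cof_Arr by auto
  show "lifts E i (p d c)"
    unfolding lifts_def
  proof (intro ballI impI)
    fix u v assume "u \<in> hom E (Dom E i) (Dom E (p d c))" "v \<in> hom E (Cod E i) (Cod E (p d c))"
      and sq: "p d c \<cdot> u = v \<cdot> i"
    then have u: "u \<in> Arr E" "Dom E u = Dom E i" "Cod E u = R d c"
      and v: "v \<in> Arr E" "Dom E v = Cod E i" "Cod E v = X.H d c"
      using pr by (auto simp: hom_iff)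
    let ?A = "Dom E i" and ?B = "Cod E i"
    let ?m1 = "ft d \<cdot> X.unc d c v" and ?m2 = "Y.unc d c (q d c \<cdot> u)"
    have cu: "compat d c (v \<cdot> i) (q d c \<cdot> u)"
      unfolding sq[symmetric] using pr u by (intro compat_comp compat_pq) auto
    have "?m1 \<cdot> (i \<odot> ident E (X.T c)) = ft d \<cdot> X.unc d c (v \<cdot> i)"
      using pr u v iA by (simp add: X.unc_comp assoc_comp)
    \<comment> \<open>The prescriptions agree on \<open>Dom E i \<otimes> X_c\<close> because the
      two components of \<open>u\<close> are compatible.\<close>
    also have "\<dots> = ?m2 \<cdot> (ident E ?A \<odot> ft c)" using compatD(6)[OF cu] pr u by simp
    finally have eq: "?m1 \<cdot> (i \<odot> ident E (X.T c)) = ?m2 \<cdot> (ident E ?A \<odot> ft c)" .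
    obtain n where n: "n \<in> hom E (?B \<otimes> Y.T c) (Y.T d)" "n \<cdot> (ident E ?B \<odot> ft c) = ?m1"
        "n \<cdot> (i \<odot> ident E (Y.T c)) = ?m2"
      using pushout_product_extension[OF inaccessible i fc y, of ?m1 ?m2] eq pr u v iA
      by (auto simp: hom_iff)
    let ?w = "curry_arr E ?B (Y.T c) (Y.T d) n"
    have w: "?w \<in> Arr E" "Dom E ?w = ?B" "Cod E ?w = Y.H d c" "Y.unc d c ?w = n"
      using curry_typed[of ?B "Y.T c" "Y.T d" n] n pr iA by (auto simp: hom_iff Y.unc_def)
    have vw: "compat d c v ?w" using v w n by (simp add: compat_def)
    note h = into_typed[OF pr vw]
    have hA: "into d c v ?w \<in> Arr E" "Dom E (into d c v ?w) = ?B" "Cod E (into d c v ?w) = R d c"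
      using h(1) v by (auto simp: hom_iff)
    have wi: "?w \<cdot> i = q d c \<cdot> u"
      by (rule Y.unc_cancel[OF pr, of _ ?A]) (use pr u w iA n in \<open>auto simp: hom_iff Y.unc_comp\<close>)
    have "into d c v ?w \<cdot> i = u"
    proof (rule pq_jointly_monic[OF pr, of _ ?A])
      show "p d c \<cdot> into d c v ?w \<cdot> i = p d c \<cdot> u"
        using assoc_comp[of i "into d c v ?w" "p d c"] hA iA pr h(2) sq by simp
      show "q d c \<cdot> into d c v ?w \<cdot> i = q d c \<cdot> u"
        using assoc_comp[of i "into d c v ?w" "q d c"] hA iA pr h(3) wi by simp
    qed (use hA iA u in \<open>auto simp: hom_iff\<close>)
    then show "\<exists>h \<in> hom E ?B (Dom E (p d c)). h \<cdot> i = u \<and> p d c \<cdot> h = v"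
      using h v pr by (intro bexI[of _ "into d c v ?w"]) auto
  qed
qed (use pr in auto)

text \<open>Now the component of the lift for \<open>Y\<close> must be \<open>v\<close>, and the one
  for \<open>X\<close>, uncurried, is a diagonal \<open>n\<close> between \<open>i\<close> tensored
  with \<open>X_c\<close> and \<open>f_d\<close>. Its upper triangle expresses agreement with
  \<open>u\<close>, its lower triangle compatibility with \<open>v\<close>.\<close>

lemma q_acyclic_fib:
  assumes pr: "d \<in> profiles CC" "c \<in> profiles CC"
    and x: "cofibrant E M (X.T c)" and fd: "ft d \<in> fib M \<inter> weq M"
  shows "q d c \<in> fib M \<inter> weq M"
proof (rule acyclic_fib_if_lifts)
  fix i assume i: "i \<in> cof M"
  then have iA: "i \<in> Arr E" using cof_Arr by auto
  show "lifts E i (q d c)"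
    unfolding lifts_def
  proof (intro ballI impI)
    fix u v assume "u \<in> hom E (Dom E i) (Dom E (q d c))" "v \<in> hom E (Cod E i) (Cod E (q d c))"
      and sq: "q d c \<cdot> u = v \<cdot> i"
    then have u: "u \<in> Arr E" "Dom E u = Dom E i" "Cod E u = R d c"
      and v: "v \<in> Arr E" "Dom E v = Cod E i" "Cod E v = Y.H d c"
      using pr by (auto simp: hom_iff)
    let ?A = "Dom E i" and ?B = "Cod E i"
    let ?m1 = "X.unc d c (p d c \<cdot> u)" and ?m2 = "Y.unc d c v \<cdot> (ident E ?B \<odot> ft c)"
    let ?j = "i \<odot> ident E (X.T c)"
    have cu: "compat d c (p d c \<cdot> u) (v \<cdot> i)"
      unfolding sq[symmetric] using pr u by (intro compat_comp compat_pq) auto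
    have "ft d \<cdot> ?m1 = Y.unc d c (v \<cdot> i) \<cdot> (ident E ?A \<odot> ft c)"
      using compatD(6)[OF cu] pr v iA by simp
    also have "\<dots> = ?m2 \<cdot> ?j" using pr v iA by (simp add: Y.unc_comp fuse)
    finally have eq: "ft d \<cdot> ?m1 = ?m2 \<cdot> ?j" .
    have m: "?m1 \<in> hom E (Dom E ?j) (Dom E (ft d))" "?m2 \<in> hom E (Cod E ?j) (Cod E (ft d))"
      using pr u v iA by (auto simp: hom_iff)
    obtain n where n: "n \<in> hom E (?B \<otimes> X.T c) (X.T d)" "n \<cdot> ?j = ?m1" "ft d \<cdot> n = ?m2"
      using cof_lifts[OF cof_tensor[OF i x] fd, unfolded lifts_def, rule_format, OF m eq] pr iA by auto
    let ?w = "curry_arr E ?B (X.T c) (X.T d) n"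
    have w: "?w \<in> Arr E" "Dom E ?w = ?B" "Cod E ?w = X.H d c" "X.unc d c ?w = n"
      using curry_typed[of ?B "X.T c" "X.T d" n] n pr iA by (auto simp: hom_iff X.unc_def)
    have vw: "compat d c ?w v" using v w n by (simp add: compat_def)
    note h = into_typed[OF pr vw]
    have hA: "into d c ?w v \<in> Arr E" "Dom E (into d c ?w v) = ?B" "Cod E (into d c ?w v) = R d c"
      using h(1) w by (auto simp: hom_iff)
    have wi: "?w \<cdot> i = p d c \<cdot> u"
      by (rule X.unc_cancel[OF pr, of _ ?A]) (use pr u w iA n in \<open>auto simp: hom_iff X.unc_comp\<close>)
    have "into d c ?w v \<cdot> i = u"
    proof (rule pq_jointly_monic[OF pr, of _ ?A])
      show "p d c \<cdot> into d c ?w v \<cdot> i = p d c \<cdot> u"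
        using assoc_comp[of i "into d c ?w v" "p d c"] hA iA pr h(2) wi by simp
      show "q d c \<cdot> into d c ?w v \<cdot> i = q d c \<cdot> u"
        using assoc_comp[of i "into d c ?w v" "q d c"] hA iA pr h(3) sq by simp
    qed (use hA iA u in \<open>auto simp: hom_iff\<close>)
    then show "\<exists>h \<in> hom E ?B (Dom E (q d c)). h \<cdot> i = u \<and> q d c \<cdot> h = v"
      using h w pr by (intro bexI[of _ "into d c ?w v"]) auto
  qed
qed (use pr in auto)

section \<open>Transport of algebra structures\<close>

lemma p_hom: "(PF, p, X.Q) \<in> hom (PROP_cat E CC) PF X.Q"
  and q_hom: "(PF, q, Y.Q) \<in> hom (PROP_cat E CC) PF Y.Q"
  using colored_PROP_PF X.colored_PROP_endo Y.colored_PROP_endo p_prop_map q_prop_map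
  by (auto simp: PROP_cat_hom)

lemma algebra_morphism_if_compat:
  assumes P: "colored_PROP E CC P"
    and c: "\<And>d c. d \<in> profiles CC \<Longrightarrow> c \<in> profiles CC \<Longrightarrow> compat d c (\<phi> d c) (\<psi> d c)"
    and \<phi>: "\<And>d c. d \<in> profiles CC \<Longrightarrow> c \<in> profiles CC \<Longrightarrow> Dom E (\<phi> d c) = entry P d c"
  shows "is_algebra_morphism E CC P X \<phi> Y \<psi> f"
  unfolding is_algebra_morphism_def
proof (intro conjI ballI)
  fix d c :: "'c list" assume p: "d \<in> profiles CC" "c \<in> profiles CC"
  note D = compatD[OF c[OF p]]
  have "tens_arr E f d \<cdot> alg_map E X \<phi> d c = ft d \<cdot> X.unc d c (\<phi> d c)"
    by (simp add: alg_map_def X.unc_def)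
  also have "\<dots> = alg_map E Y \<psi> d c \<cdot> (ident E (entry P d c) \<odot> ft c)"
    unfolding D(6) using \<phi>[OF p] D(3) by (simp add: alg_map_def Y.unc_def)
  finally show "tens_arr E f d \<cdot> alg_map E X \<phi> d c = alg_map E Y \<psi> d c \<cdot> (ident E (entry P d c) \<odot> tens_arr E f c)" .
qed (rule f_hom)

text \<open>The two projections form a compatible pair, and compatibility is stable under
  precomposition.\<close>

lemma lift_compat:
  assumes \<beta>: "(P, \<beta>, PF) \<in> hom (PROP_cat E CC) P PF" and pr: "d \<in> profiles CC" "c \<in> profiles CC"
  shows "compat d c (p d c \<cdot> \<beta> d c) (q d c \<cdot> \<beta> d c)" "Dom E (p d c \<cdot> \<beta> d c) = entry P d c"
proof -
  have b: "\<beta> d c \<in> Arr E" "Dom E (\<beta> d c) = entry P d c" "Cod E (\<beta> d c) = R d c"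
    using \<beta> pr by (auto simp: PROP_cat_hom is_prop_map_def hom_iff)
  show "compat d c (p d c \<cdot> \<beta> d c) (q d c \<cdot> \<beta> d c)"
    using pr b by (intro compat_comp compat_pq) auto
  show "Dom E (p d c \<cdot> \<beta> d c) = entry P d c" using pr b by simp
qed

text \<open>The lift \<open>\<beta>\<close> of \<open>\<phi>\<close> along \<open>p\<close> contains
  both structures, and composing it with \<open>q\<close> extracts the one on \<open>Y\<close>. That
  \<open>f\<close> is a morphism is the compatibility of the two components of
  \<open>\<beta>\<close>.\<close>

lemma algebra_pushforward:
  assumes P: "cofibrant (PROP_cat E CC) (PROP_model E CC M) P"
    and h: "\<And>c. c \<in> profiles CC \<Longrightarrow> fibrant E M (Y.T c) \<and> ft c \<in> cof M \<inter> weq M"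
    and \<phi>: "is_algebra E CC P X \<phi>"
  shows "\<exists>\<psi>. is_algebra E CC P Y \<psi> \<and> is_algebra_morphism E CC P X \<phi> Y \<psi> f"
proof -
  have \<phi>h: "(P, \<phi>, X.Q) \<in> hom (PROP_cat E CC) P X.Q" using \<phi> by (simp add: is_algebra_def)
  obtain \<beta> where \<beta>: "(P, \<beta>, PF) \<in> hom (PROP_cat E CC) P PF"
    "\<And>d c. d \<in> profiles CC \<Longrightarrow> c \<in> profiles CC \<Longrightarrow> p d c \<cdot> \<beta> d c = \<phi> d c"
    by (rule cofibrant_PROP_lift[OF P \<phi>h p_hom]) (use p_acyclic_fib h in blast)+
  \<comment> \<open>The value \<open>undefined\<close> makes this literally the middle component of
    the composite in \<open>PROP_cat\<close>.\<close>
  let ?\<psi> = "\<lambda>d c. if d \<in> profiles CC \<and> c \<in> profiles CC then q d c \<cdot> \<beta> d c else undefined"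
  have "is_algebra E CC P Y ?\<psi>"
    using PROP_cat_comp_hom[OF \<beta>(1) q_hom] XY_Obj by (simp add: is_algebra_def PROP_cat_comp)
  moreover have "is_algebra_morphism E CC P X \<phi> Y ?\<psi> f"
    using \<phi>h lift_compat[OF \<beta>(1)] \<beta>(2) by (intro algebra_morphism_if_compat) (auto simp: PROP_cat_hom)
  ultimately show ?thesis by blast
qed

text \<open>The same argument with the projections exchanged: the lift is taken along
  \<open>q\<close>, and \<open>p\<close> extracts the structure on \<open>X\<close>.\<close>

lemma algebra_pullback:
  assumes P: "cofibrant (PROP_cat E CC) (PROP_model E CC M) P"
    and h: "\<And>c. c \<in> profiles CC \<Longrightarrow> cofibrant E M (X.T c) \<and> ft c \<in> fib M \<inter> weq M"
    and \<psi>: "is_algebra E CC P Y \<psi>"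
  shows "\<exists>\<phi>. is_algebra E CC P X \<phi> \<and> is_algebra_morphism E CC P X \<phi> Y \<psi> f"
proof -
  have \<psi>h: "(P, \<psi>, Y.Q) \<in> hom (PROP_cat E CC) P Y.Q" using \<psi> by (simp add: is_algebra_def)
  obtain \<beta> where \<beta>: "(P, \<beta>, PF) \<in> hom (PROP_cat E CC) P PF"
    "\<And>d c. d \<in> profiles CC \<Longrightarrow> c \<in> profiles CC \<Longrightarrow> q d c \<cdot> \<beta> d c = \<psi> d c"
    by (rule cofibrant_PROP_lift[OF P \<psi>h q_hom]) (use q_acyclic_fib h in blast)+
  let ?\<phi> = "\<lambda>d c. if d \<in> profiles CC \<and> c \<in> profiles CC then p d c \<cdot> \<beta> d c else undefined"
  have "is_algebra E CC P X ?\<phi>"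
    using PROP_cat_comp_hom[OF \<beta>(1) p_hom] XY_Obj by (simp add: is_algebra_def PROP_cat_comp)
  moreover have "is_algebra_morphism E CC P X ?\<phi> Y \<psi> f"
    using \<psi>h lift_compat[OF \<beta>(1)] \<beta>(2) by (intro algebra_morphism_if_compat) (auto simp: PROP_cat_hom)
  ultimately show ?thesis by blast
qed

end

theorem theorem1p2:
  fixes U :: "'u rel" and CC :: "'c set" and E :: "('o, 'a) smc" and M :: "'a model_str"
    and P :: "('c, 'o, 'a) colored_prop" and X Y :: "'c \<Rightarrow> 'o" and f :: "'c \<Rightarrow> 'a"
  assumes "strongly_inaccessible U"
    and "CC \<noteq> {}" and "|CC| <o U"
    and "symmetric_monoidal_model_category U E M"
    and "strongly_cofibrantly_generated U E M"
    and "\<exists>z. zero_object E z"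
    and "has_symmetric_monoidal_fibrant_replacement E M"
    and "(cofibrant E M (tunit E) \<and> has_cocommutative_interval E M) \<or> has_functorial_path_data E M"
    and "cofibrant (PROP_cat E CC) (PROP_model E CC M) P"
    and "\<forall>c \<in> CC. f c \<in> hom E (X c) (Y c)"
  shows
    "((\<forall>c \<in> profiles CC. fibrant E M (tens_obj E Y c) \<and> tens_arr E f c \<in> cof M \<inter> weq M) \<longrightarrow>
       (\<forall>\<phi>. is_algebra E CC P X \<phi> \<longrightarrow>
          (\<exists>\<psi>. is_algebra E CC P Y \<psi> \<and> is_algebra_morphism E CC P X \<phi> Y \<psi> f))) \<and>
     ((\<forall>c \<in> profiles CC. cofibrant E M (tens_obj E X c) \<and> tens_arr E f c \<in> fib M \<inter> weq M) \<longrightarrow>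
       (\<forall>\<psi>. is_algebra E CC P Y \<psi> \<longrightarrow>
          (\<exists>\<phi>. is_algebra E CC P X \<phi> \<and> is_algebra_morphism E CC P X \<phi> Y \<psi> f)))"
proof -
  interpret symmetric_monoidal_model_category U E M by (rule assms(4))
  have tf: "tensor_family E CC X Y f"
    by (intro tensor_family.intro tensor_family_axioms.intro closed_symmetric_monoidal_category_axioms)
      (use assms(10) in auto)
  have mf: "model_family U E M CC X Y f"
    by (intro model_family.intro model_family_axioms.intro assms(4) tf assms(1))
  obtain R p q where "morphism_PROP E CC X Y f R p q"
    using model_family.morphism_PROP_exists[OF mf] by blast
  then interpret model_morphism_PROP U E M CC X Y f R p q
    by (intro model_morphism_PROP.intro mf)
  show ?thesis using algebra_pushforward[OF assms(9)] algebra_pullback[OF assms(9)] by blast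
qed

end
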